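(* Let $\mathfrak a:a_1<\cdots<a_p$ and $\mathfrak b:b_1<\cdots<b_q$ be two sequences of elements of $\mathbb N_0=\{0,1,2,\ldots\}$, and let $w\in W_\infty$. Suppose that $w$ and $w^{-1}$ are compatible with $\mathfrak a$ and $\mathfrak b$, respectively. Then the Schubert polynomial $\mathfrak C_w(X;Y,Z)$ satisfies $$\mathfrak C_w=\sum G_{u_1}(0/Z_q)\cdots G_{u_{q-1}}(0/Z_2)\,J_{u_q}(X;Y_1/Z_1)\,G_{u_{q+1}}(Y_2)\cdots G_{u_{p+q-1}}(Y_p)$$ summed over all reduced factorizations $u_1\cdots u_{p+q-1}=w$ compatible with $\mathfrak a,\mathfrak b$.
   Context: $X=(x_1,x_2,\ldots)$, $Y=(y_1,y_2,\ldots)$, $Z=(z_1,z_2,\ldots)$ are commuting independent variables. $W_n$ is the group of signed permutations of $\{1,\ldots,n\}$ generated by $s_i=(i,i+1)$, $1\leq i\leq n-1$, and the sign change $s_0(1)=\overline1$; $W_\infty=\bigcup_nW_n$ (adjoining fixed points), and $S_\infty=\bigcup_nS_n\subset W_\infty$. $\ell$ is the length; $w$ has a descent at $r\in\mathbb N_0$ if $\ell(ws_r)<\ell(w)$. A reduced factorization $u_1\cdots u_m=w$ is one with $\ell(u_1)+\cdots+\ell(u_m)=\ell(w)$. The nilCoxeter algebra of $W_n$ is the free associative unital algebra on $u_0,\ldots,u_{n-1}$ modulo $u_i^2=0$; $u_iu_j=u_ju_i$ for $|i-j|\geq2$; $u_iu_{i+1}u_i=u_{i+1}u_iu_{i+1}$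 for $i>0$; $u_0u_1u_0u_1=u_1u_0u_1u_0$. It has basis $u_w=u_{a_1}\cdots u_{a_\ell}$, $w\in W_n$, for any reduced word $a_1\cdots a_\ell$ of $w$; $\langle\xi,w\rangle$ is the coefficient of $u_w$ in $\xi$. Set $A_i(t)=(1+tu_{n-1})\cdots(1+tu_i)$, $\tilde A_i(t)=(1-tu_i)\cdots(1-tu_{n-1})$, $C(t)=(1+tu_{n-1})\cdots(1+tu_1)(1+tu_0)(1+tu_0)(1+tu_1)\cdots(1+tu_{n-1})$, $C(X)=C(x_1)C(x_2)\cdots$, $A(Y)=A_1(y_1)A_1(y_2)\cdots$, $\tilde A(Z)=\tilde A_1(z_1)\tilde A_1(z_2)\cdots$. For $w\in W_n$ and $\varpi\in S_n$ define (all independent of $n$): - the type C double Schubert polynomial $\mathfrak C_w(X;Y,Z)=\langle\tilde A_{n-1}(z_{n-1})\cdots\tilde A_1(z_1)C(X)A_1(y_1)\cdots A_{n-1}(y_{n-1}),w\rangle$; - the double Stanley function $G_\varpi(Y/Z)=\langle\tilde A(Z)A(Y),\varpi\rangle$ and $G_\varpi(Y)=\langle A(Y),\varpi\rangle$ (so $G_\varpi(0/Z)=\langle\tilde A(Z),\varpi\rangle$); - the double mixed Stanley function $J_w(X;Y/Z)=\langle\tilde A(Z)C(X)A(Y),w\rangle$. $G_\varpi(Y/Z)$ is symmetric in $Y$ and in $Z$ separately, and $J_w(X;Y/Z)$ is separately symmetric in $X,Y,Z$, so they may be evaluated at finite sets of variables in place of $Y,Z$ (remaining variables set to $0$). Compatibility: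 an element $w\in W_\infty$ is compatible with $\mathfrak a$ if all descent positions of $w$ are contained in $\mathfrak a$. A reduced factorization $u_1\cdots u_{p+q-1}=w$ is compatible with $\mathfrak a,\mathfrak b$ if $u_i\in S_\infty$ for all $i\neq q$, and $u_j(i)=i$ whenever $j<q$ and $1\leq i\leq b_{q-j}$, or whenever $j>q$ and $1\leq i\leq a_{j-q}$. Here $Y_i=\{y_{a_{i-1}+1},\ldots,y_{a_i}\}$ and $Z_j=\{z_{b_{j-1}+1},\ldots,z_{b_j}\}$ for $i,j\geq1$, with $a_0=b_0=0$. *)

theory Defs
  imports "HOL-Library.Poly_Mapping"
begin

section \<open>Formal power series in arbitrarily many commuting variables\<close>

text \<open>Monomials are finitely supported exponent functions; a series is an arbitrary family of
  coefficients indexed by monomials, multiplied by convolution.\<close>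

typedef ('v, 'a) mseries = "UNIV :: (('v \<Rightarrow>\<^sub>0 nat) \<Rightarrow> 'a) set"
  morphisms mcoeff Abs_mseries ..

setup_lifting type_definition_mseries

lemma mseries_eqI: "(\<And>m. mcoeff f m = mcoeff g m) \<Longrightarrow> f = g"
  by transfer auto

definition splits :: "('v \<Rightarrow>\<^sub>0 nat) \<Rightarrow> (('v \<Rightarrow>\<^sub>0 nat) \<times> ('v \<Rightarrow>\<^sub>0 nat)) set" where
  "splits m = {(a, b). a + b = m}"

lemma finite_splits: "finite (splits m)"
proof -
  let ?F = "{f. \<forall>x. (x \<in> Poly_Mapping.keys m \<longrightarrow> f x \<in> {..sum (Poly_Mapping.lookup m) (Poly_Mapping.keys m)}) \<and> (x \<notin> Poly_Mapping.keys m \<longrightarrow> f x = 0)}"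
  have "finite ?F"
    by (rule finite_set_of_finite_funs) (rule finite_keys, rule finite_atMost)
  moreover have "Poly_Mapping.lookup ` fst ` splits m \<subseteq> ?F"
  proof clarify
    fix a b x assume "(a, b) \<in> splits m"
    then have "Poly_Mapping.lookup a x \<le> Poly_Mapping.lookup m x" for x
      by (auto simp: splits_def lookup_add)
    moreover have "Poly_Mapping.lookup m x \<le> sum (Poly_Mapping.lookup m) (Poly_Mapping.keys m)" if "x \<in> Poly_Mapping.keys m"
      using that by (simp add: member_le_sum)
    ultimately show "(x \<in> Poly_Mapping.keys m \<longrightarrow> Poly_Mapping.lookup (fst (a, b)) x \<in> {..sum (Poly_Mapping.lookup m) (Poly_Mapping.keys m)}) \<and>
      (x \<notin> Poly_Mapping.keys m \<longrightarrow> Poly_Mapping.lookup (fst (a, b)) x = 0)"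
      by (metis atMost_iff fst_conv in_keys_iff le_trans le_zero_eq)
  qed
  ultimately have "finite (Poly_Mapping.lookup ` fst ` splits m)"
    using finite_subset by blast
  then have "finite (fst ` splits m)"
    by (rule finite_imageD) (auto simp: inj_on_def poly_mapping_eqI)
  moreover have "inj_on fst (splits m)"
    by (auto simp: inj_on_def splits_def)
  ultimately show ?thesis
    using finite_imageD by blast
qed

instantiation mseries :: (type, comm_ring_1) comm_ring_1
begin

lift_definition zero_mseries :: "('a, 'b) mseries" is "\<lambda>_. 0" .
lift_definition one_mseries :: "('a, 'b) mseries" is "\<lambda>m. if m = 0 then 1 else 0" .
lift_definition plus_mseries :: "('a, 'b) mseries \<Rightarrow> ('a, 'b) mseries \<Rightarrow> ('a, 'b) mseries"
  is "\<lambda>f g m. f m + g m" .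
lift_definition minus_mseries :: "('a, 'b) mseries \<Rightarrow> ('a, 'b) mseries \<Rightarrow> ('a, 'b) mseries"
  is "\<lambda>f g m. f m - g m" .
lift_definition uminus_mseries :: "('a, 'b) mseries \<Rightarrow> ('a, 'b) mseries" is "\<lambda>f m. - f m" .
lift_definition times_mseries :: "('a, 'b) mseries \<Rightarrow> ('a, 'b) mseries \<Rightarrow> ('a, 'b) mseries"
  is "\<lambda>f g m. \<Sum>(a, b)\<in>splits m. f a * g b" .

instance
proof
  fix f g h :: "('a, 'b) mseries"
  show "f * g * h = f * (g * h)"
  proof (rule mseries_eqI)
    fix m
    have "mcoeff (f * g * h) m =
      (\<Sum>((p, c), (a, b))\<in>Sigma (splits m) (\<lambda>(p, c). splits p). mcoeff f a * mcoeff g b * mcoeff h c)"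
      by (simp add: times_mseries.rep_eq sum_distrib_right split_def sum.Sigma finite_splits)
    also have "\<dots> =
      (\<Sum>((a, q), (b, c))\<in>Sigma (splits m) (\<lambda>(a, q). splits q). mcoeff f a * mcoeff g b * mcoeff h c)"
      by (rule sum.reindex_bij_witness[where
            i = "\<lambda>((a, q), (b, c)). ((a + b, c), (a, b))" and
            j = "\<lambda>((p, c), (a, b)). ((a, b + c), (b, c))"])
         (auto simp: splits_def add.assoc)
    also have "\<dots> = mcoeff (f * (g * h)) m"
      by (simp add: times_mseries.rep_eq sum_distrib_left split_def sum.Sigma finite_splits mult.assoc)
    finally show "mcoeff (f * g * h) m = mcoeff (f * (g * h)) m" .
  qed
  show "f * g = g * f"
  proof (rule mseries_eqI)
    fix m
    show "mcoeff (f * g) m = mcoeff (g * f) m"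
      unfolding times_mseries.rep_eq
      by (rule sum.reindex_bij_witness[where i = prod.swap and j = prod.swap])
         (auto simp: splits_def add.commute mult.commute)
  qed
  show "1 * f = f"
  proof (rule mseries_eqI)
    fix m
    have "mcoeff (1 * f) m = (\<Sum>x\<in>splits m. if x = (0, m) then mcoeff f m else 0)"
      unfolding times_mseries.rep_eq one_mseries.rep_eq
      by (rule sum.cong) (auto simp: splits_def split: if_splits)
    also have "\<dots> = mcoeff f m"
      by (subst sum.delta) (auto simp: finite_splits, auto simp: splits_def)
    finally show "mcoeff (1 * f) m = mcoeff f m" .
  qed
  show "(f + g) * h = f * h + g * h"
    by (rule mseries_eqI)
       (simp add: times_mseries.rep_eq plus_mseries.rep_eq split_def distrib_right sum.distrib)
  show "(0 :: ('a, 'b) mseries) \<noteq> 1"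
    by (metis (full_types) one_mseries.rep_eq zero_mseries.rep_eq zero_neq_one)
qed (transfer; simp add: fun_eq_iff add_ac)+

end

lift_definition mvar :: "'v \<Rightarrow> ('v, 'a::comm_ring_1) mseries"
  is "\<lambda>v m. if m = Poly_Mapping.single v 1 then 1 else 0" .

text \<open>Limit for coefficientwise stabilisation; it gives the value of infinite products.\<close>

definition stable_limit :: "(nat \<Rightarrow> ('v, 'a) mseries) \<Rightarrow> ('v, 'a) mseries" where
  "stable_limit f = Abs_mseries (\<lambda>m. THE c. \<exists>N0. \<forall>N\<ge>N0. mcoeff (f N) m = c)"


section \<open>Signed permutations\<close>

text \<open>A signed permutation \<open>w\<close> is extended to all integers by \<open>w (- i) = - w i\<close>, and the product
  is composition of functions.\<close>

definition W :: "nat \<Rightarrow> (int \<Rightarrow> int) set" where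
  "W n = {w. bij w \<and> (\<forall>i. w (- i) = - w i) \<and> (\<forall>i. \<bar>i\<bar> > int n \<longrightarrow> w i = i)}"

definition W_inf :: "(int \<Rightarrow> int) set" where
  "W_inf = (\<Union>n. W n)"

definition S_inf :: "(int \<Rightarrow> int) set" where
  "S_inf = {w \<in> W_inf. \<forall>i>0. w i > 0}"

definition sgen :: "nat \<Rightarrow> int \<Rightarrow> int" where
  "sgen r = (if r = 0 then id(1 := - 1, - 1 := 1)
     else id(int r := int r + 1, int r + 1 := int r,
             - int r := - int r - 1, - int r - 1 := - int r))"

definition word_prod :: "nat list \<Rightarrow> int \<Rightarrow> int" where
  "word_prod as = foldr (\<circ>) (map sgen as) id"

definition cox_length :: "(int \<Rightarrow> int) \<Rightarrow> nat" where
  "cox_length w = (LEAST l. \<exists>as. length as = l \<and> word_prod as = w)"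

definition reduced_words :: "nat \<Rightarrow> (int \<Rightarrow> int) \<Rightarrow> nat list set" where
  "reduced_words n w = {as. set as \<subseteq> {..<n} \<and> word_prod as = w \<and> length as = cox_length w}"

definition descents :: "(int \<Rightarrow> int) \<Rightarrow> nat set" where
  "descents w = {r. cox_length (w \<circ> sgen r) < cox_length w}"


section \<open>The nilCoxeter algebra\<close>

text \<open>Words form a monoid under concatenation, so finitely supported functions on words, with the
  convolution product of \<^typ>\<open>'a \<Rightarrow>\<^sub>0 'b\<close>, are the free associative algebra.\<close>

datatype word = Word (letters: "nat list")

instantiation word :: monoid_add
begin
definition zero_word :: word where "zero_word = Word []"
definition plus_word :: "word \<Rightarrow> word \<Rightarrow> word" where "plus_word v w = Word (letters v @ letters w)"
instance by standard (auto simp: zero_word_def plus_word_def)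
end

type_synonym 'r free_alg = "word \<Rightarrow>\<^sub>0 'r"

definition tu :: "'r \<Rightarrow> nat \<Rightarrow> 'r::comm_ring_1 free_alg" where
  "tu t i = Poly_Mapping.single (Word [i]) t"

abbreviation ugen :: "nat \<Rightarrow> 'r::comm_ring_1 free_alg" where
  "ugen i \<equiv> tu 1 i"

definition free_carrier :: "nat \<Rightarrow> 'r::comm_ring_1 free_alg set" where
  "free_carrier n = {\<xi>. \<forall>v\<in>Poly_Mapping.keys \<xi>. set (letters v) \<subseteq> {..<n}}"

definition nil_relators :: "nat \<Rightarrow> 'r::comm_ring_1 free_alg set" where
  "nil_relators n =
     {ugen i * ugen i | i. i < n} \<union>
     {ugen i * ugen j - ugen j * ugen i | i j. i < n \<and> j < n \<and> \<bar>int i - int j\<bar> \<ge> 2} \<union>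
     {ugen i * ugen (i + 1) * ugen i - ugen (i + 1) * ugen i * ugen (i + 1) | i. 0 < i \<and> i + 1 < n} \<union>
     (if 1 < n then {ugen 0 * ugen 1 * ugen 0 * ugen 1 - ugen 1 * ugen 0 * ugen 1 * ugen 0} else {})"

inductive_set nil_ideal :: "nat \<Rightarrow> 'r::comm_ring_1 free_alg set" for n where
  relator: "\<rho> \<in> nil_relators n \<Longrightarrow> \<rho> \<in> nil_ideal n"
| zero: "0 \<in> nil_ideal n"
| add: "\<xi> \<in> nil_ideal n \<Longrightarrow> \<eta> \<in> nil_ideal n \<Longrightarrow> \<xi> + \<eta> \<in> nil_ideal n"
| mult_left: "\<alpha> \<in> free_carrier n \<Longrightarrow> \<xi> \<in> nil_ideal n \<Longrightarrow> \<alpha> * \<xi> \<in> nil_ideal n"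
| mult_right: "\<alpha> \<in> free_carrier n \<Longrightarrow> \<xi> \<in> nil_ideal n \<Longrightarrow> \<xi> * \<alpha> \<in> nil_ideal n"

text \<open>The nilCoxeter algebra of \<open>W n\<close> is \<open>free_carrier n\<close> modulo \<open>nil_ideal n\<close>; its elements are
  given below by representatives. \<open>nil_basis c w n\<close> represents \<open>c\<close> times the basis element
  indexed by \<open>w\<close>; modulo the ideal, it does not depend on the reduced word chosen.\<close>

definition nil_basis :: "'r \<Rightarrow> (int \<Rightarrow> int) \<Rightarrow> nat \<Rightarrow> 'r::comm_ring_1 free_alg" where
  "nil_basis c w n = Poly_Mapping.single (Word (SOME as. as \<in> reduced_words n w)) c"

text \<open>\<open>bracket n \<xi> w\<close> is the coefficient of \<open>w\<close> in the expansion, in the basis above, of the class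
  of \<open>\<xi>\<close>. It is meaningful for \<open>\<xi> \<in> free_carrier n\<close> and \<open>w \<in> W n\<close>.\<close>

definition bracket :: "nat \<Rightarrow> 'r::comm_ring_1 free_alg \<Rightarrow> (int \<Rightarrow> int) \<Rightarrow> 'r" where
  "bracket n \<xi> w = (THE c. \<exists>f. \<xi> - (\<Sum>v\<in>W n. nil_basis (f v) v n) \<in> nil_ideal n \<and> f w = c)"

definition A_fac :: "nat \<Rightarrow> nat \<Rightarrow> 'r \<Rightarrow> 'r::comm_ring_1 free_alg" where
  "A_fac n i t = (\<Prod>j\<leftarrow>rev [i..<n]. 1 + tu t j)"

definition A_tilde_fac :: "nat \<Rightarrow> nat \<Rightarrow> 'r \<Rightarrow> 'r::comm_ring_1 free_alg" where
  "A_tilde_fac n i t = (\<Prod>j\<leftarrow>[i..<n]. 1 - tu t j)"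

definition C_fac :: "nat \<Rightarrow> 'r \<Rightarrow> 'r::comm_ring_1 free_alg" where
  "C_fac n t = (\<Prod>j\<leftarrow>rev [0..<n] @ [0..<n]. 1 + tu t j)"


section \<open>Schubert polynomials and Stanley functions\<close>

text \<open>Alphabets \<open>x\<close>, \<open>y\<close>, \<open>z\<close> are sequences of ring elements indexed by \<open>1, 2, \<dots>\<close> (the value at
  \<open>0\<close> is never used); a finite alphabet is a sequence padded with zeros. The infinite products are
  truncated to the first \<open>N\<close> variables of each alphabet and the coefficients are then passed to
  the limit \<open>N \<longlonglongrightarrow> \<infinity>\<close>.\<close>

definition C_upto :: "nat \<Rightarrow> nat \<Rightarrow> (nat \<Rightarrow> 'r) \<Rightarrow> 'r::comm_ring_1 free_alg" where
  "C_upto N n x = (\<Prod>i\<leftarrow>[1..<N + 1]. C_fac n (x i))"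

definition A_upto :: "nat \<Rightarrow> nat \<Rightarrow> (nat \<Rightarrow> 'r) \<Rightarrow> 'r::comm_ring_1 free_alg" where
  "A_upto N n y = (\<Prod>i\<leftarrow>[1..<N + 1]. A_fac n 1 (y i))"

definition A_tilde_upto :: "nat \<Rightarrow> nat \<Rightarrow> (nat \<Rightarrow> 'r) \<Rightarrow> 'r::comm_ring_1 free_alg" where
  "A_tilde_upto N n z = (\<Prod>i\<leftarrow>[1..<N + 1]. A_tilde_fac n 1 (z i))"

text \<open>The functions below do not depend on the \<open>n\<close> with \<open>w \<in> W n\<close> that is used to compute them;
  the least one is taken. (For \<open>n = 0\<close> all the products are \<open>1\<close>, as is the value at \<open>w = id\<close>
  for every \<open>n\<close>.)\<close>

definition min_n :: "(int \<Rightarrow> int) \<Rightarrow> nat" where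
  "min_n w = (LEAST n. w \<in> W n)"

type_synonym 'v alphabet = "nat \<Rightarrow> ('v, int) mseries"

definition double_schubert ::
    "(int \<Rightarrow> int) \<Rightarrow> 'v alphabet \<Rightarrow> 'v alphabet \<Rightarrow> 'v alphabet \<Rightarrow> ('v, int) mseries" where
  "double_schubert w x y z = (let n = min_n w in stable_limit (\<lambda>N. bracket n
     ((\<Prod>i\<leftarrow>rev [1..<n]. A_tilde_fac n i (z i)) * C_upto N n x * (\<Prod>i\<leftarrow>[1..<n]. A_fac n i (y i))) w))"

definition double_stanley ::
    "(int \<Rightarrow> int) \<Rightarrow> 'v alphabet \<Rightarrow> 'v alphabet \<Rightarrow> ('v, int) mseries" where
  "double_stanley w y z = (let n = min_n w in stable_limit (\<lambda>N. bracket n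
     (A_tilde_upto N n z * A_upto N n y) w))"

definition stanley :: "(int \<Rightarrow> int) \<Rightarrow> 'v alphabet \<Rightarrow> ('v, int) mseries" where
  "stanley w y = (let n = min_n w in stable_limit (\<lambda>N. bracket n (A_upto N n y) w))"

definition mixed_stanley ::
    "(int \<Rightarrow> int) \<Rightarrow> 'v alphabet \<Rightarrow> 'v alphabet \<Rightarrow> 'v alphabet \<Rightarrow> ('v, int) mseries" where
  "mixed_stanley w x y z = (let n = min_n w in stable_limit (\<lambda>N. bracket n
     (A_tilde_upto N n z * C_upto N n x * A_upto N n y) w))"

datatype var = x_var nat | y_var nat | z_var nat

definition X :: "var alphabet" where "X i = mvar (x_var i)"
definition Y :: "var alphabet" where "Y i = mvar (y_var i)"
definition Z :: "var alphabet" where "Z i = mvar (z_var i)"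

text \<open>The \<open>i\<close>-th block \<open>v (c (i - 1) + 1), \<dots>, v (c i)\<close> of the alphabet \<open>v\<close>, where \<open>i \<ge> 1\<close>.\<close>

definition var_block :: "(nat \<Rightarrow> nat) \<Rightarrow> 'v alphabet \<Rightarrow> nat \<Rightarrow> 'v alphabet" where
  "var_block c v i = (\<lambda>k. if 1 \<le> k \<and> k \<le> c i - c (i - 1) then v (c (i - 1) + k) else 0)"


section \<open>Compatibility\<close>

text \<open>Sequences \<open>a\<^sub>1 < \<dots> < a\<^sub>p\<close> are functions on \<open>{1..p}\<close>. Factorizations are lists, whose
  \<open>j\<close>-th entry, counting from \<open>1\<close>, is \<open>entry us j\<close>.\<close>

definition compatible :: "(int \<Rightarrow> int) \<Rightarrow> nat \<Rightarrow> (nat \<Rightarrow> nat) \<Rightarrow> bool" where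
  "compatible w p a \<longleftrightarrow> descents w \<subseteq> a ` {1..p}"

definition entry :: "'b list \<Rightarrow> nat \<Rightarrow> 'b" where
  "entry us j = us ! (j - 1)"

definition reduced_factorization :: "(int \<Rightarrow> int) list \<Rightarrow> (int \<Rightarrow> int) \<Rightarrow> bool" where
  "reduced_factorization us w \<longleftrightarrow>
     set us \<subseteq> W_inf \<and> foldr (\<circ>) us id = w \<and> (\<Sum>v\<leftarrow>us. cox_length v) = cox_length w"

definition compatible_factorizations ::
    "nat \<Rightarrow> (nat \<Rightarrow> nat) \<Rightarrow> nat \<Rightarrow> (nat \<Rightarrow> nat) \<Rightarrow> (int \<Rightarrow> int) \<Rightarrow> (int \<Rightarrow> int) list set" where
  "compatible_factorizations p a q b w =
     {us. length us = p + q - 1 \<and> reduced_factorization us w \<and>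
       (\<forall>j\<in>{1..p + q - 1}.
          (j \<noteq> q \<longrightarrow> entry us j \<in> S_inf) \<and>
          (j < q \<longrightarrow> (\<forall>i\<in>{1..b (q - j)}. entry us j (int i) = int i)) \<and>
          (j > q \<longrightarrow> (\<forall>i\<in>{1..a (j - q)}. entry us j (int i) = int i)))}"

end

theory Submission
  imports Defs
begin

text \<open>
  Why the formula holds. In the nilCoxeter algebra put \<open>A\<^sub>i(t) = (1 + t u\<^sub>n\<^sub>-\<^sub>1) \<cdots> (1 + t u\<^sub>i)\<close>. The Schubert
  polynomial is a coefficient of a product whose right part is the staircase
  \<open>A\<^sub>1(y\<^sub>1) A\<^sub>2(y\<^sub>2) \<cdots>\<close>, whereas the functions on the right-hand side are coefficients of blocks
  \<open>A\<^sub>i(y\<^sub>i) A\<^sub>i(y\<^sub>i\<^sub>+\<^sub>1) \<cdots> A\<^sub>i(y\<^sub>d)\<close>, all factors of which start at the same letter.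

  A block is the corresponding piece \<open>A\<^sub>i(y\<^sub>i) A\<^sub>i\<^sub>+\<^sub>1(y\<^sub>i\<^sub>+\<^sub>1) \<cdots> A\<^sub>d(y\<^sub>d)\<close> of the staircase times an excess
  factor \<open>R\<close> that is a product of factors \<open>1 + t u\<^sub>j\<close> with \<open>i \<le> j < d\<close>
  (\<open>A_block_eq_staircase_mult\<close>): the letters left over from \<open>A\<^sub>i(y\<^sub>k)\<close> commute with the later staircase
  factors. If all further factors to the right only have letters beyond \<open>d\<close>, then \<open>R\<close> commutes with
  them as well and can be moved to the right end. There it has no effect on the coefficient of \<open>w\<close>
  if \<open>w\<close> has no descent \<open>j\<close> with \<open>i \<le> j < d\<close>, because a reduced word of \<open>w\<close> ends in a descent
  (\<open>ncoef_mult_unipotent\<close>). Cutting the staircase at the numbers \<open>a\<^sub>k\<close>, among which all descents of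
  \<open>w\<close> are found, it can therefore be replaced by blocks (\<open>right_block_reduction\<close>). Inverting
  \<open>w\<close> turns the left staircase into a right one (\<open>left_block_reduction\<close>); the order of the variables
  within a block is reversed thereby, which is harmless as \<open>A\<^sub>i(s)\<close> and \<open>A\<^sub>i(t)\<close> commute
  (\<open>A_class_commute\<close>).

  The coefficient of \<open>w\<close> in a product of blocks is the sum, over all reduced factorizations of \<open>w\<close>, of
  the products of the coefficients of the parts (\<open>ncoef_prod_list\<close>). A block with letters beyond
  \<open>c\<close> has a nonzero coefficient only at elements of \<open>S_inf\<close> that fix \<open>1, \<dots>, c\<close>
  (\<open>unipotent_ncoef_fixes_below\<close>), so that only compatible factorizations survive; and at such elements
  letters up to \<open>c\<close> do not matter, so that the coefficient is the value of a Stanley function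
  (\<open>stanley_var_block\<close>). All this happens for finitely many \<open>X\<close> variables, and one passes to the limit
  at the end.

  What makes these coefficients accessible is that the coefficient of \<open>u\<^sub>w\<close> is the sum of the
  coefficients of all reduced words of \<open>w\<close> in any representative (\<open>bracket_eq_coef\<close>). This rests on
  Matsumoto's theorem for signed permutations (\<open>reduced_words_nil_eq\<close>).
\<close>

section \<open>Length and descents of signed permutations\<close>

lemma W_I:
  assumes "bij w" "\<And>i. w (- i) = - w i" "\<And>i. int n < \<bar>i\<bar> \<Longrightarrow> w i = i"
  shows "w \<in> W n"
  using assms by (auto simp: W_def)

lemma W_mono: "m \<le> n \<Longrightarrow> W m \<subseteq> W n"
  by (auto simp: W_def)

lemma W_subset_W_inf: "w \<in> W n \<Longrightarrow> w \<in> W_inf"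
  by (auto simp: W_inf_def)

lemma id_in_W: "id \<in> W n"
  by (auto simp: W_def)

lemma comp_in_W: "v \<in> W n \<Longrightarrow> w \<in> W n \<Longrightarrow> v \<circ> w \<in> W n"
  unfolding W_def by (simp add: bij_comp)

lemma comp_in_W_inf:
  assumes "v \<in> W_inf" "w \<in> W_inf" shows "v \<circ> w \<in> W_inf"
proof -
  obtain m n where "v \<in> W m" "w \<in> W n"
    using assms by (auto simp: W_inf_def)
  then have "v \<in> W (max m n)" "w \<in> W (max m n)"
    using W_mono[of m "max m n"] W_mono[of n "max m n"] by auto
  then show ?thesis
    using comp_in_W W_subset_W_inf by blast
qed

lemma W_infD:
  assumes "w \<in> W_inf"
  shows "bij w" "w (- i) = - w i" "w 0 = 0" "w i = w j \<longleftrightarrow> i = j" "w i = 0 \<longleftrightarrow> i = 0"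
proof -
  obtain n where w: "w \<in> W n" using assms by (auto simp: W_inf_def)
  then show b: "bij w" and "w (- i) = - w i"
    by (auto simp: W_def)
  have "w (- 0) = - w 0" using w unfolding W_def by blast
  then show z: "w 0 = 0" by simp
  show "w i = w j \<longleftrightarrow> i = j" for i j
    using b by (metis bij_pointE)
  from this[of i 0] z show "w i = 0 \<longleftrightarrow> i = 0" by simp
qed

lemma sgen_simps:
  "sgen 0 1 = - 1" "sgen 0 (- 1) = 1"
  "\<bar>i\<bar> \<noteq> 1 \<Longrightarrow> sgen 0 i = i"
  "r > 0 \<Longrightarrow> sgen r (int r) = int r + 1"
  "r > 0 \<Longrightarrow> sgen r (int r + 1) = int r"
  "r > 0 \<Longrightarrow> sgen r (- int r) = - int r - 1"
  "r > 0 \<Longrightarrow> sgen r (- int r - 1) = - int r"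
  "r > 0 \<Longrightarrow> \<bar>i\<bar> \<noteq> int r \<Longrightarrow> \<bar>i\<bar> \<noteq> int r + 1 \<Longrightarrow> sgen r i = i"
  by (auto simp: sgen_def)

lemma sgen_sgen_apply [simp]: "sgen r (sgen r i) = i"
  by (auto simp: sgen_def)

lemma sgen_sgen [simp]: "sgen r \<circ> sgen r = id"
  by (simp add: fun_eq_iff)

lemma sgen_cancel [simp]: "w \<circ> sgen r \<circ> sgen r = w" "sgen r \<circ> (sgen r \<circ> w) = w"
  by (simp_all add: fun_eq_iff)

lemma sgen_eq_iff [simp]: "sgen r i = sgen r j \<longleftrightarrow> i = j"
  by (metis sgen_sgen_apply)

lemma bij_sgen: "bij (sgen r)"
  by (rule involuntory_imp_bij) simp

lemma sgen_in_W: "r < n \<Longrightarrow> sgen r \<in> W n"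
  by (rule W_I) (auto simp: bij_sgen, auto simp: sgen_def)

lemma sgen_in_W_inf: "sgen r \<in> W_inf"
  using sgen_in_W[of r "Suc r"] W_subset_W_inf by blast

lemma word_prod_Nil [simp]: "word_prod [] = id"
  and word_prod_Cons: "word_prod (r # as) = sgen r \<circ> word_prod as"
  by (simp_all add: word_prod_def)

lemma word_prod_append: "word_prod (as @ bs) = word_prod as \<circ> word_prod bs"
  by (induction as) (simp_all add: word_prod_Cons comp_assoc)

lemma word_prod_snoc: "word_prod (as @ [r]) = word_prod as \<circ> sgen r"
  by (simp add: word_prod_append word_prod_Cons)

lemma word_prod_in_W: "set as \<subseteq> {..<n} \<Longrightarrow> word_prod as \<in> W n"
  by (induction as) (auto simp: word_prod_Cons id_in_W intro!: comp_in_W sgen_in_W)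

lemma word_prod_in_W_inf: "word_prod as \<in> W_inf"
proof -
  obtain n where "set as \<subseteq> {..<n}"
    using finite_nat_set_iff_bounded[of "set as"] by auto
  then show ?thesis
    using W_subset_W_inf word_prod_in_W by blast
qed

text \<open>The one-line criterion for a right descent; lemma \<open>descents_iff\<close> matches it with the definition
  by length.\<close>

definition has_descent :: "(int \<Rightarrow> int) \<Rightarrow> nat \<Rightarrow> bool" where
  "has_descent w r \<longleftrightarrow> (if r = 0 then w 1 < 0 else w (int r + 1) < w (int r))"

definition inversions :: "(int \<Rightarrow> int) \<Rightarrow> (int \<times> int) set" where
  "inversions w = {(i, j). i < j \<and> w j < w i \<and> i \<noteq> 0 \<and> j \<noteq> 0}"

definition negatives :: "(int \<Rightarrow> int) \<Rightarrow> int set" where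
  "negatives w = {i. 0 < i \<and> w i < 0}"

text \<open>Twice the length: negating and exchanging the entries of a pair is an involution on inversions
  whose fixed points are the pairs \<open>(- i, i)\<close>, so an inversion outside these pairs is counted
  together with its mirror image, and adding \<open>negatives\<close> doubles the contribution of the fixed ones.
  Counting all pairs avoids the choice of a system of positive roots.\<close>

definition inv_number :: "(int \<Rightarrow> int) \<Rightarrow> nat" where
  "inv_number w = card (inversions w) + card (negatives w)"

lemma W_le:
  assumes "w \<in> W n" "\<bar>i\<bar> \<le> int n" shows "\<bar>w i\<bar> \<le> int n"
proof (rule ccontr)
  assume "\<not> ?thesis"
  then have "w (w i) = w i" using assms(1) by (auto simp: W_def)
  then have "w i = i" using W_infD(4)[OF W_subset_W_inf[OF assms(1)]] by blast
  with \<open>\<not> ?thesis\<close> assms(2) show False by simp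
qed

lemma W_fix: "w \<in> W n \<Longrightarrow> int n < \<bar>i\<bar> \<Longrightarrow> w i = i"
  by (simp add: W_def)

lemma finite_inversions:
  assumes "w \<in> W_inf" shows "finite (inversions w)" "finite (negatives w)"
proof -
  obtain n where w: "w \<in> W n" using assms by (auto simp: W_inf_def)
  have "inversions w \<subseteq> {- int n..int n} \<times> {- int n..int n}"
  proof clarify
    fix i j assume ij: "(i, j) \<in> inversions w"
    consider "\<bar>i\<bar> \<le> int n" "\<bar>j\<bar> \<le> int n" | "\<bar>i\<bar> \<le> int n" "int n < \<bar>j\<bar>"
      | "int n < \<bar>i\<bar>" "\<bar>j\<bar> \<le> int n" | "int n < \<bar>i\<bar>" "int n < \<bar>j\<bar>" by linarith
    then show "i \<in> {- int n..int n} \<and> j \<in> {- int n..int n}"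
      using ij W_fix[OF w, of i] W_fix[OF w, of j] W_le[OF w, of i] W_le[OF w, of j]
      by cases (auto simp: inversions_def abs_le_iff)
  qed
  then show "finite (inversions w)" by (rule finite_subset) simp
  have "negatives w \<subseteq> {- int n..int n}"
  proof
    fix i assume "i \<in> negatives w"
    then show "i \<in> {- int n..int n}"
      using W_fix[OF w, of i] by (cases "\<bar>i\<bar> \<le> int n") (auto simp: negatives_def)
  qed
  then show "finite (negatives w)" by (rule finite_subset) simp
qed

lemma sgen_zero [simp]: "sgen r 0 = 0"
  by (auto simp: sgen_def)

lemma sgen_eq_zero_iff [simp]: "sgen r i = 0 \<longleftrightarrow> i = 0"
  by (metis sgen_zero sgen_sgen_apply)

lemma sgen_less:
  assumes "i < j" "i \<noteq> 0" "j \<noteq> 0"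
    "r = 0 \<Longrightarrow> (i, j) \<noteq> (- 1, 1)" "r > 0 \<Longrightarrow> (i, j) \<noteq> (int r, int r + 1) \<and> (i, j) \<noteq> (- int r - 1, - int r)"
  shows "sgen r i < sgen r j"
  using assms by (cases "r = 0") (auto simp: sgen_def)

lemma sgen_pos_iff: "r > 0 \<Longrightarrow> 0 < sgen r i \<longleftrightarrow> 0 < i"
  by (auto simp: sgen_def)

lemma disjoint_imageI: "(\<And>x. x \<in> B \<Longrightarrow> g x \<notin> A) \<Longrightarrow> A \<inter> g ` B = {}"
  by auto

text \<open>Among pairs of nonzero integers, \<open>sgen r\<close> preserves the order of all but the pair \<open>(- 1, 1)\<close>, or the
  pairs \<open>(r, r + 1)\<close> and \<open>(- r - 1, - r)\<close>. So the inversions of \<open>w \<circ> sgen r\<close> are the image of those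
  of \<open>w\<close> together with these exceptional pairs, which at an ascent were not inversions. For
  \<open>r = 0\<close> there is one new inversion and one new negative value; for \<open>r > 0\<close> two new inversions.\<close>

lemma inv_number_ascent:
  assumes w: "w \<in> W_inf" and asc: "\<not> has_descent w r"
  shows "inv_number (w \<circ> sgen r) = inv_number w + 2"
proof -
  let ?s = "sgen r"
  let ?g = "\<lambda>(i, j). (?s i, ?s j)"
  have inj: "inj_on ?g A" for A by (auto simp: inj_on_def)
  have inj': "inj_on ?s A" for A by (auto simp: inj_on_def)
  note W_infD(2)[OF w, simp]
  note fin = finite_inversions[OF w]
  show ?thesis
  proof (cases "r = 0")
    case True
    then have pos: "0 < w 1"
      using asc W_infD(5)[OF w, of 1] by (auto simp: has_descent_def)
    have "inversions (w \<circ> ?s) = insert (- 1, 1) (?g ` inversions w)"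
    proof (intro equalityI subsetI)
      fix x assume x: "x \<in> inversions (w \<circ> ?s)"
      obtain i j where [simp]: "x = (i, j)" by force
      have "x = ?g (?s i, ?s j)" by simp
      moreover have "(?s i, ?s j) \<in> inversions w" if "x \<noteq> (- 1, 1)"
        using x that sgen_less[of i j r] True by (simp add: inversions_def)
      ultimately show "x \<in> insert (- 1, 1) (?g ` inversions w)" by blast
    next
      fix x assume "x \<in> insert (- 1, 1) (?g ` inversions w)"
      then consider "x = (- 1, 1)" | i j where "(i, j) \<in> inversions w" "x = (?s i, ?s j)" by auto
      then show "x \<in> inversions (w \<circ> ?s)"
      proof cases
        case 1
        then show ?thesis using True pos by (simp add: inversions_def sgen_simps)
      next
        case 2
        moreover have "(i, j) \<noteq> (- 1, 1)" using 2 pos by (auto simp: inversions_def)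
        ultimately show ?thesis using True sgen_less[of i j r] by (auto simp: inversions_def)
      qed
    qed
    moreover have "(- 1, 1) \<notin> ?g ` inversions w"
    proof
      assume "(- 1, 1) \<in> ?g ` inversions w"
      then obtain i j where "(i, j) \<in> inversions w" "?s i = - 1" "?s j = 1" by auto
      then have "i = ?s (- 1)" "j = ?s 1" by (metis sgen_sgen_apply)+
      with \<open>(i, j) \<in> inversions w\<close> True show False by (simp add: inversions_def sgen_simps)
    qed
    ultimately have 1: "card (inversions (w \<circ> ?s)) = card (inversions w) + 1"
      using fin by (simp add: card_image[OF inj])
    have "negatives (w \<circ> ?s) = insert 1 (negatives w)"
    proof (rule set_eqI)
      fix i show "i \<in> negatives (w \<circ> ?s) \<longleftrightarrow> i \<in> insert 1 (negatives w)"
        using True pos by (cases "i = 1") (auto simp: negatives_def sgen_simps)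
    qed
    moreover have "1 \<notin> negatives w" using pos by (simp add: negatives_def)
    ultimately have "card (negatives (w \<circ> ?s)) = card (negatives w) + 1"
      using fin by simp
    with 1 show ?thesis by (simp add: inv_number_def)
  next
    case False
    then have r: "r > 0" by simp
    then have lt: "w (int r) < w (int r + 1)"
      using asc W_infD(4)[OF w, of "int r + 1" "int r"] by (simp add: has_descent_def)
    have neg: "w (- int r - 1) = - w (int r + 1)"
      using W_infD(2)[OF w, of "int r + 1"] by simp
    note s = sgen_simps(4-7)[OF r]
    let ?A = "{(int r, int r + 1), (- int r - 1, - int r)}"
    have "inversions (w \<circ> ?s) = ?A \<union> ?g ` inversions w"
    proof (intro equalityI subsetI)
      fix x assume x: "x \<in> inversions (w \<circ> ?s)"
      obtain i j where [simp]: "x = (i, j)" by force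
      have "x = ?g (?s i, ?s j)" by simp
      moreover have "(?s i, ?s j) \<in> inversions w" if "x \<notin> ?A"
        using x that sgen_less[of i j r] r by (simp add: inversions_def)
      ultimately show "x \<in> ?A \<union> ?g ` inversions w" by blast
    next
      fix x assume "x \<in> ?A \<union> ?g ` inversions w"
      then consider "x = (int r, int r + 1)" | "x = (- int r - 1, - int r)"
        | i j where "(i, j) \<in> inversions w" "x = (?s i, ?s j)" by auto
      then show "x \<in> inversions (w \<circ> ?s)"
      proof cases
        case 3
        moreover have "(i, j) \<notin> ?A" using 3 lt neg by (auto simp: inversions_def)
        ultimately show ?thesis using r sgen_less[of i j r] by (auto simp: inversions_def)
      next
        case 1
        then show ?thesis using r lt by (simp add: inversions_def s)
      next
        case 2
        then show ?thesis using r lt neg by (simp add: inversions_def s)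
      qed
    qed
    moreover have "?g x \<notin> ?A" if "x \<in> inversions w" for x
    proof
      assume A: "?g x \<in> ?A"
      obtain i j where x: "x = (i, j)" by (cases x)
      have lt: "i < j" using that by (simp add: x inversions_def)
      have i: "i = ?s (?s i)" and j: "j = ?s (?s j)" by simp_all
      from A consider "?s i = int r" "?s j = int r + 1" | "?s i = - int r - 1" "?s j = - int r"
        by (auto simp: x)
      then show False
      proof cases
        case 1
        then show ?thesis using i j lt unfolding 1 s by linarith
      next
        case 2
        then show ?thesis using i j lt unfolding 2 s by linarith
      qed
    qed
    then have "?A \<inter> ?g ` inversions w = {}" by (rule disjoint_imageI)
    ultimately have 1: "card (inversions (w \<circ> ?s)) = card (inversions w) + 2"
      using fin by (simp add: card_image[OF inj] card_Un_disjoint)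
    have "negatives (w \<circ> ?s) = ?s ` negatives w"
    proof (intro equalityI subsetI)
      fix i assume "i \<in> negatives (w \<circ> ?s)"
      then have "?s i \<in> negatives w" using r by (simp add: negatives_def sgen_pos_iff)
      then show "i \<in> ?s ` negatives w" by (metis image_eqI sgen_sgen_apply)
    qed (use r in \<open>auto simp: negatives_def sgen_pos_iff\<close>)
    then have "card (negatives (w \<circ> ?s)) = card (negatives w)"
      by (simp add: card_image[OF inj'])
    with 1 show ?thesis by (simp add: inv_number_def)
  qed
qed

lemma has_descent_sgen:
  assumes w: "w \<in> W_inf"
  shows "has_descent (w \<circ> sgen r) r \<longleftrightarrow> \<not> has_descent w r"
  using W_infD(4)[OF w, of "int r + 1" "int r"] W_infD(5)[OF w, of 1] W_infD(2)[OF w, of 1]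
  by (cases "r = 0") (auto simp: has_descent_def sgen_simps)

lemma inv_number_descent:
  assumes w: "w \<in> W_inf" and "has_descent w r"
  shows "inv_number w = inv_number (w \<circ> sgen r) + 2"
  using inv_number_ascent[of "w \<circ> sgen r" r] assms
  by (simp add: comp_in_W_inf sgen_in_W_inf has_descent_sgen)

lemma inv_number_id: "inv_number id = 0"
proof -
  have "inversions id = {}" "negatives id = {}"
    by (auto simp: inversions_def negatives_def)
  then show ?thesis by (simp add: inv_number_def)
qed

text \<open>Without descents, \<open>w\<close> is strictly increasing on the nonnegative integers and \<open>w 0 = 0\<close>, whence
  \<open>w k \<ge> k\<close>; since \<open>w\<close> fixes all large integers, descending from there gives \<open>w k \<le> k\<close>.\<close>

lemma no_descent_imp_id:
  assumes w: "w \<in> W_inf" and nd: "\<And>r. \<not> has_descent w r"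
  shows "w = id"
proof -
  obtain n where wn: "w \<in> W n" using w by (auto simp: W_inf_def)
  have step: "w (int r) < w (int r + 1)" for r
    using nd[of r] W_infD(3)[OF w] W_infD(4)[OF w, of "int r + 1" "int r"] W_infD(5)[OF w, of 1]
    by (cases "r = 0") (auto simp: has_descent_def)
  have lower: "int k \<le> w (int k)" for k
  proof (induction k)
    case (Suc k)
    then show ?case using step[of k] by (simp add: add.commute)
  qed (simp add: W_infD(3)[OF w])
  have upper: "w (int k) \<le> int k" if "k \<le> Suc n" for k
    using that
  proof (induction k rule: inc_induct)
    case base
    show ?case using W_fix[OF wn, of "int (Suc n)"] by simp
  next
    case (step m)
    then show ?case using \<open>\<And>r. w (int r) < w (int r + 1)\<close>[of m] by (simp add: add.commute)
  qed
  have nat: "w (int k) = int k" for k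
  proof (cases "k \<le> Suc n")
    case True
    then show ?thesis using lower[of k] upper[of k] by simp
  next
    case False
    then show ?thesis using W_fix[OF wn, of "int k"] by simp
  qed
  show "w = id"
  proof
    fix i :: int
    show "w i = id i"
      using nat W_infD(2)[OF w] by (cases i rule: int_cases2) auto
  qed
qed

lemma has_descent_less:
  assumes "w \<in> W n" "has_descent w r" shows "r < n"
proof (rule ccontr)
  assume "\<not> r < n"
  then have r: "n \<le> r" by simp
  have 1: "w (int r + 1) = int r + 1" using r W_fix[OF assms(1), of "int r + 1"] by simp
  have "\<bar>w (int r)\<bar> \<le> int r"
    using r W_fix[OF assms(1), of "int r"] W_le[OF assms(1), of "int r"] by (cases "r = n") auto
  with 1 assms(2) show False by (auto simp: has_descent_def split: if_splits)
qed

text \<open>Sorting: as long as there is a descent, multiplying by it lowers \<open>inv_number\<close> by 2 and stays in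
  \<open>W n\<close>.\<close>

lemma exists_reduced_word:
  assumes "w \<in> W n"
  shows "\<exists>as. set as \<subseteq> {..<n} \<and> word_prod as = w \<and> 2 * length as = inv_number w"
  using assms
proof (induction "inv_number w" arbitrary: w rule: less_induct)
  case less
  have w: "w \<in> W_inf" using less.prems W_subset_W_inf by blast
  show ?case
  proof (cases "\<exists>r. has_descent w r")
    case False
    then have id: "w = id" using no_descent_imp_id w by blast
    have "word_prod [] = w" "inv_number w = 0"
      unfolding id by (rule word_prod_Nil, rule inv_number_id)
    then show ?thesis by (intro exI[of _ "[]"]) simp
  next
    case True
    then obtain r where r: "has_descent w r" by blast
    have rn: "r < n" using has_descent_less less.prems r by blast
    have "w \<circ> sgen r \<in> W n" using less.prems rn by (simp add: comp_in_W sgen_in_W)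
    from less.hyps[OF _ this] inv_number_descent[OF w r] obtain as where
      "set as \<subseteq> {..<n}" "word_prod as = w \<circ> sgen r" "2 * length as = inv_number (w \<circ> sgen r)"
      by auto
    then show ?thesis
      using rn inv_number_descent[OF w r]
      by (intro exI[of _ "as @ [r]"]) (simp add: word_prod_snoc)
  qed
qed

lemma inv_number_word_prod: "inv_number (word_prod as) \<le> 2 * length as"
proof (induction as rule: rev_induct)
  case Nil
  show ?case unfolding word_prod_Nil inv_number_id by simp
next
  case (snoc r as)
  have "inv_number (word_prod as \<circ> sgen r) \<le> inv_number (word_prod as) + 2"
    using inv_number_ascent[OF word_prod_in_W_inf, of as r] inv_number_descent[OF word_prod_in_W_inf, of as r]
    by (cases "has_descent (word_prod as) r") auto
  with snoc have "inv_number (word_prod (as @ [r])) \<le> 2 * length (as @ [r])"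
    unfolding word_prod_snoc by simp
  then show ?case .
qed

lemma inv_number_eq_length:
  assumes "w \<in> W_inf" shows "inv_number w = 2 * cox_length w"
proof -
  obtain n where "w \<in> W n" using assms by (auto simp: W_inf_def)
  from exists_reduced_word[OF this] obtain as where as: "word_prod as = w" "2 * length as = inv_number w"
    by blast
  have "cox_length w = length as"
    unfolding cox_length_def
  proof (rule Least_equality)
    fix l assume "\<exists>as. length as = l \<and> word_prod as = w"
    then show "length as \<le> l" using inv_number_word_prod as by (metis mult_le_cancel1 zero_less_numeral)
  qed (use as in blast)
  then show ?thesis using as by simp
qed

lemma cox_length_descent: "w \<in> W_inf \<Longrightarrow> has_descent w r \<Longrightarrow> cox_length w = Suc (cox_length (w \<circ> sgen r))"
  using inv_number_descent[of w r] by (simp add: inv_number_eq_length comp_in_W_inf sgen_in_W_inf)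

lemma cox_length_ascent: "w \<in> W_inf \<Longrightarrow> \<not> has_descent w r \<Longrightarrow> cox_length (w \<circ> sgen r) = Suc (cox_length w)"
  using inv_number_ascent[of w r] by (simp add: inv_number_eq_length comp_in_W_inf sgen_in_W_inf)

lemma descents_iff: "w \<in> W_inf \<Longrightarrow> r \<in> descents w \<longleftrightarrow> has_descent w r"
  using cox_length_descent[of w r] cox_length_ascent[of w r]
  by (cases "has_descent w r") (simp_all add: descents_def)

lemma cox_length_word_prod: "cox_length (word_prod as) \<le> length as"
  unfolding cox_length_def by (rule Least_le) blast

text \<open>Unlike \<open>reduced_words n\<close>, this puts no bound on the letters; for elements of \<open>W n\<close> the bound is
  automatic, by lemma \<open>red_words_letters\<close>.\<close>

definition red_words :: "(int \<Rightarrow> int) \<Rightarrow> nat list set" where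
  "red_words w = {as. word_prod as = w \<and> length as = cox_length w}"

lemma red_words_I: "word_prod as = w \<Longrightarrow> length as \<le> cox_length w \<Longrightarrow> as \<in> red_words w"
  using cox_length_word_prod[of as] by (auto simp: red_words_def)

lemma red_words_W_inf: "as \<in> red_words w \<Longrightarrow> w \<in> W_inf"
  using word_prod_in_W_inf by (auto simp: red_words_def)

lemma reduced_words_nonempty: "w \<in> W n \<Longrightarrow> \<exists>as. as \<in> reduced_words n w"
  using exists_reduced_word[of w n] inv_number_eq_length[of w] W_subset_W_inf[of w n]
  by (auto simp: reduced_words_def)

lemma red_words_nonempty: "w \<in> W_inf \<Longrightarrow> red_words w \<noteq> {}"
  using reduced_words_nonempty by (auto simp: W_inf_def red_words_def reduced_words_def)

lemma cox_length_id [simp]: "cox_length id = 0"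
  using cox_length_word_prod[of "[]"] by simp

lemma cox_length_eq_0: "w \<in> W_inf \<Longrightarrow> cox_length w = 0 \<Longrightarrow> w = id"
  using red_words_nonempty by (fastforce simp: red_words_def)

lemma red_words_id [simp]: "red_words id = {[]}"
  by (auto simp: red_words_def)

text \<open>The last letter of a reduced word is a descent. Peeling off last letters is the form in which
  reduced words enter all inductions below.\<close>

lemma red_words_snoc_iff: "as @ [r] \<in> red_words w \<longleftrightarrow> w \<in> W_inf \<and> has_descent w r \<and> as \<in> red_words (w \<circ> sgen r)"
proof
  assume L: "as @ [r] \<in> red_words w"
  then have w: "w \<in> W_inf" by (rule red_words_W_inf)
  have as: "word_prod as = w \<circ> sgen r" "Suc (length as) = cox_length w"
    using L by (auto simp: red_words_def word_prod_snoc)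
  then have "has_descent w r"
    using cox_length_ascent[OF w, of r] cox_length_word_prod[of as] by force
  with as w show "w \<in> W_inf \<and> has_descent w r \<and> as \<in> red_words (w \<circ> sgen r)"
    using cox_length_descent[OF w, of r] by (simp add: red_words_def)
next
  assume R: "w \<in> W_inf \<and> has_descent w r \<and> as \<in> red_words (w \<circ> sgen r)"
  then show "as @ [r] \<in> red_words w"
    using cox_length_descent[of w r] by (simp add: red_words_def word_prod_snoc)
qed

text \<open>This is why coefficients at an element of \<open>W n\<close> ignore all generators with index at least \<open>n\<close>.\<close>

lemma red_words_letters:
  assumes "w \<in> W n" "as \<in> red_words w" shows "set as \<subseteq> {..<n}"
  using assms
proof (induction as arbitrary: w rule: rev_induct)
  case (snoc r as)
  then have "has_descent w r" "as \<in> red_words (w \<circ> sgen r)" by (auto simp: red_words_snoc_iff)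
  then show ?case
    using snoc has_descent_less[of w n r] comp_in_W[of w n "sgen r"] sgen_in_W[of r n] by auto
qed simp

lemma red_words_W: "as \<in> red_words w \<Longrightarrow> set as \<subseteq> {..<n} \<Longrightarrow> w \<in> W n"
  using word_prod_in_W by (auto simp: red_words_def)

lemma reduced_words_eq_red_words: "w \<in> W n \<Longrightarrow> reduced_words n w = red_words w"
  using red_words_letters by (auto simp: reduced_words_def red_words_def)

lemma finite_red_words: "finite (red_words w)"
proof (cases "w \<in> W_inf")
  case True
  then obtain n where "w \<in> W n" by (auto simp: W_inf_def)
  then have "red_words w \<subseteq> {as. set as \<subseteq> {..<n} \<and> length as = cox_length w}"
    using red_words_letters by (auto simp: red_words_def)
  then show ?thesis
    by (rule finite_subset) (simp add: finite_lists_length_eq)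
next
  case False
  then have "red_words w = {}" using red_words_W_inf by auto
  then show ?thesis by simp
qed

lemma finite_W: "finite (W n)"
proof -
  let ?I = "{- int n..int n}"
  let ?r = "\<lambda>(w :: int \<Rightarrow> int) i. if i \<in> ?I then w i else 0"
  have "?r ` W n \<subseteq> {f. \<forall>i. (i \<in> ?I \<longrightarrow> f i \<in> ?I) \<and> (i \<notin> ?I \<longrightarrow> f i = 0)}"
    using W_le by (force simp: abs_le_iff)
  then have "finite (?r ` W n)"
    by (rule finite_subset) (rule finite_set_of_finite_funs; simp)
  moreover have "inj_on ?r (W n)"
  proof (rule inj_onI, rule ext)
    fix v w i assume "v \<in> W n" "w \<in> W n" "?r v = ?r w"
    then show "v i = w i"
      using fun_cong[of "?r v" "?r w" i] W_fix[of v n i] W_fix[of w n i] by (cases "i \<in> ?I") auto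
  qed
  ultimately show ?thesis by (rule finite_imageD)
qed

lemma red_words_rev:
  assumes "as \<in> red_words w" shows "word_prod (rev as) = inv w"
proof -
  have "word_prod (rev as) \<circ> word_prod as = id" for as
    by (induction as) (simp_all add: word_prod_append word_prod_Cons fun_eq_iff)
  from this[of as] this[of "rev as"] have "word_prod (rev as) = inv (word_prod as)"
    by (metis inv_unique_comp rev_rev_ident)
  with assms show ?thesis by (simp add: red_words_def)
qed

lemma inv_in_W_inf:
  assumes "w \<in> W_inf" shows "inv w \<in> W_inf"
  using red_words_nonempty[OF assms] red_words_rev word_prod_in_W_inf by (metis ex_in_conv)

lemma inv_inv_W_inf: "w \<in> W_inf \<Longrightarrow> inv (inv w) = w"
  by (simp add: W_infD(1) inv_inv_eq)

lemma cox_length_inv: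
  assumes "w \<in> W_inf" shows "cox_length (inv w) = cox_length w"
proof -
  have le: "cox_length (inv w) \<le> cox_length w" if "w \<in> W_inf" for w
  proof -
    obtain as where as: "as \<in> red_words w" using red_words_nonempty[OF \<open>w \<in> W_inf\<close>] by blast
    show ?thesis
      using cox_length_word_prod[of "rev as"] as by (simp add: red_words_rev) (simp add: red_words_def)
  qed
  show ?thesis using le[OF assms] le[OF inv_in_W_inf[OF assms]] by (simp add: inv_inv_W_inf assms)
qed

section \<open>Coefficients in the nilCoxeter algebra\<close>

text \<open>The coefficient of \<open>u\<^sub>w\<close>, read off from a representative: it is the linear functional that is 1 on
  the reduced words of \<open>w\<close> and 0 on all other words. It is defined on the whole free algebra and for
  all ranks at once; lemma \<open>bracket_eq_coef\<close> identifies it with \<open>bracket\<close>.\<close>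

definition coef :: "(int \<Rightarrow> int) \<Rightarrow> 'r::comm_ring_1 free_alg \<Rightarrow> 'r" where
  "coef w \<xi> = (\<Sum>as\<in>red_words w. Poly_Mapping.lookup \<xi> (Word as))"

lemma coef_zero [simp]: "coef w 0 = 0"
  and coef_add: "coef w (\<xi> + \<eta>) = coef w \<xi> + coef w \<eta>"
  and coef_diff: "coef w (\<xi> - \<eta>) = coef w \<xi> - coef w \<eta>"
  and coef_uminus: "coef w (- \<xi>) = - coef w \<xi>"
  by (simp_all add: coef_def lookup_add lookup_minus sum.distrib sum_subtractf sum_negf)

lemma coef_sum: "coef w (\<Sum>i\<in>I. f i) = (\<Sum>i\<in>I. coef w (f i))"
  by (induction I rule: infinite_finite_induct) (simp_all add: coef_add)

lemma coef_single: "coef w (Poly_Mapping.single (Word as) c) = (if as \<in> red_words w then c else 0)"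
proof -
  have "coef w (Poly_Mapping.single (Word as) c) = (\<Sum>bs\<in>red_words w. if bs = as then c else 0)"
    unfolding coef_def by (rule sum.cong) (auto simp: lookup_single when_def)
  then show ?thesis by (simp add: finite_red_words)
qed

lemma lookup_mult_word:
  "Poly_Mapping.lookup (\<xi> * \<eta> :: 'r::comm_ring_1 free_alg) (Word as) =
   (\<Sum>i\<le>length as. Poly_Mapping.lookup \<xi> (Word (take i as)) * Poly_Mapping.lookup \<eta> (Word (drop i as)))"
proof -
  let ?f = "Poly_Mapping.lookup \<xi>" and ?g = "Poly_Mapping.lookup \<eta>"
  let ?split = "\<lambda>i. (Word (take i as), Word (drop i as))"
  have sub: "{(u, v). Word as = u + v} \<subseteq> ?split ` {..length as}"
  proof clarify
    fix u v assume "Word as = u + v"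
    then have "as = letters u @ letters v" by (simp add: plus_word_def)
    then show "(u, v) \<in> ?split ` {..length as}"
      by (intro image_eqI[of _ _ "length (letters u)"]) auto
  qed
  have "Poly_Mapping.lookup (\<xi> * \<eta>) (Word as) = (\<Sum>(u, v). ?f u * ?g v when Word as = u + v)"
    unfolding times_poly_mapping.rep_eq by (rule prod_fun_unfold_prod) (simp_all add: finite_lookup)
  also have "\<dots> = (\<Sum>(u, v)\<in>?split ` {..length as}. ?f u * ?g v when Word as = u + v)"
    using sub by (intro Sum_any.expand_superset) auto
  also have "\<dots> = (\<Sum>i\<le>length as. ?f (Word (take i as)) * ?g (Word (drop i as)))"
  proof (subst sum.reindex)
    show "inj_on ?split {..length as}"
      by (rule inj_onI) (metis Pair_inject atMost_iff length_take min.absorb2 word.inject)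
  qed (simp add: plus_word_def)
  finally show ?thesis .
qed

definition red_splits :: "(int \<Rightarrow> int) \<Rightarrow> ((int \<Rightarrow> int) \<times> (int \<Rightarrow> int)) set" where
  "red_splits w = {(u, v). u \<in> W_inf \<and> v \<in> W_inf \<and> u \<circ> v = w \<and> cox_length u + cox_length v = cox_length w}"

lemma cox_length_comp_le:
  assumes "u \<in> W_inf" "v \<in> W_inf"
  shows "cox_length (u \<circ> v) \<le> cox_length u + cox_length v"
proof -
  obtain bs cs where bs: "bs \<in> red_words u" and cs: "cs \<in> red_words v"
    using red_words_nonempty[OF assms(1)] red_words_nonempty[OF assms(2)] by blast
  then show ?thesis
    using cox_length_word_prod[of "bs @ cs"] by (simp add: red_words_def word_prod_append)
qed

lemma red_words_append_iff:
  "bs @ cs \<in> red_words w \<longleftrightarrow> (word_prod bs, word_prod cs) \<in> red_splits w \<and> bs \<in> red_words (word_prod bs) \<and> cs \<in> red_words (word_prod cs)"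
proof
  assume L: "bs @ cs \<in> red_words w"
  then have "word_prod bs \<circ> word_prod cs = w" "length bs + length cs = cox_length w"
    by (auto simp: red_words_def word_prod_append)
  moreover have "cox_length (word_prod bs \<circ> word_prod cs) \<le> cox_length (word_prod bs) + cox_length (word_prod cs)"
    by (intro cox_length_comp_le word_prod_in_W_inf)
  moreover note cox_length_word_prod[of bs] cox_length_word_prod[of cs]
    word_prod_in_W_inf[of bs] word_prod_in_W_inf[of cs]
  ultimately show "(word_prod bs, word_prod cs) \<in> red_splits w \<and> bs \<in> red_words (word_prod bs) \<and> cs \<in> red_words (word_prod cs)"
    by (simp add: red_splits_def red_words_def)
qed (auto simp: red_splits_def red_words_def word_prod_append)

lemma finite_red_splits: "finite (red_splits w)"
proof -
  have "red_splits w \<subseteq> (\<lambda>(as, i). (word_prod (take i as), word_prod (drop i as))) ` (SIGMA as:red_words w. {..length as})"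
  proof clarify
    fix u v assume uv: "(u, v) \<in> red_splits w"
    then obtain bs cs where bs: "bs \<in> red_words u" and cs: "cs \<in> red_words v"
      using red_words_nonempty unfolding red_splits_def by blast
    then have "word_prod bs = u" "word_prod cs = v" by (auto simp: red_words_def)
    moreover from this have "bs @ cs \<in> red_words w" using uv bs cs by (auto simp: red_words_append_iff)
    ultimately show "(u, v) \<in> (\<lambda>(as, i). (word_prod (take i as), word_prod (drop i as))) ` (SIGMA as:red_words w. {..length as})"
      by (intro image_eqI[of _ _ "(bs @ cs, length bs)"]) auto
  qed
  then show ?thesis by (rule finite_subset) (simp add: finite_red_words)
qed

text \<open>Cutting a reduced word of \<open>w\<close> into two pieces is the same as choosing a length-additive
  factorization \<open>w = u \<circ> v\<close> and reduced words of both factors. Hence the functionals \<open>coef\<close> satisfy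
  this coproduct rule, from which everything about products of the factors \<open>1 + t u\<^sub>j\<close> is derived.\<close>

lemma coef_mult: "coef w (\<xi> * \<eta>) = (\<Sum>(u, v)\<in>red_splits w. coef u \<xi> * coef v \<eta>)"
proof -
  let ?f = "\<lambda>as. Poly_Mapping.lookup \<xi> (Word as)" and ?g = "\<lambda>as. Poly_Mapping.lookup \<eta> (Word as)"
  have "coef w (\<xi> * \<eta>) = (\<Sum>(as, i)\<in>(SIGMA as:red_words w. {..length as}). ?f (take i as) * ?g (drop i as))"
    unfolding coef_def lookup_mult_word by (rule sum.Sigma) (simp_all add: finite_red_words)
  also have "\<dots> = (\<Sum>((u, v), (bs, cs))\<in>(SIGMA (u, v):red_splits w. red_words u \<times> red_words v). ?f bs * ?g cs)"
  proof (rule sum.reindex_bij_witness[where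
        i = "\<lambda>((u, v), (bs, cs)). (bs @ cs, length bs)" and
        j = "\<lambda>(as, i). ((word_prod (take i as), word_prod (drop i as)), (take i as, drop i as))"])
    fix x assume "x \<in> (SIGMA as:red_words w. {..length as})"
    then obtain as i where x: "x = (as, i)" "as \<in> red_words w" "i \<le> length as" by auto
    then show "(\<lambda>(as, i). ((word_prod (take i as), word_prod (drop i as)), (take i as, drop i as))) x
        \<in> (SIGMA (u, v):red_splits w. red_words u \<times> red_words v)"
      using red_words_append_iff[of "take i as" "drop i as" w] by simp
  next
    fix y assume "y \<in> (SIGMA (u, v):red_splits w. red_words u \<times> red_words v)"
    then obtain u v bs cs where y: "y = ((u, v), (bs, cs))" "(u, v) \<in> red_splits w" "bs \<in> red_words u" "cs \<in> red_words v"
      by auto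
    then have [simp]: "word_prod bs = u" "word_prod cs = v" by (auto simp: red_words_def)
    show "(\<lambda>((u, v), (bs, cs)). (bs @ cs, length bs)) y \<in> (SIGMA as:red_words w. {..length as})"
      using y by (simp add: red_words_append_iff)
    show "(\<lambda>(as, i). ((word_prod (take i as), word_prod (drop i as)), (take i as, drop i as)))
        ((\<lambda>((u, v), (bs, cs)). (bs @ cs, length bs)) y) = y"
      by (simp add: y(1))
  qed auto
  also have "\<dots> = (\<Sum>(u, v)\<in>red_splits w. \<Sum>(bs, cs)\<in>red_words u \<times> red_words v. ?f bs * ?g cs)"
    by (subst sum.Sigma[symmetric]) (auto simp: finite_red_splits finite_red_words split_def)
  also have "\<dots> = (\<Sum>(u, v)\<in>red_splits w. coef u \<xi> * coef v \<eta>)"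
    by (simp add: coef_def sum_product sum.cartesian_product)
  finally show ?thesis .
qed

abbreviation monomial :: "nat list \<Rightarrow> 'r::comm_ring_1 free_alg" where
  "monomial as \<equiv> Poly_Mapping.single (Word as) 1"

lemma monomial_mult: "monomial as * monomial bs = monomial (as @ bs)"
  by (simp add: mult_single plus_word_def)

lemma monomial_Nil: "monomial [] = 1"
  by (simp add: zero_word_def[symmetric])

lemma single_eq_monomial: "Poly_Mapping.single (Word as) c = Poly_Mapping.single 0 c * monomial as"
  by (simp add: mult_single)

lemma ugen_monomial: "ugen i = monomial [i]"
  by (simp add: tu_def)

lemma tu_eq: "tu t i = Poly_Mapping.single 0 t * ugen i"
  by (simp add: tu_def mult_single)

lemma W_inf_eqI:
  assumes "u \<in> W_inf" "v \<in> W_inf" "\<And>k. 0 < k \<Longrightarrow> u k = v k"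
  shows "u = v"
proof
  fix i :: int
  have "0 < i \<or> i = 0 \<or> 0 < - i" by linarith
  then show "u i = v i"
    using assms(3)[of i] assms(3)[of "- i"] W_infD(2,3)[OF assms(1)] W_infD(2,3)[OF assms(2)] by auto
qed

lemma sgen_pos:
  "0 < r \<Longrightarrow> 0 < k \<Longrightarrow> sgen r k = (if k = int r then int r + 1 else if k = int r + 1 then int r else k)"
  by (simp add: sgen_def)

lemma sgen_0_pos: "0 < k \<Longrightarrow> sgen 0 k = (if k = 1 then - 1 else k)"
  by (simp add: sgen_def)

lemma sgen_uminus: "sgen r (- i) = - sgen r i"
  using W_infD(2)[OF sgen_in_W_inf] .

lemma sgen_commute_less:
  assumes "i + 2 \<le> j" shows "sgen i \<circ> sgen j = sgen j \<circ> sgen i"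
proof (rule W_inf_eqI)
  fix k :: int assume k: "0 < k"
  show "(sgen i \<circ> sgen j) k = (sgen j \<circ> sgen i) k"
  proof (cases "i = 0")
    case True
    then show ?thesis using assms k by (simp add: sgen_pos sgen_0_pos sgen_uminus)
  next
    case False
    then show ?thesis using assms k by (simp add: sgen_pos)
  qed
qed (simp_all add: comp_in_W_inf sgen_in_W_inf)

lemma sgen_commute: "\<bar>int i - int j\<bar> \<ge> 2 \<Longrightarrow> sgen i \<circ> sgen j = sgen j \<circ> sgen i"
  using sgen_commute_less[of i j] sgen_commute_less[of j i] by (cases "i \<le> j") auto

text \<open>The braid relations are compared on positive integers only, where \<open>sgen r\<close> with \<open>r > 0\<close> is a plain
  transposition; oddness does the rest.\<close>

lemma sgen_braid:
  assumes "0 < i"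
  shows "sgen i \<circ> (sgen (i + 1) \<circ> sgen i) = sgen (i + 1) \<circ> (sgen i \<circ> sgen (i + 1))"
proof (rule W_inf_eqI)
  fix k :: int assume k: "0 < k"
  consider "k = int i" | "k = int i + 1" | "k = int i + 2" | "k \<noteq> int i" "k \<noteq> int i + 1" "k \<noteq> int i + 2"
    by blast
  then show "(sgen i \<circ> (sgen (i + 1) \<circ> sgen i)) k = (sgen (i + 1) \<circ> (sgen i \<circ> sgen (i + 1))) k"
    using assms k by cases (simp_all add: sgen_pos)
qed (intro comp_in_W_inf sgen_in_W_inf)+

lemma sgen_braid0: "sgen 0 \<circ> (sgen 1 \<circ> (sgen 0 \<circ> sgen 1)) = sgen 1 \<circ> (sgen 0 \<circ> (sgen 1 \<circ> sgen 0))"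
proof (rule W_inf_eqI)
  fix k :: int assume k: "0 < k"
  consider "k = 1" | "k = 2" | "k > 2" using k by linarith
  then show "(sgen 0 \<circ> (sgen 1 \<circ> (sgen 0 \<circ> sgen 1))) k = (sgen 1 \<circ> (sgen 0 \<circ> (sgen 1 \<circ> sgen 0))) k"
    by cases (simp_all add: sgen_pos sgen_0_pos sgen_uminus)
qed (intro comp_in_W_inf sgen_in_W_inf)+

lemma coef_monomial_cong:
  assumes "word_prod as = word_prod bs" "length as = length bs"
  shows "coef w (monomial as) = coef w (monomial bs)"
  using assms by (simp add: coef_single red_words_def)

text \<open>Commutation and braid relations preserve both the length and the product of a word, hence whether
  it is a reduced word of \<open>w\<close>; and a word containing a square is never reduced.\<close>

lemma coef_nil_relator:
  assumes "\<rho> \<in> nil_relators n" shows "coef w \<rho> = 0"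
proof -
  consider i where "\<rho> = ugen i * ugen i"
    | i j where "\<rho> = ugen i * ugen j - ugen j * ugen i" "\<bar>int i - int j\<bar> \<ge> 2"
    | i where "\<rho> = ugen i * ugen (i + 1) * ugen i - ugen (i + 1) * ugen i * ugen (i + 1)" "0 < i"
    | "\<rho> = ugen 0 * ugen 1 * ugen 0 * ugen 1 - ugen 1 * ugen 0 * ugen 1 * ugen 0"
    using assms unfolding nil_relators_def by (auto split: if_splits)
  then show ?thesis
  proof cases
    case 1
    have "word_prod [i, i] = id" by (simp add: word_prod_Cons)
    then have "[i, i] \<notin> red_words w" by (auto simp: red_words_def)
    then show ?thesis by (simp add: 1 ugen_monomial monomial_mult coef_single)
  next
    case 2
    have "word_prod [i, j] = word_prod [j, i]" using sgen_commute[OF 2(2)] by (simp add: word_prod_Cons)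
    from coef_monomial_cong[OF this, of w] show ?thesis by (simp add: 2(1) ugen_monomial monomial_mult coef_diff)
  next
    case 3
    have "word_prod [i, i + 1, i] = word_prod [i + 1, i, i + 1]"
      using sgen_braid[OF 3(2)] by (simp add: word_prod_Cons)
    from coef_monomial_cong[OF this, of w] show ?thesis by (simp add: 3(1) ugen_monomial monomial_mult coef_diff)
  next
    case 4
    have "word_prod [0, 1, 0, 1] = word_prod [1, 0, 1, 0]"
      using sgen_braid0 by (simp add: word_prod_Cons)
    from coef_monomial_cong[OF this, of w] show ?thesis by (simp add: 4 ugen_monomial monomial_mult coef_diff)
  qed
qed

lemma coef_nil_ideal:
  assumes "\<xi> \<in> nil_ideal n" shows "coef w \<xi> = 0"
  using assms
proof (induction arbitrary: w rule: nil_ideal.induct)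
  case (mult_left \<alpha> \<xi>)
  show ?case unfolding coef_mult by (rule sum.neutral) (auto simp: mult_left.IH)
next
  case (mult_right \<alpha> \<xi>)
  show ?case unfolding coef_mult by (rule sum.neutral) (auto simp: mult_right.IH)
qed (simp_all add: coef_nil_relator coef_add)

lemma single_free_carrier: "set as \<subseteq> {..<n} \<Longrightarrow> Poly_Mapping.single (Word as) c \<in> free_carrier n"
  by (auto simp: free_carrier_def split: if_splits)

lemma const_free_carrier: "Poly_Mapping.single 0 c \<in> free_carrier n"
  using single_free_carrier[of "[]" n c] by (simp add: zero_word_def)

lemma nil_ideal_uminus:
  assumes "\<xi> \<in> nil_ideal n" shows "- \<xi> \<in> nil_ideal n"
proof -
  have "Poly_Mapping.single 0 (- 1) * \<xi> \<in> nil_ideal n"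
    using assms const_free_carrier by (rule nil_ideal.mult_left[rotated])
  moreover have "Poly_Mapping.single 0 (- 1) = (- 1 :: 'a free_alg)"
    by (simp add: single_uminus)
  ultimately show ?thesis by simp
qed

definition nil_eq :: "nat \<Rightarrow> 'r::comm_ring_1 free_alg \<Rightarrow> 'r free_alg \<Rightarrow> bool" where
  "nil_eq n \<xi> \<eta> \<longleftrightarrow> \<xi> - \<eta> \<in> nil_ideal n"

lemma nil_eq_refl: "nil_eq n \<xi> \<xi>"
  by (simp add: nil_eq_def nil_ideal.zero)

lemma nil_eq_sym: "nil_eq n \<xi> \<eta> \<Longrightarrow> nil_eq n \<eta> \<xi>"
  using nil_ideal_uminus[of "\<xi> - \<eta>" n] by (simp add: nil_eq_def)

lemma nil_eq_trans: "nil_eq n \<xi> \<eta> \<Longrightarrow> nil_eq n \<eta> \<zeta> \<Longrightarrow> nil_eq n \<xi> \<zeta>"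
  using nil_ideal.add[of "\<xi> - \<eta>" n "\<eta> - \<zeta>"] by (simp add: nil_eq_def)

lemma nil_eq_monomial_context:
  assumes "set cs \<subseteq> {..<n}" "set ds \<subseteq> {..<n}" and "nil_eq n (monomial as :: 'r::comm_ring_1 free_alg) (monomial bs)"
  shows "nil_eq n (monomial (cs @ as @ ds) :: 'r free_alg) (monomial (cs @ bs @ ds))"
proof -
  have "monomial cs * ((monomial as - monomial bs) * monomial ds) \<in> (nil_ideal n :: 'r free_alg set)"
    using assms unfolding nil_eq_def by (intro nil_ideal.mult_left nil_ideal.mult_right single_free_carrier)
  then show ?thesis by (simp add: nil_eq_def left_diff_distrib right_diff_distrib monomial_mult)
qed

lemma nil_eq_commute:
  "i < n \<Longrightarrow> j < n \<Longrightarrow> \<bar>int i - int j\<bar> \<ge> 2 \<Longrightarrow> nil_eq n (monomial [i, j]) (monomial [j, i])"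
proof -
  assume "i < n" "j < n" "\<bar>int i - int j\<bar> \<ge> 2"
  then have "ugen i * ugen j - ugen j * ugen i \<in> nil_relators n"
    unfolding nil_relators_def by blast
  then have "ugen i * ugen j - ugen j * ugen i \<in> nil_ideal n" by (rule nil_ideal.relator)
  then show ?thesis by (simp add: nil_eq_def ugen_monomial monomial_mult)
qed

lemma nil_eq_braid:
  "0 < i \<Longrightarrow> i + 1 < n \<Longrightarrow> nil_eq n (monomial [i, i + 1, i]) (monomial [i + 1, i, i + 1])"
proof -
  assume "0 < i" "i + 1 < n"
  then have "ugen i * ugen (i + 1) * ugen i - ugen (i + 1) * ugen i * ugen (i + 1) \<in> nil_relators n"
    unfolding nil_relators_def by blast
  then have "ugen i * ugen (i + 1) * ugen i - ugen (i + 1) * ugen i * ugen (i + 1) \<in> nil_ideal n" by (rule nil_ideal.relator)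
  then show ?thesis by (simp add: nil_eq_def ugen_monomial monomial_mult)
qed

lemma nil_eq_braid0:
  "1 < n \<Longrightarrow> nil_eq n (monomial [0, 1, 0, 1]) (monomial [1, 0, 1, 0])"
proof -
  assume "1 < n"
  then have "ugen 0 * ugen 1 * ugen 0 * ugen 1 - ugen 1 * ugen 0 * ugen 1 * ugen 0 \<in> nil_relators n"
    unfolding nil_relators_def by simp
  then have "ugen 0 * ugen 1 * ugen 0 * ugen 1 - ugen 1 * ugen 0 * ugen 1 * ugen 0 \<in> nil_ideal n" by (rule nil_ideal.relator)
  then show ?thesis by (simp add: nil_eq_def ugen_monomial monomial_mult)
qed

lemma square_in_nil_ideal: "i < n \<Longrightarrow> monomial [i, i] \<in> nil_ideal n"
proof -
  assume "i < n"
  then have "ugen i * ugen i \<in> nil_relators n"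
    unfolding nil_relators_def by blast
  then have "ugen i * ugen i \<in> nil_ideal n" by (rule nil_ideal.relator)
  then show ?thesis by (simp add: ugen_monomial monomial_mult)
qed

text \<open>The rank-two step of the word property. Two descents \<open>i\<close> and \<open>j\<close> of \<open>w\<close> allow the longest element of
  the dihedral subgroup that they generate, of length 2, 3 or 4, to be split off on the right of \<open>w\<close>.
  Its two reduced words \<open>\<alpha> i\<close> and \<open>\<beta> j\<close> are the two sides of a defining relation.\<close>

lemma two_descents:
  fixes w :: "int \<Rightarrow> int"
  assumes w: "w \<in> W n" and ij: "i < j" and i: "has_descent w i" and j: "has_descent w j"
  obtains \<alpha> \<beta> v where "set \<alpha> \<subseteq> {..<n}" "set \<beta> \<subseteq> {..<n}" "length \<alpha> = length \<beta>"
    "nil_eq n (monomial (\<alpha> @ [i])) (monomial (\<beta> @ [j]) :: 'r::comm_ring_1 free_alg)"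
    "v \<in> W n" "v \<circ> word_prod (\<alpha> @ [i]) = w" "v \<circ> word_prod (\<beta> @ [j]) = w"
    "cox_length w = cox_length v + length \<alpha> + 1"
proof -
  have jn: "j < n" using has_descent_less[OF w j] .
  then have i_n: "i < n" using ij by simp
  have inW: "u \<circ> sgen r \<in> W n" if "u \<in> W n" "r \<in> {i, j}" for u r
    using that jn i_n by (auto intro: comp_in_W sgen_in_W)
  have inf: "u \<in> W_inf" if "u \<in> W n" for u using that W_subset_W_inf by blast
  note w_inf = inf[OF w]
  have odd: "w (- k) = - w k" for k using W_infD(2)[OF w_inf] .
  consider "i + 2 \<le> j" | "0 < i" "j = i + 1" | "i = 0" "j = 1" using ij by linarith
  then show ?thesis
  proof cases
    case 1
    have "has_descent (w \<circ> sgen i) j"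
      using 1 j odd by (cases "i = 0") (auto simp: has_descent_def sgen_pos sgen_0_pos)
    then have "cox_length w = cox_length (w \<circ> sgen i \<circ> sgen j) + length [j] + 1"
      using cox_length_descent[OF w_inf i] cox_length_descent[of "w \<circ> sgen i" j] w inW inf by auto
    moreover have "w \<circ> sgen i \<circ> sgen j \<circ> (sgen j \<circ> sgen i) = w"
      by (simp add: fun_eq_iff)
    moreover have "sgen i \<circ> sgen j = sgen j \<circ> sgen i" using sgen_commute_less[OF 1] .
    ultimately show ?thesis
      using that[of "[j]" "[i]" "w \<circ> sgen i \<circ> sgen j"] 1 w inW i_n jn nil_eq_commute[of j n i]
      by (simp add: word_prod_Cons)
  next
    case 2
    let ?v = "w \<circ> sgen i \<circ> sgen j \<circ> sgen i"
    have d: "w (int i + 2) < w (int i + 1)" "w (int i + 1) < w (int i)"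
      using i j 2 by (auto simp: has_descent_def add.commute)
    have "has_descent (w \<circ> sgen i) j" "has_descent (w \<circ> sgen i \<circ> sgen j) i"
      using 2 d by (auto simp: has_descent_def sgen_pos add.commute[of 2 "int i"])
    then have "cox_length w = cox_length ?v + length [i, j] + 1"
      using cox_length_descent[OF w_inf i] cox_length_descent[of "w \<circ> sgen i" j]
        cox_length_descent[of "w \<circ> sgen i \<circ> sgen j" i] w inW inf by auto
    moreover have "?v \<circ> (sgen i \<circ> (sgen j \<circ> sgen i)) = w"
      by (simp add: fun_eq_iff)
    moreover have "sgen i \<circ> (sgen j \<circ> sgen i) = sgen j \<circ> (sgen i \<circ> sgen j)"
      using sgen_braid[OF 2(1)] 2 by simp
    ultimately show ?thesis
      using that[of "[i, j]" "[j, i]" ?v] 2 w inW i_n jn nil_eq_braid[of i n]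
      by (simp add: word_prod_Cons)
  next
    case 3
    let ?v = "w \<circ> sgen 0 \<circ> sgen 1 \<circ> sgen 0 \<circ> sgen 1"
    have d: "w 1 < 0" "w 2 < w 1"
      using i j 3 by (auto simp: has_descent_def)
    have "has_descent w 0" "has_descent (w \<circ> sgen 0) 1" "has_descent (w \<circ> sgen 0 \<circ> sgen 1) 0" "has_descent (w \<circ> sgen 0 \<circ> sgen 1 \<circ> sgen 0) 1"
      using d odd[of 1] odd[of 2] by (auto simp: has_descent_def sgen_pos sgen_0_pos sgen_uminus)
    then have "cox_length w = cox_length ?v + length [1, 0, 1] + 1"
      using cox_length_descent[OF w_inf, of 0] cox_length_descent[of "w \<circ> sgen 0" 1]
        cox_length_descent[of "w \<circ> sgen 0 \<circ> sgen 1" 0]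
        cox_length_descent[of "w \<circ> sgen 0 \<circ> sgen 1 \<circ> sgen 0" 1] w inW inf 3 by auto
    moreover have "?v \<circ> (sgen 1 \<circ> (sgen 0 \<circ> (sgen 1 \<circ> sgen 0))) = w"
      by (simp add: fun_eq_iff)
    moreover note sgen_braid0
    ultimately show ?thesis
      using that[of "[1, 0, 1]" "[0, 1, 0]" ?v] 3 w inW i_n jn nil_eq_sym[OF nil_eq_braid0[of n]]
      by (simp add: word_prod_Cons)
  qed
qed

text \<open>Matsumoto's theorem for signed permutations: any two reduced words of \<open>w\<close> are connected by the
  defining relations. If the last letters \<open>i\<close> and \<open>j\<close> differ, both words are connected by induction to
  reduced words that end in \<open>\<alpha> i\<close> and \<open>\<beta> j\<close>, and those two differ by one relation.\<close>

lemma reduced_words_nil_eq: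
  assumes "w \<in> W n" "as \<in> red_words w" "bs \<in> red_words w"
  shows "nil_eq n (monomial as :: 'r::comm_ring_1 free_alg) (monomial bs)"
  using assms
proof (induction "length as" arbitrary: w as bs)
  case 0
  have "length bs = length as" using 0(3,4) by (simp add: red_words_def)
  with 0(1) have "as = []" "bs = []" by simp_all
  then show ?case by (simp add: nil_eq_refl)
next
  case (Suc l)
  have "as \<noteq> []" "bs \<noteq> []" using Suc.hyps(2) Suc.prems by (auto simp: red_words_def)
  then obtain as' i bs' j where ij: "as = as' @ [i]" "bs = bs' @ [j]" by (metis rev_exhaust)
  have has_descent: "has_descent w i" "has_descent w j" and as': "as' \<in> red_words (w \<circ> sgen i)" and bs': "bs' \<in> red_words (w \<circ> sgen j)"
    using Suc.prems by (auto simp: ij red_words_snoc_iff)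
  have less: "i < n" "j < n" using has_descent_less[OF Suc.prems(1)] has_descent by auto
  have inW: "w \<circ> sgen i \<in> W n" "w \<circ> sgen j \<in> W n"
    using less Suc.prems(1) by (auto intro: comp_in_W sgen_in_W)
  have len: "l = length as'" "l = length bs'"
    using Suc.hyps(2) Suc.prems by (auto simp: ij red_words_def)
  show ?case
  proof (cases "i = j")
    case True
    then have "nil_eq n (monomial as' :: 'r free_alg) (monomial bs')"
      using Suc.hyps(1)[OF len(1) inW(1) as'] bs' by simp
    from nil_eq_monomial_context[OF _ _ this, of "[]" "[i]"] show ?thesis
      using less True by (simp add: ij)
  next
    case False
    have step: "nil_eq n (monomial (as' @ [i]) :: 'r free_alg) (monomial (bs' @ [j]))"
      if *: "i < j" "has_descent w i" "has_descent w j" "as' \<in> red_words (w \<circ> sgen i)" "bs' \<in> red_words (w \<circ> sgen j)"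
        "w \<circ> sgen i \<in> W n" "w \<circ> sgen j \<in> W n" "i < n" "j < n" "l = length as'" "l = length bs'" for i j as' bs'
    proof -
      obtain \<alpha> \<beta> v where v: "set \<alpha> \<subseteq> {..<n}" "set \<beta> \<subseteq> {..<n}" "length \<alpha> = length \<beta>"
        "nil_eq n (monomial (\<alpha> @ [i])) (monomial (\<beta> @ [j]) :: 'r free_alg)"
        "v \<in> W n" "v \<circ> word_prod (\<alpha> @ [i]) = w" "v \<circ> word_prod (\<beta> @ [j]) = w"
        "cox_length w = cox_length v + length \<alpha> + 1"
        using two_descents[OF Suc.prems(1) *(1-3)] by metis
      obtain cs where cs: "cs \<in> red_words v" using red_words_nonempty[OF W_subset_W_inf[OF v(5)]] by blast
      have csn: "set cs \<subseteq> {..<n}" using red_words_letters[OF v(5) cs] .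
      have "cs @ \<alpha> @ [i] \<in> red_words w" "cs @ \<beta> @ [j] \<in> red_words w"
        using cs v(3,6-8) by (auto simp: red_words_def word_prod_append[of cs])
      then have "cs @ \<alpha> \<in> red_words (w \<circ> sgen i)" "cs @ \<beta> \<in> red_words (w \<circ> sgen j)"
        by (simp_all add: red_words_snoc_iff flip: append_assoc)
      then have "nil_eq n (monomial as' :: 'r free_alg) (monomial (cs @ \<alpha>))" "nil_eq n (monomial (cs @ \<beta>) :: 'r free_alg) (monomial bs')"
        using Suc.hyps(1)[OF *(10,6,4)] Suc.hyps(1)[OF *(11,7,5)] nil_eq_sym by blast+
      then have "nil_eq n (monomial (as' @ [i]) :: 'r free_alg) (monomial (cs @ \<alpha> @ [i]))"
        "nil_eq n (monomial (cs @ \<beta> @ [j]) :: 'r free_alg) (monomial (bs' @ [j]))"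
        using nil_eq_monomial_context[of "[]" n "[i]" as' "cs @ \<alpha>"] nil_eq_monomial_context[of "[]" n "[j]" "cs @ \<beta>" bs'] *(8,9)
        by simp_all
      moreover have "nil_eq n (monomial (cs @ \<alpha> @ [i]) :: 'r free_alg) (monomial (cs @ \<beta> @ [j]))"
        using nil_eq_monomial_context[OF csn _ v(4), of "[]"] by simp
      ultimately show ?thesis using nil_eq_trans by blast
    qed
    show ?thesis
    proof (cases "i < j")
      case True
      show ?thesis unfolding ij by (rule step) (use True has_descent as' bs' inW less len in auto)
    next
      case False
      then have "j < i" using \<open>i \<noteq> j\<close> by simp
      show ?thesis unfolding ij
        by (rule nil_eq_sym, rule step) (use \<open>j < i\<close> has_descent as' bs' inW less len in auto)
    qed
  qed
qed

text \<open>At the first letter \<open>i\<close> that destroys reducedness, \<open>i\<close> is a descent of the prefix, so the prefix can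
  be rewritten to end in \<open>i\<close> and a square appears.\<close>

lemma nonreduced_in_nil_ideal:
  assumes "set as \<subseteq> {..<n}" "as \<notin> red_words (word_prod as)"
  shows "(monomial as :: 'r::comm_ring_1 free_alg) \<in> nil_ideal n"
  using assms
proof (induction as rule: rev_induct)
  case Nil
  have "[] \<in> red_words (word_prod [])" by simp
  with Nil(2) show ?case by (rule notE)
next
  case (snoc i as)
  let ?v = "word_prod as"
  have i: "i < n" and as: "set as \<subseteq> {..<n}" using snoc.prems by auto
  show ?case
  proof (cases "as \<in> red_words ?v")
    case False
    then have "monomial as * monomial [i] \<in> (nil_ideal n :: 'r free_alg set)"
      using snoc.IH as i by (intro nil_ideal.mult_right single_free_carrier) auto
    then show ?thesis by (simp add: monomial_mult)
  next
    case True
    have v: "?v \<in> W n" using word_prod_in_W[OF as] .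
    have "has_descent ?v i"
    proof (rule ccontr)
      assume "\<not> has_descent ?v i"
      then have "cox_length (word_prod (as @ [i])) = length (as @ [i])"
        unfolding word_prod_snoc using cox_length_ascent[of ?v i] True word_prod_in_W_inf by (simp add: red_words_def)
      then show False using snoc.prems(2) by (simp add: red_words_def)
    qed
    moreover have "?v \<circ> sgen i \<in> W_inf" by (intro comp_in_W_inf word_prod_in_W_inf sgen_in_W_inf)
    then obtain ds where "ds \<in> red_words (?v \<circ> sgen i)" using red_words_nonempty by blast
    ultimately have ds: "ds @ [i] \<in> red_words ?v" by (simp add: red_words_snoc_iff word_prod_in_W_inf)
    have "set ds \<subseteq> {..<n}" using red_words_letters[OF v ds] by simp
    then have "monomial ds * monomial [i, i] \<in> (nil_ideal n :: 'r free_alg set)"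
      using square_in_nil_ideal[OF i] by (intro nil_ideal.mult_left single_free_carrier)
    moreover have "nil_eq n (monomial (as @ [i]) :: 'r free_alg) (monomial (ds @ [i, i]))"
      using nil_eq_monomial_context[OF _ _ reduced_words_nil_eq[OF v True ds], of "[]" "[i]"] i by simp
    ultimately show ?thesis
      using nil_ideal.add[of "monomial (as @ [i]) - monomial (ds @ [i, i]) :: 'r free_alg" n "monomial (ds @ [i, i])"]
      by (simp add: nil_eq_def monomial_mult)
  qed
qed

lemma free_alg_sum_singles: "\<xi> = (\<Sum>v\<in>Poly_Mapping.keys \<xi>. Poly_Mapping.single v (Poly_Mapping.lookup \<xi> v))"
proof (rule poly_mapping_eqI)
  fix k
  have "Poly_Mapping.lookup (\<Sum>v\<in>Poly_Mapping.keys \<xi>. Poly_Mapping.single v (Poly_Mapping.lookup \<xi> v)) k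
    = (\<Sum>v\<in>Poly_Mapping.keys \<xi>. if v = k then Poly_Mapping.lookup \<xi> v else 0)"
    unfolding lookup_sum by (rule sum.cong) (auto simp: lookup_single when_def)
  also have "\<dots> = Poly_Mapping.lookup \<xi> k"
    by (simp add: in_keys_iff)
  finally show "Poly_Mapping.lookup \<xi> k = Poly_Mapping.lookup (\<Sum>v\<in>Poly_Mapping.keys \<xi>. Poly_Mapping.single v (Poly_Mapping.lookup \<xi> v)) k"
    by simp
qed

lemma nil_ideal_sum: "(\<And>i. i \<in> I \<Longrightarrow> f i \<in> nil_ideal n) \<Longrightarrow> (\<Sum>i\<in>I. f i) \<in> nil_ideal n"
  by (induction I rule: infinite_finite_induct) (auto intro: nil_ideal.zero nil_ideal.add)

lemma nil_basis_eq:
  assumes "w \<in> W n" obtains as where "as \<in> red_words w" "\<And>c. nil_basis c w n = Poly_Mapping.single (Word as) c"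
proof (rule that)
  show "(SOME as. as \<in> reduced_words n w) \<in> red_words w"
    using someI_ex[OF reduced_words_nonempty[OF assms]] reduced_words_eq_red_words[OF assms] by simp
qed (simp add: nil_basis_def)

lemma coef_nil_basis:
  assumes "v \<in> W n" shows "coef w (nil_basis c v n) = (if v = w then c else 0)"
proof -
  obtain as where "as \<in> red_words v" "nil_basis c v n = Poly_Mapping.single (Word as) c"
    using nil_basis_eq[OF assms] by metis
  then show ?thesis using cox_length_word_prod by (auto simp: coef_single red_words_def)
qed

lemma single_expansion:
  assumes as: "set as \<subseteq> {..<n}"
  shows "Poly_Mapping.single (Word as) c - (\<Sum>v\<in>W n. nil_basis (coef v (Poly_Mapping.single (Word as) c)) v n) \<in> nil_ideal n"
proof (cases "as \<in> red_words (word_prod as)")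
  case False
  then have "as \<notin> red_words v" for v by (auto simp: red_words_def)
  then have "(\<Sum>v\<in>W n. nil_basis (coef v (Poly_Mapping.single (Word as) c)) v n) = 0"
    by (intro sum.neutral) (simp add: coef_single nil_basis_def)
  moreover have "Poly_Mapping.single (Word as) c \<in> nil_ideal n"
    using False as
    by (subst single_eq_monomial, intro nil_ideal.mult_left const_free_carrier nonreduced_in_nil_ideal)
  ultimately show ?thesis by simp
next
  case True
  let ?v = "word_prod as"
  have v: "?v \<in> W n" using word_prod_in_W[OF as] .
  obtain bs where bs: "bs \<in> red_words ?v" "\<And>c::'a. nil_basis c ?v n = Poly_Mapping.single (Word bs) c"
    using nil_basis_eq[OF v] by metis
  have "as \<in> red_words v \<longleftrightarrow> v = ?v" for v using True by (auto simp: red_words_def)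
  then have "(\<Sum>v\<in>W n. nil_basis (coef v (Poly_Mapping.single (Word as) c)) v n) =
    (\<Sum>v\<in>W n. if v = ?v then nil_basis c ?v n else 0)"
    by (intro sum.cong) (auto simp: coef_single nil_basis_def)
  also have "\<dots> = Poly_Mapping.single (Word bs) c"
    using v bs(2) by (simp add: finite_W)
  finally have "Poly_Mapping.single (Word as) c - (\<Sum>v\<in>W n. nil_basis (coef v (Poly_Mapping.single (Word as) c)) v n)
    = Poly_Mapping.single 0 c * (monomial as - monomial bs)"
    by (simp add: right_diff_distrib mult_single)
  also have "\<dots> \<in> nil_ideal n"
    using reduced_words_nil_eq[OF v True bs(1)] unfolding nil_eq_def
    by (intro nil_ideal.mult_left const_free_carrier)
  finally show ?thesis .
qed

lemma nil_basis_sum: "nil_basis (\<Sum>i\<in>I. c i) v n = (\<Sum>i\<in>I. nil_basis (c i) v n)"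
  by (induction I rule: infinite_finite_induct) (simp_all add: nil_basis_def single_add)

lemma basis_expansion:
  assumes "\<xi> \<in> free_carrier n"
  shows "\<xi> - (\<Sum>v\<in>W n. nil_basis (coef v \<xi>) v n) \<in> nil_ideal n"
proof -
  let ?s = "\<lambda>u. Poly_Mapping.single u (Poly_Mapping.lookup \<xi> u)"
  have "\<xi> - (\<Sum>v\<in>W n. nil_basis (coef v \<xi>) v n) =
    (\<Sum>u\<in>Poly_Mapping.keys \<xi>. ?s u) - (\<Sum>v\<in>W n. nil_basis (coef v (\<Sum>u\<in>Poly_Mapping.keys \<xi>. ?s u)) v n)"
    using free_alg_sum_singles[of \<xi>] by simp
  also have "\<dots> = (\<Sum>u\<in>Poly_Mapping.keys \<xi>. ?s u - (\<Sum>v\<in>W n. nil_basis (coef v (?s u)) v n))"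
    unfolding coef_sum nil_basis_sum sum_subtractf by (subst sum.swap) simp
  also have "\<dots> \<in> nil_ideal n"
  proof (rule nil_ideal_sum)
    fix u assume "u \<in> Poly_Mapping.keys \<xi>"
    then have "set (letters u) \<subseteq> {..<n}" using assms by (auto simp: free_carrier_def)
    from single_expansion[OF this] show "?s u - (\<Sum>v\<in>W n. nil_basis (coef v (?s u)) v n) \<in> nil_ideal n"
      by simp
  qed
  finally show ?thesis .
qed

text \<open>Every representative has the expansion with coefficients \<open>coef v \<xi>\<close>, since reduced words are
  congruent to basis elements and the other words vanish. The expansion is unique because \<open>coef w\<close>
  vanishes on the ideal and is dual to the basis.\<close>

lemma bracket_eq_coef:
  assumes "\<xi> \<in> free_carrier n" "w \<in> W n"
  shows "bracket n \<xi> w = coef w \<xi>"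
  unfolding bracket_def
proof (rule the_equality)
  show "\<exists>f. \<xi> - (\<Sum>v\<in>W n. nil_basis (f v) v n) \<in> nil_ideal n \<and> f w = coef w \<xi>"
    using basis_expansion[OF assms(1)] by (intro exI[of _ "\<lambda>v. coef v \<xi>"]) simp
next
  fix c assume "\<exists>f. \<xi> - (\<Sum>v\<in>W n. nil_basis (f v) v n) \<in> nil_ideal n \<and> f w = c"
  then obtain f where f: "\<xi> - (\<Sum>v\<in>W n. nil_basis (f v) v n) \<in> nil_ideal n" "f w = c" by blast
  have "coef w (\<Sum>v\<in>W n. nil_basis (f v) v n) = (\<Sum>v\<in>W n. if v = w then f v else 0)"
    unfolding coef_sum by (rule sum.cong) (auto simp: coef_nil_basis)
  also have "\<dots> = c" using assms(2) f(2) by (simp add: finite_W)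
  finally show "c = coef w \<xi>"
    using coef_nil_ideal[OF f(1), of w] by (simp add: coef_diff)
qed

section \<open>The nilCoxeter ring and its unipotent factors\<close>

text \<open>Identifying elements of the free algebra with equal coefficients gives the nilCoxeter algebra of
  \<open>W_inf\<close> as a ring, in which the relations become equations. By the coproduct rule \<open>coef_mult\<close>,
  this identification is compatible with products.\<close>

quotient_type (overloaded) 'r nilcox = "'r::comm_ring_1 free_alg" / "\<lambda>\<xi> \<eta>. \<forall>w. coef w \<xi> = coef w \<eta>"
  morphisms rep_nilcox nil_class
  by (rule equivpI) (auto simp: reflp_def symp_def transp_def)

instantiation nilcox :: (comm_ring_1) ring_1
begin

lift_definition zero_nilcox :: "'a nilcox" is 0 .
lift_definition one_nilcox :: "'a nilcox" is 1 .
lift_definition plus_nilcox :: "'a nilcox \<Rightarrow> 'a nilcox \<Rightarrow> 'a nilcox" is "(+)" by (simp add: coef_add)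
lift_definition minus_nilcox :: "'a nilcox \<Rightarrow> 'a nilcox \<Rightarrow> 'a nilcox" is "(-)" by (simp add: coef_diff)
lift_definition uminus_nilcox :: "'a nilcox \<Rightarrow> 'a nilcox" is uminus by (simp add: coef_uminus)
lift_definition times_nilcox :: "'a nilcox \<Rightarrow> 'a nilcox \<Rightarrow> 'a nilcox" is "(*)" by (simp add: coef_mult)

instance
proof
  show "(0 :: 'a nilcox) \<noteq> 1"
  proof transfer
    have "coef id (1 :: 'a free_alg) = 1"
      by (simp add: coef_def flip: zero_word_def)
    then show "\<not> (\<forall>w. coef w (0 :: 'a free_alg) = coef w 1)"
      by (metis coef_zero zero_neq_one)
  qed
qed (transfer; simp add: algebra_simps)+

end

lift_definition ncoef :: "(int \<Rightarrow> int) \<Rightarrow> 'r::comm_ring_1 nilcox \<Rightarrow> 'r" is coef by simp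
lift_definition nconst :: "'r::comm_ring_1 \<Rightarrow> 'r nilcox" is "Poly_Mapping.single 0" .
lift_definition ngen :: "nat \<Rightarrow> 'r::comm_ring_1 nilcox" is ugen .
text \<open>The factor \<open>1 + t u\<^sub>j\<close>; since \<open>u\<^sub>j\<close> has square zero, it is the exponential of \<open>t u\<^sub>j\<close>.\<close>

lift_definition hfac :: "nat \<Rightarrow> 'r::comm_ring_1 \<Rightarrow> 'r nilcox" is "\<lambda>j t. 1 + tu t j" .

lemma nil_class_one: "nil_class 1 = 1" by (simp add: one_nilcox_def)
lemma nil_class_mult: "nil_class (\<xi> * \<eta>) = nil_class \<xi> * nil_class \<eta>" by (simp add: times_nilcox.abs_eq)
lemma nil_class_hfac: "nil_class (1 + tu t j) = hfac j t" by (simp add: hfac_def)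

lemma nil_class_prod_list: "nil_class (prod_list \<xi>s) = prod_list (map nil_class \<xi>s)"
  by (induction \<xi>s) (simp_all add: nil_class_one nil_class_mult)

lemma coef_eq_ncoef: "coef w \<xi> = ncoef w (nil_class \<xi>)" by (simp add: ncoef.abs_eq)

lemma ncoef_add: "ncoef w (\<xi> + \<eta>) = ncoef w \<xi> + ncoef w \<eta>"
  by transfer (rule coef_add)

lemma ncoef_mult: "ncoef w (\<xi> * \<eta>) = (\<Sum>(u, v)\<in>red_splits w. ncoef u \<xi> * ncoef v \<eta>)"
  by transfer (rule coef_mult)

lemma ncoef_one: "ncoef w 1 = (if w = id then 1 else 0)"
proof transfer
  fix w :: "int \<Rightarrow> int"
  have "[] \<in> red_words w \<longleftrightarrow> w = id"
  proof
    assume "[] \<in> red_words w"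
    then have "word_prod [] = w" by (simp only: red_words_def mem_Collect_eq)
    then show "w = id" unfolding word_prod_Nil by (rule sym)
  next
    assume "w = id"
    show "[] \<in> red_words w" unfolding \<open>w = id\<close> red_words_id by simp
  qed
  then show "coef w (1 :: 'a free_alg) = (if w = id then 1 else 0)"
    unfolding monomial_Nil[symmetric] coef_single by simp
qed

lemma hfac_eq: "hfac j t = 1 + nconst t * ngen j"
  by transfer (subst tu_eq, simp)

lemma nconst_central: "\<xi> * nconst c = nconst c * \<xi>"
proof transfer
  fix \<xi> :: "'a free_alg" and c
  have "\<xi> * Poly_Mapping.single 0 c = Poly_Mapping.single 0 c * \<xi>"
  proof -
    have "Poly_Mapping.single u a * Poly_Mapping.single 0 c = Poly_Mapping.single 0 c * Poly_Mapping.single u a" for u :: word and a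
      by (simp add: mult_single mult.commute)
    then show ?thesis
      by (subst (1 2) free_alg_sum_singles) (simp add: sum_distrib_left sum_distrib_right)
  qed
  then show "\<forall>w. coef w (\<xi> * Poly_Mapping.single 0 c) = coef w (Poly_Mapping.single 0 c * \<xi>)" by simp
qed

lemma ncoef_scale: "ncoef w (nconst c * \<xi>) = c * ncoef w \<xi>"
proof transfer
  fix \<xi> :: "'a free_alg" and c and w :: "int \<Rightarrow> int"
  have "Poly_Mapping.lookup (Poly_Mapping.single 0 c * \<xi>) (Word as) = c * Poly_Mapping.lookup \<xi> (Word as)" for as
  proof -
    have "Poly_Mapping.lookup (Poly_Mapping.single 0 c * \<xi>) (Word as) =
      (\<Sum>i\<le>length as. if i = 0 then c * Poly_Mapping.lookup \<xi> (Word (drop 0 as)) else 0)"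
      unfolding lookup_mult_word
      by (rule sum.cong) (auto simp: lookup_single when_def zero_word_def)
    then show ?thesis by simp
  qed
  then show "coef w (Poly_Mapping.single 0 c * \<xi>) = c * coef w \<xi>"
    by (simp add: coef_def sum_distrib_left)
qed

lemma red_words_square: "[i, i] \<notin> red_words w"
  using red_words_append_iff[of "[i]" "[i]" w] red_words_snoc_iff[of "[i]" i w] has_descent_sgen[of w i] red_words_snoc_iff[of "[]" i "w \<circ> sgen i"]
  by auto

lemma hfac_zero [simp]: "hfac j 0 = 1"
  by transfer (simp add: tu_def)

lemma hfac_add: "hfac j s * hfac j t = hfac j (s + t)"
  by transfer (simp add: tu_def distrib_left distrib_right mult_single plus_word_def coef_add coef_single red_words_square algebra_simps)

lemma hfac_commute:
  assumes "\<bar>int i - int j\<bar> \<ge> 2" shows "hfac i s * hfac j t = hfac j t * hfac i s"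
proof -
  have "[i, j] \<in> red_words w \<longleftrightarrow> [j, i] \<in> red_words w" for w
    using sgen_commute[OF assms] by (simp add: red_words_def word_prod_Cons)
  then show ?thesis
    by transfer (simp add: tu_def distrib_left distrib_right mult_single plus_word_def coef_add coef_single algebra_simps)
qed

text \<open>Both sides expand to the same combination of words once squares vanish and the braid relation is
  used for the cubic term.\<close>

lemma yang_baxter:
  assumes "0 < i"
  shows "hfac i s * hfac (i + 1) (s + t) * hfac i t = hfac (i + 1) t * hfac i (s + t) * hfac (i + 1) s"
proof -
  have "[i, Suc i, i] \<in> red_words w \<longleftrightarrow> [Suc i, i, Suc i] \<in> red_words w" for w
    using sgen_braid[OF assms] by (simp add: red_words_def word_prod_Cons)
  then show ?thesis
    by transfer (simp add: tu_def distrib_left distrib_right mult_single plus_word_def coef_add coef_single red_words_square algebra_simps)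
qed

lemma red_words_singleton: "[j] \<in> red_words w \<longleftrightarrow> w = sgen j"
proof
  assume "[j] \<in> red_words w" then show "w = sgen j" by (auto simp: red_words_def word_prod_Cons)
next
  assume w: "w = sgen j"
  have neq: "sgen j \<noteq> id"
  proof
    assume "sgen j = id"
    then have "sgen j (int j + 1) = id (int j + 1)" by (rule fun_cong)
    then show False by (cases "j = 0") (simp_all add: sgen_pos sgen_0_pos)
  qed
  have "cox_length w \<noteq> 0"
  proof
    assume "cox_length w = 0"
    then have "w = id" unfolding w by (intro cox_length_eq_0 sgen_in_W_inf)
    with neq w show False by blast
  qed
  then show "[j] \<in> red_words w" by (intro red_words_I) (simp_all add: w word_prod_Cons)
qed

lemma ncoef_ngen: "ncoef w (ngen j) = (if w = sgen j then 1 else 0)"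
  by transfer (simp add: tu_def coef_single red_words_singleton)

lemma cox_length_sgen: "cox_length (sgen j) = 1"
  using red_words_singleton[of j "sgen j"] by (simp add: red_words_def)

text \<open>The only length-additive factorization of \<open>w\<close> with right factor \<open>sgen j\<close> is \<open>w \<circ> sgen j\<close> times
  \<open>sgen j\<close>, and it exists exactly if \<open>j\<close> is a descent.\<close>

lemma ncoef_mult_ngen:
  assumes w: "w \<in> W_inf"
  shows "ncoef w (\<xi> * ngen j) = (if has_descent w j then ncoef (w \<circ> sgen j) \<xi> else 0)"
proof -
  have *: "(u, sgen j) \<in> red_splits w \<longleftrightarrow> has_descent w j \<and> u = w \<circ> sgen j" for u
  proof
    assume "(u, sgen j) \<in> red_splits w"
    then have u: "u \<circ> sgen j = w" "Suc (cox_length u) = cox_length w"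
      by (simp_all add: red_splits_def cox_length_sgen)
    then have "u = w \<circ> sgen j" using sgen_cancel(1)[of u j] by metis
    with u(2) show "has_descent w j \<and> u = w \<circ> sgen j"
      using cox_length_ascent[OF w, of j] by fastforce
  next
    assume u: "has_descent w j \<and> u = w \<circ> sgen j"
    then have "cox_length w = Suc (cox_length u)" using cox_length_descent[OF w, of j] by blast
    moreover have "u \<in> W_inf" using u comp_in_W_inf[OF w sgen_in_W_inf] by blast
    moreover have "u \<circ> sgen j = w" using u sgen_cancel(1) by metis
    ultimately show "(u, sgen j) \<in> red_splits w"
      using sgen_in_W_inf[of j] cox_length_sgen[of j] unfolding red_splits_def by simp
  qed
  have "ncoef w (\<xi> * ngen j) = (\<Sum>x\<in>red_splits w. if x = (w \<circ> sgen j, sgen j) then ncoef (w \<circ> sgen j) \<xi> else 0)"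
    unfolding ncoef_mult
  proof (rule sum.cong)
    fix x assume x: "x \<in> red_splits w"
    obtain u v where uv: "x = (u, v)" by (cases x)
    show "(case x of (u, v) \<Rightarrow> ncoef u \<xi> * ncoef v (ngen j)) = (if x = (w \<circ> sgen j, sgen j) then ncoef (w \<circ> sgen j) \<xi> else 0)"
    proof (cases "v = sgen j")
      case True
      then show ?thesis using x *[of u] by (simp add: uv ncoef_ngen)
    qed (simp add: uv ncoef_ngen)
  qed simp
  then show ?thesis by (simp add: finite_red_splits *)
qed

lemma ncoef_mult_hfac:
  assumes w: "w \<in> W_inf"
  shows "ncoef w (\<xi> * hfac j t) = ncoef w \<xi> + (if has_descent w j then t * ncoef (w \<circ> sgen j) \<xi> else 0)"
proof -
  have "\<xi> * hfac j t = \<xi> + nconst t * (\<xi> * ngen j)"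
    unfolding hfac_eq distrib_left mult_1_right by (simp only: mult.assoc[symmetric] nconst_central)
  then show ?thesis by (simp add: ncoef_add ncoef_scale ncoef_mult_ngen[OF w])
qed

text \<open>The parabolic subgroup generated by the letters in \<open>T\<close>, in the form that is closed under
  length-additive factors.\<close>

definition parabolic :: "nat set \<Rightarrow> (int \<Rightarrow> int) set" where
  "parabolic T = {u \<in> W_inf. \<forall>as\<in>red_words u. set as \<subseteq> T}"

text \<open>Congruence modulo the basis elements outside the parabolic subgroup; it serves to discard
  generators that cannot contribute to a coefficient, and so to compare different ranks.\<close>

definition agree :: "nat set \<Rightarrow> 'r::comm_ring_1 nilcox \<Rightarrow> 'r nilcox \<Rightarrow> bool" where
  "agree T \<xi> \<eta> \<longleftrightarrow> (\<forall>u\<in>parabolic T. ncoef u \<xi> = ncoef u \<eta>)"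

lemma parabolic_red_splits:
  assumes "w \<in> parabolic T" "(u, v) \<in> red_splits w" shows "u \<in> parabolic T" "v \<in> parabolic T"
proof -
  have uv: "u \<in> W_inf" "v \<in> W_inf" using assms(2) by (auto simp: red_splits_def)
  have *: "set as \<subseteq> T \<and> set bs \<subseteq> T" if "as \<in> red_words u" "bs \<in> red_words v" for as bs
  proof -
    have "word_prod as = u" "word_prod bs = v" using that by (auto simp: red_words_def)
    then have "as @ bs \<in> red_words w" using that assms(2) by (auto simp: red_words_append_iff)
    then have "set (as @ bs) \<subseteq> T" using assms(1) unfolding parabolic_def by blast
    then show ?thesis by simp
  qed
  show "u \<in> parabolic T" using uv(1) red_words_nonempty[OF uv(2)] * by (auto simp: parabolic_def)
  show "v \<in> parabolic T" using uv(2) red_words_nonempty[OF uv(1)] * by (auto simp: parabolic_def)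
qed

lemma agree_refl: "agree T \<xi> \<xi>"
  by (simp add: agree_def)

lemma agree_mult:
  assumes "agree T \<xi> \<xi>'" "agree T \<eta> \<eta>'" shows "agree T (\<xi> * \<eta>) (\<xi>' * \<eta>')"
  unfolding agree_def ncoef_mult
proof (intro ballI sum.cong refl)
  fix w x assume w: "w \<in> parabolic T" and x: "x \<in> red_splits w"
  obtain u v where uv: "x = (u, v)" by (cases x)
  show "(case x of (u, v) \<Rightarrow> ncoef u \<xi> * ncoef v \<eta>) = (case x of (u, v) \<Rightarrow> ncoef u \<xi>' * ncoef v \<eta>')"
    using parabolic_red_splits[OF w] x assms by (simp add: uv agree_def)
qed

lemma agree_prod_list: "list_all2 (agree T) \<xi>s \<eta>s \<Longrightarrow> agree T (prod_list \<xi>s) (prod_list \<eta>s)"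
  by (induction rule: list_all2_induct) (simp_all add: agree_refl agree_mult)

lemma agree_hfac_one: "j \<notin> T \<Longrightarrow> agree T (hfac j t) 1"
proof -
  assume j: "j \<notin> T"
  have "\<not> has_descent u j" if u: "u \<in> parabolic T" for u
  proof
    assume d: "has_descent u j"
    have w: "u \<in> W_inf" using u by (simp add: parabolic_def)
    obtain as where "as \<in> red_words (u \<circ> sgen j)" using red_words_nonempty[OF comp_in_W_inf[OF w sgen_in_W_inf]] by blast
    then have "as @ [j] \<in> red_words u" using d w by (simp add: red_words_snoc_iff)
    then show False using u j by (auto simp: parabolic_def)
  qed
  then show "agree T (hfac j t) 1"
    using ncoef_mult_hfac[of _ 1 j t] by (simp add: agree_def parabolic_def)
qed

text \<open>Factors with a letter outside \<open>T\<close> are congruent to 1.\<close>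

lemma agree_prod_filter:
  "agree T (prod_list (map (\<lambda>j. hfac j t) js)) (prod_list (map (\<lambda>j. hfac j t) (filter (\<lambda>j. j \<in> T) js)))"
proof (induction js)
  case (Cons j js)
  then show ?case
    using agree_mult[OF agree_hfac_one[of j T t] Cons] agree_mult[OF agree_refl Cons] by simp
qed (simp add: agree_refl)

text \<open>The relation of being exchanged by the antiautomorphism \<open>u\<^sub>w \<mapsto> u\<^sub>v\<close> with \<open>v = inv w\<close>. It
  transports statements about descents of \<open>w\<close> to statements about descents of \<open>inv w\<close>.\<close>

definition adjoint :: "'r::comm_ring_1 nilcox \<Rightarrow> 'r nilcox \<Rightarrow> bool" where
  "adjoint \<xi> \<eta> \<longleftrightarrow> (\<forall>w\<in>W_inf. ncoef w \<xi> = ncoef (inv w) \<eta>)"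

lemma inv_comp_W_inf: "u \<in> W_inf \<Longrightarrow> v \<in> W_inf \<Longrightarrow> inv (u \<circ> v) = inv v \<circ> inv u"
  by (rule o_inv_distrib) (simp_all add: W_infD(1))

lemma red_splits_inv:
  assumes "w \<in> W_inf" "(u, v) \<in> red_splits w" shows "(inv v, inv u) \<in> red_splits (inv w)"
  using assms by (auto simp: red_splits_def inv_in_W_inf cox_length_inv inv_comp_W_inf)

lemma adjoint_one: "adjoint 1 1"
proof -
  have "w = id \<longleftrightarrow> inv w = id" if "w \<in> W_inf" for w
    using inv_inv_W_inf[OF that] by (metis inv_id)
  then show ?thesis by (simp add: adjoint_def ncoef_one)
qed

lemma inv_sgen: "inv (sgen j) = sgen j"
  by (rule inv_unique_comp) simp_all

lemma adjoint_hfac: "adjoint (hfac j t) (hfac j t)"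
proof -
  have sgen: "w = sgen j \<longleftrightarrow> inv w = sgen j" if "w \<in> W_inf" for w
    using inv_inv_W_inf[OF that] inv_sgen by metis
  show ?thesis
    using adjoint_one sgen ncoef_scale[of _ t "ngen j"]
    by (simp add: adjoint_def hfac_eq ncoef_add ncoef_ngen)
qed

lemma adjoint_mult:
  assumes "adjoint \<xi> \<xi>'" "adjoint \<eta> \<eta>'" shows "adjoint (\<xi> * \<eta>) (\<eta>' * \<xi>')"
  unfolding adjoint_def
proof
  fix w assume w: "w \<in> W_inf"
  show "ncoef w (\<xi> * \<eta>) = ncoef (inv w) (\<eta>' * \<xi>')"
    unfolding ncoef_mult
  proof (rule sum.reindex_bij_witness[where i = "\<lambda>(u, v). (inv v, inv u)" and j = "\<lambda>(u, v). (inv v, inv u)"])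
    fix x assume x: "x \<in> red_splits w"
    obtain u v where uv: "x = (u, v)" by (cases x)
    then have W: "u \<in> W_inf" "v \<in> W_inf" using x by (auto simp: red_splits_def)
    show "(\<lambda>(u, v). (inv v, inv u)) ((\<lambda>(u, v). (inv v, inv u)) x) = x"
      using W by (simp add: uv inv_inv_W_inf)
    show "(\<lambda>(u, v). (inv v, inv u)) x \<in> red_splits (inv w)"
      using red_splits_inv[OF w] x by (simp add: uv)
    show "(case (case x of (u, v) \<Rightarrow> (inv v, inv u)) of (u, v) \<Rightarrow> ncoef u \<eta>' * ncoef v \<xi>') = (case x of (u, v) \<Rightarrow> ncoef u \<xi> * ncoef v \<eta>)"
      using W assms by (simp add: uv adjoint_def mult.commute)
  next
    fix y assume y: "y \<in> red_splits (inv w)"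
    obtain u v where uv: "y = (u, v)" by (cases y)
    then have W: "u \<in> W_inf" "v \<in> W_inf" using y by (auto simp: red_splits_def)
    show "(\<lambda>(u, v). (inv v, inv u)) ((\<lambda>(u, v). (inv v, inv u)) y) = y"
      using W by (simp add: uv inv_inv_W_inf)
    show "(\<lambda>(u, v). (inv v, inv u)) y \<in> red_splits w"
      using red_splits_inv[OF inv_in_W_inf[OF w], of u v] y inv_inv_W_inf[OF w] by (simp add: uv)
  qed
qed

lemma adjoint_prod_list: "list_all2 adjoint \<xi>s \<eta>s \<Longrightarrow> adjoint (prod_list \<xi>s) (prod_list (rev \<eta>s))"
  by (induction rule: list_all2_induct) (simp_all add: adjoint_one adjoint_mult)

text \<open>The multiplicative monoid generated by the factors \<open>1 + t u\<^sub>j\<close> with \<open>j \<in> T\<close>; all the products that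
  define Schubert and Stanley functions lie in such monoids.\<close>

definition unipotent :: "nat set \<Rightarrow> 'r::comm_ring_1 nilcox set" where
  "unipotent T = {\<Prod>(j, t)\<leftarrow>ps. hfac j t | ps. fst ` set ps \<subseteq> T}"

lemma unipotent_one: "1 \<in> unipotent T"
  unfolding unipotent_def by (intro CollectI exI[of _ "[]"]) simp

lemma unipotent_hfac: "j \<in> T \<Longrightarrow> hfac j t \<in> unipotent T"
  unfolding unipotent_def by (intro CollectI exI[of _ "[(j, t)]"]) simp

lemma unipotent_mult:
  assumes "\<xi> \<in> unipotent T" "\<eta> \<in> unipotent T" shows "\<xi> * \<eta> \<in> unipotent T"
proof -
  obtain ps qs where "fst ` set ps \<subseteq> T" "\<xi> = (\<Prod>(j, t)\<leftarrow>ps. hfac j t)" "fst ` set qs \<subseteq> T" "\<eta> = (\<Prod>(j, t)\<leftarrow>qs. hfac j t)"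
    using assms by (auto simp: unipotent_def)
  then show ?thesis unfolding unipotent_def by (intro CollectI exI[of _ "ps @ qs"]) auto
qed

lemma unipotent_prod_list: "set \<xi>s \<subseteq> unipotent T \<Longrightarrow> prod_list \<xi>s \<in> unipotent T"
  by (induction \<xi>s) (auto intro: unipotent_one unipotent_mult)

lemma unipotent_subset: "S \<subseteq> T \<Longrightarrow> unipotent S \<subseteq> unipotent T"
  by (fastforce simp: unipotent_def)

lemma unipotent_induct [consumes 1, case_names one mult]:
  assumes "\<xi> \<in> unipotent T" and "P 1" and "\<And>\<xi> j t. P \<xi> \<Longrightarrow> j \<in> T \<Longrightarrow> P (\<xi> * hfac j t)"
  shows "P \<xi>"
proof -
  have "fst ` set ps \<subseteq> T \<Longrightarrow> P (\<Prod>(j, t)\<leftarrow>ps. hfac j t)" for ps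
    by (induction ps rule: rev_induct) (auto simp: assms(2,3))
  then show ?thesis using assms(1) by (auto simp: unipotent_def)
qed

lemma unipotent_commute:
  assumes "\<xi> \<in> unipotent S" "\<eta> \<in> unipotent T" and far: "\<And>i j. i \<in> S \<Longrightarrow> j \<in> T \<Longrightarrow> \<bar>int i - int j\<bar> \<ge> 2"
  shows "\<xi> * \<eta> = \<eta> * \<xi>"
proof -
  have *: "hfac i s * \<eta> = \<eta> * hfac i s" if "i \<in> S" for i s
    using assms(2)
  proof (induction rule: unipotent_induct)
    case (mult \<eta> j t)
    then show ?case using hfac_commute[OF far[OF that mult(2)], of s t] by (metis mult.assoc)
  qed simp
  show ?thesis using assms(1)
    by (induction rule: unipotent_induct) (simp_all add: mult.assoc *, simp flip: mult.assoc)
qed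

text \<open>The heart of the matter: expanding \<open>R\<close>, every term other than 1 ends in a letter of \<open>T\<close>, and a word
  that ends in a letter \<open>j\<close> is reduced for \<open>w\<close> only if \<open>j\<close> is a descent of \<open>w\<close>.\<close>

lemma ncoef_mult_unipotent:
  assumes "w \<in> W_inf" "R \<in> unipotent T" "\<And>j. j \<in> T \<Longrightarrow> \<not> has_descent w j"
  shows "ncoef w (\<xi> * R) = ncoef w \<xi>"
  using assms(2)
proof (induction rule: unipotent_induct)
  case (mult R j t)
  then show ?case using assms(3) by (simp add: ncoef_mult_hfac[OF assms(1)] flip: mult.assoc)
qed simp

lemma unipotent_support:
  assumes "\<xi> \<in> unipotent T" "u \<in> W_inf" "ncoef u \<xi> \<noteq> 0"
  shows "\<exists>as\<in>red_words u. set as \<subseteq> T"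
  using assms
proof (induction arbitrary: u rule: unipotent_induct)
  case one
  then have "u = id" by (auto simp: ncoef_one split: if_splits)
  then have "[] \<in> red_words u" by (simp only: red_words_id insertI1)
  then show ?case by (rule bexI[rotated]) simp
next
  case (mult \<xi> j t)
  show ?case
  proof (cases "ncoef u \<xi> = 0")
    case True
    then have d: "has_descent u j" "ncoef (u \<circ> sgen j) \<xi> \<noteq> 0"
      using mult.prems by (auto simp: ncoef_mult_hfac split: if_splits)
    then obtain as where "as \<in> red_words (u \<circ> sgen j)" "set as \<subseteq> T"
      using mult.IH comp_in_W_inf[OF mult.prems(1) sgen_in_W_inf] by blast
    then have "as @ [j] \<in> red_words u" "set (as @ [j]) \<subseteq> T"
      using d mult by (auto simp: red_words_snoc_iff)
    then show ?thesis by blast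
  qed (use mult in blast)
qed

section \<open>Merging the staircase into blocks\<close>

definition A_class :: "nat \<Rightarrow> nat \<Rightarrow> 'r \<Rightarrow> 'r::comm_ring_1 nilcox" where
  "A_class n i t = (\<Prod>j\<leftarrow>rev [i..<n]. hfac j t)"

definition A_tilde_class :: "nat \<Rightarrow> nat \<Rightarrow> 'r \<Rightarrow> 'r::comm_ring_1 nilcox" where
  "A_tilde_class n i t = (\<Prod>j\<leftarrow>[i..<n]. hfac j (- t))"

definition C_class :: "nat \<Rightarrow> 'r \<Rightarrow> 'r::comm_ring_1 nilcox" where
  "C_class n t = (\<Prod>j\<leftarrow>rev [0..<n] @ [0..<n]. hfac j t)"

lemma nil_class_A_fac: "nil_class (A_fac n i t) = A_class n i t"
  by (simp add: A_fac_def A_class_def nil_class_prod_list o_def nil_class_hfac)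

lemma nil_class_A_tilde_fac: "nil_class (A_tilde_fac n i t) = A_tilde_class n i t"
proof -
  have "nil_class (1 - tu t j) = hfac j (- t)" for j by (simp add: tu_def single_uminus flip: nil_class_hfac)
  then show ?thesis by (simp add: A_tilde_fac_def A_tilde_class_def nil_class_prod_list o_def)
qed

lemma nil_class_C_fac: "nil_class (C_fac n t) = C_class n t"
  unfolding C_fac_def C_class_def nil_class_prod_list by (simp add: o_def nil_class_hfac)

lemma A_class_unipotent: "A_class n i t \<in> unipotent {i..<n}"
  unfolding A_class_def by (rule unipotent_prod_list) (auto intro: unipotent_hfac)

lemma A_tilde_class_unipotent: "A_tilde_class n i t \<in> unipotent {i..<n}"
  unfolding A_tilde_class_def by (rule unipotent_prod_list) (auto intro: unipotent_hfac)

lemma A_class_trivial: "n \<le> i \<Longrightarrow> A_class n i t = 1"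
  by (simp add: A_class_def)

lemma A_class_rec: "i < n \<Longrightarrow> A_class n i t = A_class n (i + 1) t * hfac i t"
  by (simp add: A_class_def upt_rec[of i])

lemma hfac_cancel: "hfac j t * hfac j (- t) = 1"
  by (simp add: hfac_add)

text \<open>The argument of Fomin and Stanley: by descending induction on \<open>i\<close>, moving one factor of index
  \<open>i + 1\<close> across reduces the claim to an identity between four factors of indices \<open>i\<close> and \<open>i + 1\<close>,
  which the Yang-Baxter equation provides. This yields the symmetry of Stanley functions in their
  variables.\<close>

lemma A_class_commute:
  assumes "0 < i"
  shows "A_class n i s * A_class n i t = A_class n i t * A_class n i s"
proof (cases "i \<le> n")
  case True
  then show ?thesis using assms
  proof (induction i rule: inc_induct)
    case base
    show ?case by (simp add: A_class_trivial)
  next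
    case (step i)
    show ?case
    proof (cases "i + 1 < n")
      case False
      then show ?thesis using step(2) by (simp add: A_class_rec A_class_trivial hfac_add add.commute)
    next
      case True
      let ?a = "A_class n (i + 1)" and ?b = "A_class n (i + 2)"
      have a: "?a t = ?b t * hfac (i + 1) t" for t using A_class_rec[OF True, of t] by simp
      \<comment> \<open>The inverse of the factor of index \<open>i + 1\<close> completes \<open>?b\<close> to \<open>?a\<close>, to which the induction
        hypothesis applies.\<close>
      have b: "?b t = ?a t * hfac (i + 1) (- t)" for t by (simp only: a mult.assoc hfac_cancel) simp
      have bh: "hfac i s * ?b t = ?b t * hfac i s" for s t
        using unipotent_hfac[of i "{i}" s] A_class_unipotent[of n "i + 2" t] by (rule unipotent_commute) auto
      have *: "A_class n i s * A_class n i t = ?a s * ?a t * (hfac (i + 1) (- t) * hfac i s * hfac (i + 1) t * hfac i t)" for s t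
      proof -
        have "A_class n i s * A_class n i t = ?a s * (hfac i s * ?b t) * hfac (i + 1) t * hfac i t"
          using step(2) by (simp only: A_class_rec a mult.assoc)
        also have "\<dots> = ?a s * (?b t * hfac i s) * hfac (i + 1) t * hfac i t"
          by (simp only: bh)
        also have "\<dots> = ?a s * ?a t * (hfac (i + 1) (- t) * hfac i s * hfac (i + 1) t * hfac i t)"
          by (simp only: b mult.assoc)
        finally show ?thesis .
      qed
      have yb: "hfac (i + 1) (s - t) * hfac i s * hfac (i + 1) t = hfac i t * hfac (i + 1) s * hfac i (s - t)" for s t
        using yang_baxter[of i t "s - t"] step(4) by simp
      have "hfac (i + 1) (- t) * hfac i s * hfac (i + 1) t * hfac i t = hfac (i + 1) (- s) * (hfac (i + 1) (s - t) * hfac i s * hfac (i + 1) t) * hfac i t"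
        by (simp add: hfac_add flip: mult.assoc)
      also have "\<dots> = hfac (i + 1) (- s) * hfac i t * hfac (i + 1) s * (hfac i (s - t) * hfac i t)"
        unfolding yb by (simp only: mult.assoc)
      also have "\<dots> = hfac (i + 1) (- s) * hfac i t * hfac (i + 1) s * hfac i s"
        by (simp add: hfac_add)
      finally show ?thesis
        unfolding * using step(3) by simp
    qed
  qed
qed (simp add: A_class_trivial)

text \<open>The block of the variables \<open>y (c + 1), \<dots>, y d\<close> as it occurs in a Stanley function of an element that
  fixes \<open>1, \<dots>, c\<close>: all its factors start at the same letter \<open>c + 1\<close>.\<close>

definition A_block :: "nat \<Rightarrow> nat \<Rightarrow> nat \<Rightarrow> (nat \<Rightarrow> 'r) \<Rightarrow> 'r::comm_ring_1 nilcox" where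
  "A_block n c d y = (\<Prod>k\<leftarrow>[c + 1..<d + 1]. A_class n (c + 1) (y k))"

definition A_tilde_block :: "nat \<Rightarrow> nat \<Rightarrow> nat \<Rightarrow> (nat \<Rightarrow> 'r) \<Rightarrow> 'r::comm_ring_1 nilcox" where
  "A_tilde_block n c d z = (\<Prod>k\<leftarrow>[c + 1..<d + 1]. A_tilde_class n (c + 1) (z k))"

text \<open>The same variables as they occur in a Schubert polynomial, where the factor of \<open>y k\<close> starts at the
  letter \<open>k\<close>.\<close>

definition A_staircase :: "nat \<Rightarrow> nat \<Rightarrow> nat \<Rightarrow> (nat \<Rightarrow> 'r) \<Rightarrow> 'r::comm_ring_1 nilcox" where
  "A_staircase n c d y = (\<Prod>k\<leftarrow>[c + 1..<d + 1]. A_class n k (y k))"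

lemma A_block_unipotent: "A_block n c d y \<in> unipotent {c + 1..<n}"
  unfolding A_block_def by (rule unipotent_prod_list) (auto intro: A_class_unipotent)

lemma A_tilde_block_unipotent: "A_tilde_block n c d y \<in> unipotent {c + 1..<n}"
  unfolding A_tilde_block_def by (rule unipotent_prod_list) (auto intro: A_tilde_class_unipotent)

lemma A_class_split:
  assumes "c \<le> d" shows "\<exists>Q\<in>unipotent {c..<d}. A_class n c t = A_class n d t * Q"
proof (cases "d \<le> n")
  case True
  have "(\<Prod>j\<leftarrow>rev [c..<d]. hfac j t) \<in> unipotent {c..<d}"
    by (rule unipotent_prod_list) (auto intro: unipotent_hfac)
  moreover have "[c..<n] = [c..<d] @ [d..<n]"
    using assms True by (metis le_Suc_ex upt_add_eq_append)
  ultimately show ?thesis by (auto simp: A_class_def)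
next
  case False
  then have "unipotent {c..<n} \<subseteq> (unipotent {c..<d} :: 'a nilcox set)" by (intro unipotent_subset) auto
  then show ?thesis using False A_class_unipotent[of n c t] by (auto simp: A_class_trivial)
qed

text \<open>The factor of \<open>y k\<close> in the block is its factor in the staircase times a product over the letters from
  \<open>c + 1\<close> to \<open>k - 1\<close>. These letters are far from those of all later staircase factors, which start
  beyond \<open>k\<close>, so the excess can be collected at the right end. It involves only letters strictly
  between \<open>c\<close> and \<open>d\<close>.\<close>

lemma A_block_eq_staircase_mult:
  assumes "c \<le> d" shows "\<exists>R\<in>unipotent {c + 1..<d}. A_block n c d y = A_staircase n c d y * R"
  using assms
proof (induction d rule: dec_induct)
  case base
  then show ?case using unipotent_one by (simp add: A_block_def A_staircase_def)
next
  case (step d)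
  then obtain R where R: "R \<in> unipotent {c + 1..<d}" "A_block n c d y = A_staircase n c d y * R" by blast
  obtain Q where Q: "Q \<in> unipotent {c + 1..<d + 1}" "A_class n (c + 1) (y (d + 1)) = A_class n (d + 1) (y (d + 1)) * Q"
    using A_class_split[of "c + 1" "d + 1" n "y (d + 1)"] step(1) by auto
  have comm: "R * A_class n (d + 1) (y (d + 1)) = A_class n (d + 1) (y (d + 1)) * R"
    using R(1) A_class_unipotent by (rule unipotent_commute) auto
  have "A_block n c (Suc d) y = A_block n c d y * A_class n (c + 1) (y (d + 1))"
    using step(1) by (simp add: A_block_def)
  also have "\<dots> = A_staircase n c d y * (R * A_class n (d + 1) (y (d + 1))) * Q"
    unfolding R(2) Q(2) by (simp only: mult.assoc)
  also have "\<dots> = A_staircase n c (Suc d) y * (R * Q)"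
    unfolding comm using step(1) by (simp add: A_staircase_def mult.assoc)
  finally have "A_block n c (Suc d) y = A_staircase n c (Suc d) y * (R * Q)" .
  moreover have "R \<in> unipotent {c + 1..<Suc d}" using R(1) unipotent_subset[of "{c + 1..<d}" "{c + 1..<Suc d}"] by auto
  then have "R * Q \<in> unipotent {c + 1..<Suc d}" using Q(1) by (intro unipotent_mult) simp_all
  ultimately show ?case by blast
qed

lemma prod_list_upt_split: "c \<le> d \<Longrightarrow> d \<le> e \<Longrightarrow> (\<Prod>k\<leftarrow>[c..<e]. f k) = (\<Prod>k\<leftarrow>[c..<d]. f k) * (\<Prod>k\<leftarrow>[d..<e]. f k :: 'a::monoid_mult)"
  by (metis le_Suc_ex map_append prod_list.append upt_add_eq_append)

lemma prod_list_trivial: "(\<And>x. x \<in> set xs \<Longrightarrow> f x = 1) \<Longrightarrow> (\<Prod>x\<leftarrow>xs. f x :: 'a::monoid_mult) = 1"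
  by (induction xs) auto

text \<open>Replacing the staircase on the positions from \<open>a (k - 1) + 1\<close> to \<open>a k\<close> by a block introduces an
  excess factor in the letters strictly between \<open>a (k - 1)\<close> and \<open>a k\<close>. It commutes with the
  later blocks, whose letters exceed \<open>a k\<close>, and at the right end it is invisible to the coefficient
  of \<open>w\<close>, which has no descents at these letters. The staircase beyond \<open>a p\<close> disappears for the
  same reason.\<close>

lemma right_block_reduction:
  fixes y :: "nat \<Rightarrow> 'r::comm_ring_1"
  assumes w: "w \<in> W_inf" and p: "1 \<le> p" and a: "strict_mono_on {1..p} a" and a0: "a 0 = 0"
    and has_descent: "\<And>r. has_descent w r \<Longrightarrow> r \<in> a ` {1..p}"
  shows "ncoef w (\<xi> * (\<Prod>i\<leftarrow>[1..<n]. A_class n i (y i))) =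
    ncoef w (\<xi> * (\<Prod>k\<leftarrow>[1..<p + 1]. A_block n (a (k - 1)) (a k) y))"
proof -
  have a_le: "a k \<le> a l" if "k \<le> l" "l \<le> p" for k l
    using that a a0 strict_mono_onD[OF a, of k l] by (cases "k = 0"; cases "k = l") auto
  have gap: "\<not> has_descent w r" if "r \<in> {a m + 1..<a (m + 1)}" "m < p" for m r
  proof
    assume "has_descent w r"
    from has_descent[OF this] obtain k where k: "r = a k" "1 \<le> k" "k \<le> p" by auto
    have "m < k" using that k a_le[of k m] by (cases "m < k") auto
    moreover have "k < m + 1" using that k a_le[of "m + 1" k] by (cases "k < m + 1") auto
    ultimately show False by simp
  qed
  have last: "\<not> has_descent w r" if "r \<in> {a p + 1..<n}" for r
    using that has_descent[of r] a_le by fastforce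
  let ?f = "\<lambda>k. A_class n k (y k)"
  let ?E = "\<lambda>k. A_block n (a (k - 1)) (a k) y"
  let ?M = "max n (a p + 1)"
  \<comment> \<open>The staircase may be prolonged beyond \<open>n\<close>, where its factors are 1; this covers \<open>a p \<ge> n\<close>.\<close>
  have "(\<Prod>i\<leftarrow>[1..<n]. ?f i) = (\<Prod>i\<leftarrow>[1..<?M]. ?f i)"
  proof (cases "1 \<le> n")
    case True
    then have "(\<Prod>i\<leftarrow>[1..<?M]. ?f i) = (\<Prod>i\<leftarrow>[1..<n]. ?f i) * (\<Prod>i\<leftarrow>[n..<?M]. ?f i)"
      by (intro prod_list_upt_split) auto
    moreover have "(\<Prod>i\<leftarrow>[n..<?M]. ?f i) = 1"
      by (rule prod_list_trivial) (simp add: A_class_trivial)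
    ultimately show ?thesis by simp
  next
    case False
    then have "(\<Prod>i\<leftarrow>[1..<?M]. ?f i) = 1"
      by (intro prod_list_trivial) (simp add: A_class_trivial)
    with False show ?thesis by simp
  qed
  also have "\<dots> = A_staircase n 0 (a p) y * (\<Prod>i\<leftarrow>[a p + 1..<?M]. ?f i)"
    unfolding A_staircase_def by (subst prod_list_upt_split[of 1 "a p + 1"]) auto
  finally have eq: "(\<Prod>i\<leftarrow>[1..<n]. ?f i) = A_staircase n 0 (a p) y * (\<Prod>i\<leftarrow>[a p + 1..<?M]. ?f i)" .
  have "?f i \<in> unipotent {a p + 1..<n}" if "a p + 1 \<le> i" for i
    using A_class_unipotent[of n i "y i"] unipotent_subset[of "{i..<n}" "{a p + 1..<n}"] that by auto
  then have tail: "(\<Prod>i\<leftarrow>[a p + 1..<?M]. ?f i) \<in> unipotent {a p + 1..<n}"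
    by (intro unipotent_prod_list) auto
  have 1: "ncoef w (\<xi> * (\<Prod>i\<leftarrow>[1..<n]. ?f i)) = ncoef w (\<xi> * A_staircase n 0 (a p) y)"
    unfolding eq mult.assoc[symmetric] by (rule ncoef_mult_unipotent[OF w tail last])
  \<comment> \<open>The blocks are formed from right to left; \<open>m\<close> of them are still in staircase form.\<close>
  have 2: "ncoef w (\<xi> * A_staircase n 0 (a m) y * (\<Prod>k\<leftarrow>[m + 1..<p + 1]. ?E k)) = ncoef w (\<xi> * A_staircase n 0 (a p) y)"
    if "m \<le> p" for m
    using that
  proof (induction m rule: inc_induct)
    case base
    then show ?case by simp
  next
    case (step m)
    let ?B = "\<Prod>k\<leftarrow>[m + 2..<p + 1]. ?E k"
    obtain R where R: "R \<in> unipotent {a m + 1..<a (m + 1)}" "?E (m + 1) = A_staircase n (a m) (a (m + 1)) y * R"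
      using A_block_eq_staircase_mult[of "a m" "a (m + 1)" n y] a_le[of m "m + 1"] step(2) by auto
    have "?E k \<in> unipotent {a (m + 1) + 1..<n}" if "m + 2 \<le> k" "k \<le> p" for k
      using A_block_unipotent[of n "a (k - 1)" "a k" y] unipotent_subset[of "{a (k - 1) + 1..<n}" "{a (m + 1) + 1..<n}"]
        that a_le[of "m + 1" "k - 1"] by auto
    then have B: "?B \<in> unipotent {a (m + 1) + 1..<n}"
      by (intro unipotent_prod_list) auto
    have RB: "R * ?B = ?B * R"
      using R(1) B by (rule unipotent_commute) auto
    have D: "A_staircase n 0 (a m) y * A_staircase n (a m) (a (m + 1)) y = A_staircase n 0 (a (m + 1)) y"
      unfolding A_staircase_def using a_le[of m "m + 1"] step(2)
      by (subst prod_list_upt_split[of "0 + 1" "a m + 1" "a (m + 1) + 1"]) auto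
    have "[m + 1..<p + 1] = (m + 1) # [m + 2..<p + 1]"
      using step(2) by (simp add: upt_rec[of "Suc m"])
    then have "ncoef w (\<xi> * A_staircase n 0 (a m) y * (\<Prod>k\<leftarrow>[m + 1..<p + 1]. ?E k)) =
      ncoef w (\<xi> * A_staircase n 0 (a m) y * (?E (m + 1) * ?B))" by simp
    also have "\<xi> * A_staircase n 0 (a m) y * (?E (m + 1) * ?B) = \<xi> * (A_staircase n 0 (a m) y * A_staircase n (a m) (a (m + 1)) y) * (R * ?B)"
      unfolding R(2) by (simp only: mult.assoc)
    also have "\<dots> = \<xi> * A_staircase n 0 (a (m + 1)) y * ?B * R"
      unfolding D RB by (simp only: mult.assoc)
    also have "ncoef w \<dots> = ncoef w (\<xi> * A_staircase n 0 (a (m + 1)) y * ?B)"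
      by (rule ncoef_mult_unipotent[OF w R(1) gap[OF _ step(2)]])
    also have "\<dots> = ncoef w (\<xi> * A_staircase n 0 (a p) y)"
      using step(3) by simp
    finally show ?case .
  qed
  have "A_staircase n 0 (a 0) y = 1" by (simp add: A_staircase_def a0)
  with 1 2[of 0] show ?thesis by simp
qed

lemma prod_list_rev_commute:
  assumes "\<And>x y. x \<in> set xs \<Longrightarrow> y \<in> set xs \<Longrightarrow> x * y = y * (x :: 'a::monoid_mult)"
  shows "prod_list (rev xs) = prod_list xs"
  using assms
proof (induction xs)
  case (Cons x xs)
  have "prod_list xs * x = x * prod_list xs"
    using Cons.prems
  proof (induction xs)
    case (Cons z xs)
    then have "z * x = x * z" "prod_list xs * x = x * prod_list xs" by auto
    then show ?case by (metis mult.assoc prod_list.Cons)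
  qed simp
  with Cons show ?case by simp
qed simp

lemma adjoint_map:
  assumes "\<And>x. x \<in> set xs \<Longrightarrow> adjoint (f x) (g x)"
  shows "adjoint (prod_list (map f xs)) (prod_list (map g (rev xs)))"
proof -
  have "list_all2 adjoint (map f xs) (map g xs)" using assms by (simp add: list_all2_conv_all_nth)
  from adjoint_prod_list[OF this] show ?thesis by (simp add: rev_map)
qed

lemma adjoint_A_tilde_class: "adjoint (A_tilde_class n i t) (A_class n i (- t))"
  unfolding A_tilde_class_def A_class_def by (rule adjoint_map) (rule adjoint_hfac)

text \<open>The antiautomorphism reverses the order of the variables within the block; this is undone by
  commutativity.\<close>

lemma adjoint_A_tilde_block: "adjoint (A_tilde_block n c d z) (A_block n c d (\<lambda>k. - z k))"
proof -
  have "A_block n c d (\<lambda>k. - z k) = prod_list (rev (map (\<lambda>k. A_class n (c + 1) (- z k)) [c + 1..<d + 1]))"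
    unfolding A_block_def by (rule prod_list_rev_commute[symmetric]) (auto intro: A_class_commute)
  then show ?thesis
    unfolding A_tilde_block_def rev_map by (metis adjoint_map adjoint_A_tilde_class)
qed

lemma unipotent_adjoint:
  assumes "\<xi> \<in> unipotent T" shows "\<exists>\<xi>'. adjoint \<xi> \<xi>'"
  using assms by (induction rule: unipotent_induct) (auto intro: adjoint_one adjoint_mult adjoint_hfac)

text \<open>The mirror image of \<open>right_block_reduction\<close> under the antiautomorphism, applied to \<open>inv w\<close> and the
  variables \<open>- z\<close>.\<close>

lemma left_block_reduction:
  fixes z :: "nat \<Rightarrow> 'r::comm_ring_1"
  assumes w: "w \<in> W_inf" and q: "1 \<le> q" and b: "strict_mono_on {1..q} b" and b0: "b 0 = 0"
    and has_descent: "\<And>r. has_descent (inv w) r \<Longrightarrow> r \<in> b ` {1..q}" and \<xi>: "\<xi> \<in> unipotent T"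
  shows "ncoef w ((\<Prod>i\<leftarrow>rev [1..<n]. A_tilde_class n i (z i)) * \<xi>) =
    ncoef w ((\<Prod>k\<leftarrow>rev [1..<q + 1]. A_tilde_block n (b (k - 1)) (b k) z) * \<xi>)"
proof -
  obtain \<xi>' where \<xi>': "adjoint \<xi> \<xi>'" using unipotent_adjoint[OF \<xi>] by blast
  let ?y = "\<lambda>k. - z k"
  have "adjoint (\<Prod>i\<leftarrow>rev [1..<n]. A_tilde_class n i (z i)) (\<Prod>i\<leftarrow>rev (rev [1..<n]). A_class n i (?y i))"
    by (rule adjoint_map) (rule adjoint_A_tilde_class)
  from adjoint_mult[OF this \<xi>']
  have 1: "ncoef w ((\<Prod>i\<leftarrow>rev [1..<n]. A_tilde_class n i (z i)) * \<xi>) = ncoef (inv w) (\<xi>' * (\<Prod>i\<leftarrow>[1..<n]. A_class n i (?y i)))"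
    using w by (simp add: adjoint_def)
  have "adjoint (\<Prod>k\<leftarrow>rev [1..<q + 1]. A_tilde_block n (b (k - 1)) (b k) z) (\<Prod>k\<leftarrow>rev (rev [1..<q + 1]). A_block n (b (k - 1)) (b k) ?y)"
    by (rule adjoint_map) (rule adjoint_A_tilde_block)
  from adjoint_mult[OF this \<xi>']
  have 2: "ncoef w ((\<Prod>k\<leftarrow>rev [1..<q + 1]. A_tilde_block n (b (k - 1)) (b k) z) * \<xi>) =
      ncoef (inv w) (\<xi>' * (\<Prod>k\<leftarrow>[1..<q + 1]. A_block n (b (k - 1)) (b k) ?y))"
    using w by (simp add: adjoint_def)
  show ?thesis unfolding 1 2 by (rule right_block_reduction[OF inv_in_W_inf[OF w] q b b0 has_descent])
qed

section \<open>Coefficients of products and reduced factorizations\<close>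

definition factorizations :: "nat \<Rightarrow> (int \<Rightarrow> int) \<Rightarrow> (int \<Rightarrow> int) list set" where
  "factorizations l w = {us. length us = l \<and> reduced_factorization us w}"

lemma cox_length_factorization:
  assumes "set us \<subseteq> W_inf"
  shows "foldr (\<circ>) us id \<in> W_inf" "cox_length (foldr (\<circ>) us id) \<le> (\<Sum>v\<leftarrow>us. cox_length v)"
proof -
  have "foldr (\<circ>) us id \<in> W_inf \<and> cox_length (foldr (\<circ>) us id) \<le> (\<Sum>v\<leftarrow>us. cox_length v)"
    using assms
  proof (induction us)
    case Nil
    have "foldr (\<circ>) [] id \<in> W_inf \<and> cox_length (foldr (\<circ>) [] id) \<le> (\<Sum>v\<leftarrow>[]. cox_length v)"
      using W_subset_W_inf[OF id_in_W] by simp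
    then show ?case .
  next
    case (Cons u us)
    have u: "u \<in> W_inf" and us: "set us \<subseteq> W_inf" using Cons.prems by simp_all
    have "foldr (\<circ>) us id \<in> W_inf \<and> cox_length (foldr (\<circ>) us id) \<le> (\<Sum>v\<leftarrow>us. cox_length v)"
      using Cons.IH[OF us] .
    with u have "u \<circ> foldr (\<circ>) us id \<in> W_inf"
      "cox_length (u \<circ> foldr (\<circ>) us id) \<le> (\<Sum>v\<leftarrow>u # us. cox_length v)"
      using comp_in_W_inf cox_length_comp_le[of u "foldr (\<circ>) us id"] by auto
    then have "foldr (\<circ>) (u # us) id \<in> W_inf \<and> cox_length (foldr (\<circ>) (u # us) id) \<le> (\<Sum>v\<leftarrow>u # us. cox_length v)"
      by simp
    then show ?case .
  qed
  then show "foldr (\<circ>) us id \<in> W_inf" "cox_length (foldr (\<circ>) us id) \<le> (\<Sum>v\<leftarrow>us. cox_length v)" by blast+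
qed

lemma factorizations_Suc:
  assumes w: "w \<in> W_inf"
  shows "factorizations (Suc l) w = (\<lambda>((u, v), us). u # us) ` (SIGMA (u, v):red_splits w. factorizations l v)"
proof (intro equalityI subsetI)
  fix xs assume "xs \<in> factorizations (Suc l) w"
  then obtain u us where xs: "xs = u # us" "length us = l" and fac: "reduced_factorization (u # us) w"
    by (auto simp: factorizations_def length_Suc_conv)
  let ?v = "foldr (\<circ>) us id"
  have uv: "u \<in> W_inf" "set us \<subseteq> W_inf" "u \<circ> ?v = w" "cox_length u + (\<Sum>v\<leftarrow>us. cox_length v) = cox_length w"
    using fac by (auto simp: reduced_factorization_def)
  then have v: "?v \<in> W_inf" "cox_length ?v \<le> (\<Sum>v\<leftarrow>us. cox_length v)"
    using cox_length_factorization by blast+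
  have "cox_length w \<le> cox_length u + cox_length ?v"
    using cox_length_comp_le[OF uv(1) v(1)] uv(3) by simp
  then have len: "cox_length ?v = (\<Sum>v\<leftarrow>us. cox_length v)" using v(2) uv(4) by linarith
  have "(u, ?v) \<in> red_splits w" using uv v(1) len by (simp add: red_splits_def)
  moreover have "us \<in> factorizations l ?v"
    using uv(2) len xs(2) by (simp add: factorizations_def reduced_factorization_def)
  ultimately show "xs \<in> (\<lambda>((u, v), us). u # us) ` (SIGMA (u, v):red_splits w. factorizations l v)"
    by (intro image_eqI[of _ _ "((u, ?v), us)"]) (simp_all add: xs)
next
  fix xs assume "xs \<in> (\<lambda>((u, v), us). u # us) ` (SIGMA (u, v):red_splits w. factorizations l v)"
  then obtain u v us where xs: "xs = u # us" and uv: "(u, v) \<in> red_splits w" and us: "us \<in> factorizations l v"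
    by auto
  then show "xs \<in> factorizations (Suc l) w"
    by (simp add: factorizations_def reduced_factorization_def red_splits_def)
qed

lemma finite_factorizations: "w \<in> W_inf \<Longrightarrow> finite (factorizations l w)"
proof (induction l arbitrary: w)
  case 0
  have "factorizations 0 w \<subseteq> {[]}" by (auto simp: factorizations_def)
  then show ?case by (rule finite_subset) simp
next
  case (Suc l)
  then show ?case
    unfolding factorizations_Suc[OF Suc.prems]
    by (intro finite_imageI finite_SigmaI finite_red_splits) (auto simp: red_splits_def)
qed

text \<open>The iterated coproduct rule. For a list of factors it is a sum over length-additive factorizations
  with as many parts as there are factors.\<close>

lemma ncoef_prod_list:
  assumes "w \<in> W_inf"
  shows "ncoef w (prod_list \<xi>s) = (\<Sum>us\<in>factorizations (length \<xi>s) w. \<Prod>k<length \<xi>s. ncoef (us ! k) (\<xi>s ! k))"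
  using assms
proof (induction \<xi>s arbitrary: w)
  case Nil
  have "cox_length w = 0 \<longleftrightarrow> w = id" using cox_length_eq_0[OF Nil] cox_length_id by blast
  then have "factorizations 0 w = (if w = id then {[]} else {})"
    by (auto simp: factorizations_def reduced_factorization_def fun_eq_iff)
  then show ?case by (simp add: ncoef_one)
next
  case (Cons \<xi> \<xi>s)
  let ?l = "length \<xi>s"
  let ?P = "\<lambda>us. \<Prod>k<?l. ncoef (us ! k) (\<xi>s ! k)"
  let ?S = "SIGMA (u, v):red_splits w. factorizations ?l v"
  have fin: "finite (factorizations ?l (snd x))" if "x \<in> red_splits w" for x
    using that by (intro finite_factorizations) (auto simp: red_splits_def)
  have inj: "inj_on (\<lambda>((u, v), us). u # us) ?S"
    by (auto simp: inj_on_def factorizations_def reduced_factorization_def)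
  have "ncoef w (prod_list (\<xi> # \<xi>s)) = (\<Sum>(u, v)\<in>red_splits w. ncoef u \<xi> * ncoef v (prod_list \<xi>s))"
    by (simp add: ncoef_mult)
  also have "\<dots> = (\<Sum>x\<in>red_splits w. \<Sum>us\<in>factorizations ?l (snd x). ncoef (fst x) \<xi> * ?P us)"
  proof (rule sum.cong)
    fix x assume "x \<in> red_splits w"
    then have "snd x \<in> W_inf" by (auto simp: red_splits_def)
    from Cons.IH[OF this] show "(case x of (u, v) \<Rightarrow> ncoef u \<xi> * ncoef v (prod_list \<xi>s)) =
        (\<Sum>us\<in>factorizations ?l (snd x). ncoef (fst x) \<xi> * ?P us)"
      by (simp add: split_def sum_distrib_left)
  qed simp
  also have "\<dots> = (\<Sum>(x, us)\<in>?S. ncoef (fst x) \<xi> * ?P us)"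
    using fin finite_red_splits by (subst sum.Sigma) (auto simp: split_def)
  also have "\<dots> = (\<Sum>us\<in>factorizations (Suc ?l) w. \<Prod>k<Suc ?l. ncoef (us ! k) ((\<xi> # \<xi>s) ! k))"
    unfolding factorizations_Suc[OF Cons.prems]
    by (subst sum.reindex[OF inj]) (simp add: split_def prod.lessThan_Suc_shift del: prod.lessThan_Suc)
  finally show ?case by simp
qed

lemma red_splits_W:
  assumes "w \<in> W n" "(u, v) \<in> red_splits w" shows "u \<in> W n" "v \<in> W n"
proof -
  have "w \<in> parabolic {..<n}" using assms(1) red_words_letters[OF assms(1)] W_subset_W_inf by (auto simp: parabolic_def)
  note uv = parabolic_red_splits[OF this assms(2)]
  have *: "x \<in> W n" if "x \<in> parabolic {..<n}" for x
    using that red_words_nonempty red_words_W[of _ x n] unfolding parabolic_def by blast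
  from uv * show "u \<in> W n" "v \<in> W n" by auto
qed

lemma factorizations_W:
  assumes "w \<in> W n" "us \<in> factorizations l w" shows "set us \<subseteq> W n"
  using assms
proof (induction l arbitrary: w us)
  case 0
  then show ?case by (simp add: factorizations_def)
next
  case (Suc l)
  obtain u v vs where us: "us = u # vs" "(u, v) \<in> red_splits w" "vs \<in> factorizations l v"
    using Suc.prems(2) unfolding factorizations_Suc[OF W_subset_W_inf[OF Suc.prems(1)]] by auto
  with Suc.IH[of v vs] red_splits_W[OF Suc.prems(1) us(2)] show ?case by simp
qed

text \<open>The condition that compatibility puts on a factor. By the next two lemmas it characterizes the
  parabolic subgroup of the letters greater than \<open>c\<close>.\<close>

definition fixes_below :: "nat \<Rightarrow> (int \<Rightarrow> int) \<Rightarrow> bool" where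
  "fixes_below c u \<longleftrightarrow> u \<in> S_inf \<and> (\<forall>i\<in>{1..c}. u (int i) = int i)"

text \<open>An element that is positive on positive integers and fixes \<open>1, \<dots>, c\<close> has no descent at \<open>0, \<dots>, c\<close>,
  and multiplying it by a descent preserves the two properties.\<close>

lemma fixes_below_letters:
  assumes "fixes_below c u" "as \<in> red_words u" shows "set as \<subseteq> {c<..}"
  using assms
proof (induction as arbitrary: u rule: rev_induct)
  case (snoc r as)
  have u: "u \<in> W_inf" and d: "has_descent u r" and as: "as \<in> red_words (u \<circ> sgen r)"
    using snoc.prems(2) by (auto simp: red_words_snoc_iff)
  have pos: "0 < u i" if "0 < i" for i using snoc.prems(1) that by (auto simp: fixes_below_def S_inf_def)
  have fixed: "u i = i" if "1 \<le> i" "i \<le> int c" for i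
    using snoc.prems(1) that by (auto simp: fixes_below_def dest!: bspec[of _ _ "nat i"])
  have rc: "c < r"
  proof (rule ccontr)
    assume "\<not> c < r"
    then have r: "r \<le> c" by simp
    have "r \<noteq> 0" using d pos[of 1] by (auto simp: has_descent_def split: if_splits)
    then have lt: "u (int r + 1) < int r" using d fixed[of "int r"] r by (simp add: has_descent_def)
    then have "u (u (int r + 1)) = u (int r + 1)" using r pos[of "int r + 1"] by (intro fixed) auto
    then have "u (int r + 1) = int r + 1" using W_infD(4)[OF u] by blast
    with lt show False by simp
  qed
  have "u \<circ> sgen r \<in> S_inf"
    using comp_in_W_inf[OF u sgen_in_W_inf] pos rc by (simp add: S_inf_def sgen_pos_iff)
  moreover have "(u \<circ> sgen r) (int i) = int i" if "i \<in> {1..c}" for i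
    using that rc fixed[of "int i"] by (simp add: sgen_pos)
  ultimately have "fixes_below c (u \<circ> sgen r)" by (simp add: fixes_below_def)
  from snoc.IH[OF this as] rc show ?case by simp
qed simp

lemma letters_fixes_below:
  assumes "set as \<subseteq> {c<..}" shows "fixes_below c (word_prod as)"
proof -
  have "0 < i \<Longrightarrow> 0 < word_prod as i" "i \<in> {1..int c} \<Longrightarrow> word_prod as i = i" for i
    using assms by (induction as) (auto simp: word_prod_Cons sgen_pos_iff sgen_pos)
  then show ?thesis using word_prod_in_W_inf[of as] by (auto simp: fixes_below_def S_inf_def)
qed

lemma unipotent_ncoef_fixes_below:
  assumes "\<xi> \<in> unipotent {c + 1..<n}" "u \<in> W_inf" "ncoef u \<xi> \<noteq> 0"
  shows "fixes_below c u"
proof -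
  obtain as where as: "as \<in> red_words u" "set as \<subseteq> {c + 1..<n}" using unipotent_support[OF assms] by blast
  have "fixes_below c (word_prod as)" using as(2) by (intro letters_fixes_below) auto
  then show ?thesis using as(1) by (simp add: red_words_def)
qed

section \<open>Stable limits and evaluation at blocks of variables\<close>

text \<open>Coefficientwise stabilisation, the notion of limit behind \<open>stable_limit\<close>.\<close>

definition converges_to :: "(nat \<Rightarrow> ('v, 'a) mseries) \<Rightarrow> ('v, 'a) mseries \<Rightarrow> bool" where
  "converges_to f F \<longleftrightarrow> (\<forall>m. \<exists>N0. \<forall>N\<ge>N0. mcoeff (f N) m = mcoeff F m)"

lemma stable_limitI:
  assumes "converges_to f F" shows "stable_limit f = F"
proof -
  have "(THE c. \<exists>N0. \<forall>N\<ge>N0. mcoeff (f N) m = c) = mcoeff F m" for m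
  proof (rule the_equality)
    show "\<exists>N0. \<forall>N\<ge>N0. mcoeff (f N) m = mcoeff F m" using assms by (simp add: converges_to_def)
  next
    fix c assume "\<exists>N0. \<forall>N\<ge>N0. mcoeff (f N) m = c"
    then obtain N0 where "\<forall>N\<ge>N0. mcoeff (f N) m = c" by blast
    moreover obtain N1 where "\<forall>N\<ge>N1. mcoeff (f N) m = mcoeff F m"
      using assms by (auto simp: converges_to_def)
    ultimately show "c = mcoeff F m" by (metis max.cobounded1 max.cobounded2)
  qed
  then show ?thesis by (simp add: stable_limit_def mcoeff_inverse)
qed

lemma converges_to_eventually:
  assumes "converges_to g F" "\<And>N. N \<ge> N0 \<Longrightarrow> f N = g N" shows "converges_to f F"
  unfolding converges_to_def
proof
  fix m
  obtain N1 where "\<forall>N\<ge>N1. mcoeff (g N) m = mcoeff F m" using assms(1) by (auto simp: converges_to_def)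
  then show "\<exists>N0. \<forall>N\<ge>N0. mcoeff (f N) m = mcoeff F m"
    using assms(2) by (intro exI[of _ "max N0 N1"]) simp
qed

lemma converges_to_const: "converges_to (\<lambda>_. F) F"
  by (simp add: converges_to_def)

lemma converges_to_add:
  assumes "converges_to f F" "converges_to g G" shows "converges_to (\<lambda>N. f N + g N) (F + G)"
  unfolding converges_to_def
proof
  fix m
  obtain N1 where "\<forall>N\<ge>N1. mcoeff (f N) m = mcoeff F m" using assms(1) by (auto simp: converges_to_def)
  moreover obtain N2 where "\<forall>N\<ge>N2. mcoeff (g N) m = mcoeff G m" using assms(2) by (auto simp: converges_to_def)
  ultimately show "\<exists>N0. \<forall>N\<ge>N0. mcoeff (f N + g N) m = mcoeff (F + G) m"
    by (intro exI[of _ "max N1 N2"]) (simp add: plus_mseries.rep_eq)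
qed

lemma converges_to_mult_left:
  assumes "converges_to f F" shows "converges_to (\<lambda>N. G * f N) (G * F :: ('v, 'a::comm_ring_1) mseries)"
  unfolding converges_to_def
proof
  fix m
  have "\<exists>N0. \<forall>N\<ge>N0. mcoeff (f N) b = mcoeff F b" for b
    using assms by (simp add: converges_to_def)
  then obtain N0 where N0: "mcoeff (f N) b = mcoeff F b" if "N \<ge> N0 b" for b N by metis
  have "mcoeff (G * f N) m = mcoeff (G * F) m" if N: "N \<ge> Max (N0 ` snd ` splits m)" for N
    unfolding times_mseries.rep_eq
  proof (rule sum.cong)
    fix x assume x: "x \<in> splits m"
    then have "N0 (snd x) \<le> Max (N0 ` snd ` splits m)" by (intro Max_ge) (auto simp: finite_splits)
    then show "(case x of (a, b) \<Rightarrow> mcoeff G a * mcoeff (f N) b) = (case x of (a, b) \<Rightarrow> mcoeff G a * mcoeff F b)"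
      using N0[of "snd x" N] N by (simp add: split_def)
  qed simp
  then show "\<exists>N0. \<forall>N\<ge>N0. mcoeff (G * f N) m = mcoeff (G * F) m" by blast
qed

lemma converges_to_sum:
  assumes "\<And>i. i \<in> I \<Longrightarrow> converges_to (f i) (F i)"
  shows "converges_to (\<lambda>N. \<Sum>i\<in>I. f i N) (\<Sum>i\<in>I. F i :: ('v, 'a::comm_ring_1) mseries)"
  using assms
proof (induction I rule: infinite_finite_induct)
  case (insert x I)
  then have "converges_to (\<lambda>N. f x N + (\<Sum>i\<in>I. f i N)) (F x + (\<Sum>i\<in>I. F i))"
    by (intro converges_to_add) auto
  with insert show ?case by simp
qed (simp_all add: converges_to_const)

lemma mcoeff_mvar_mult:
  assumes "v \<notin> Poly_Mapping.keys m"
  shows "mcoeff (mvar v * f) m = (0 :: 'a::comm_ring_1)"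
  unfolding times_mseries.rep_eq
proof (rule sum.neutral, clarify)
  fix a b assume "(a, b) \<in> splits m"
  then have "Poly_Mapping.lookup m v = Poly_Mapping.lookup a v + Poly_Mapping.lookup b v"
    by (auto simp: splits_def lookup_add)
  then have "a \<noteq> Poly_Mapping.single v 1" using assms by (auto simp: in_keys_iff)
  then show "mcoeff (mvar v) a * mcoeff f b = 0" by (simp add: mvar.rep_eq)
qed

text \<open>An increment divisible by the variable \<open>X (Suc N)\<close> does not change the coefficient of a monomial in
  which this variable does not occur.\<close>

lemma converges_to_increments:
  assumes step: "\<And>N. f (Suc N) = f N + X (Suc N) * g N"
  shows "\<exists>F. converges_to f F"
proof -
  have "\<exists>c. \<exists>N0. \<forall>N\<ge>N0. mcoeff (f N) m = c" for m
  proof -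
    have "finite (x_var -` Poly_Mapping.keys m)" by (intro finite_vimageI) (auto simp: inj_on_def)
    then obtain N0 where N0: "\<And>i. x_var i \<in> Poly_Mapping.keys m \<Longrightarrow> i < N0"
      using finite_nat_set_iff_bounded[of "x_var -` Poly_Mapping.keys m"] by auto
    have "mcoeff (f N) m = mcoeff (f N0) m" if "N \<ge> N0" for N
      using that
    proof (induction N rule: dec_induct)
      case (step N)
      have "x_var (Suc N) \<notin> Poly_Mapping.keys m" using N0[of "Suc N"] step(1) by auto
      from mcoeff_mvar_mult[OF this, of "g N"] step show ?case
        by (simp add: assms plus_mseries.rep_eq X_def)
    qed simp
    then show ?thesis by blast
  qed
  then obtain c where "\<forall>m. \<exists>N0. \<forall>N\<ge>N0. mcoeff (f N) m = c m" by metis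
  then have "converges_to f (Abs_mseries c)"
    by (simp add: converges_to_def Abs_mseries_inverse)
  then show ?thesis ..
qed

definition C_prod :: "nat \<Rightarrow> nat \<Rightarrow> (nat \<Rightarrow> 'r) \<Rightarrow> 'r::comm_ring_1 nilcox" where
  "C_prod N n x = (\<Prod>k\<leftarrow>[1..<N + 1]. C_class n (x k))"

lemma hfac_prod_eq_one_plus: "\<exists>\<eta>. (\<Prod>j\<leftarrow>js. hfac j t) = 1 + nconst t * \<eta>"
proof (induction js)
  case Nil
  show ?case by (intro exI[of _ 0]) simp
next
  case (Cons j js)
  then obtain \<eta> where "(\<Prod>j\<leftarrow>js. hfac j t) = 1 + nconst t * \<eta>" by blast
  then have "(\<Prod>j\<leftarrow>j # js. hfac j t) = 1 + nconst t * (ngen j * (1 + nconst t * \<eta>) + \<eta>)"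
    by (simp add: hfac_eq distrib_left distrib_right mult.assoc add.assoc add.commute)
  then show ?case by blast
qed

text \<open>The factor of a variable is 1 plus a multiple of this variable.\<close>

lemma ncoef_C_prod_converges:
  "\<exists>F. converges_to (\<lambda>N. ncoef u (\<xi> * C_prod N n X * \<zeta>)) F"
proof -
  have "\<exists>\<eta>. C_class n (X (Suc N)) = 1 + nconst (X (Suc N)) * \<eta>" for N
    unfolding C_class_def by (rule hfac_prod_eq_one_plus)
  then obtain \<eta> where \<eta>: "\<And>N. C_class n (X (Suc N)) = 1 + nconst (X (Suc N)) * \<eta> N" by metis
  have "ncoef u (\<xi> * C_prod (Suc N) n X * \<zeta>) = ncoef u (\<xi> * C_prod N n X * \<zeta>) +
      X (Suc N) * ncoef u (\<xi> * C_prod N n X * \<eta> N * \<zeta>)" for N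
  proof -
    have "\<xi> * C_prod (Suc N) n X * \<zeta> = \<xi> * C_prod N n X * \<zeta> + (\<xi> * C_prod N n X * nconst (X (Suc N))) * (\<eta> N * \<zeta>)"
      by (simp add: C_prod_def \<eta> distrib_left distrib_right mult.assoc)
    also have "\<dots> = \<xi> * C_prod N n X * \<zeta> + nconst (X (Suc N)) * (\<xi> * C_prod N n X * \<eta> N * \<zeta>)"
      unfolding nconst_central by (simp only: mult.assoc)
    finally show ?thesis by (simp add: ncoef_add ncoef_scale)
  qed
  then show ?thesis by (rule converges_to_increments)
qed

lemma free_carrier_add: "\<xi> \<in> free_carrier n \<Longrightarrow> \<eta> \<in> free_carrier n \<Longrightarrow> \<xi> + \<eta> \<in> free_carrier n"
  using Poly_Mapping.keys_add[of \<xi> \<eta>] by (fastforce simp: free_carrier_def)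

lemma free_carrier_uminus: "\<xi> \<in> free_carrier n \<Longrightarrow> - \<xi> \<in> free_carrier n"
  by (simp add: free_carrier_def)

lemma free_carrier_mult: "\<xi> \<in> free_carrier n \<Longrightarrow> \<eta> \<in> free_carrier n \<Longrightarrow> \<xi> * \<eta> \<in> free_carrier n"
  using keys_mult[of \<xi> \<eta>] by (fastforce simp: free_carrier_def plus_word_def)

lemma free_carrier_one: "1 \<in> free_carrier n"
  using const_free_carrier[of 1 n] by simp

lemma free_carrier_prod_list: "set \<xi>s \<subseteq> free_carrier n \<Longrightarrow> prod_list \<xi>s \<in> free_carrier n"
  by (induction \<xi>s) (auto intro: free_carrier_one free_carrier_mult)

lemma free_carrier_tu: "j < n \<Longrightarrow> tu t j \<in> free_carrier n"
  unfolding tu_def by (rule single_free_carrier) simp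

lemma free_carrier_factors:
  "A_fac n i t \<in> free_carrier n" "A_tilde_fac n i t \<in> free_carrier n" "C_fac n t \<in> free_carrier n"
proof -
  have plus: "1 + tu t j \<in> free_carrier n" if "j < n" for j
    using that by (intro free_carrier_add free_carrier_one free_carrier_tu)
  have minus: "1 - tu t j \<in> free_carrier n" if "j < n" for j
    using free_carrier_add[OF free_carrier_one free_carrier_uminus[OF free_carrier_tu[OF that]]] by simp
  show "A_fac n i t \<in> free_carrier n" "A_tilde_fac n i t \<in> free_carrier n" "C_fac n t \<in> free_carrier n"
    unfolding A_fac_def A_tilde_fac_def C_fac_def
    by (rule free_carrier_prod_list, force intro: plus minus)+
qed

lemma free_carrier_upto:
  "C_upto N n x \<in> free_carrier n" "A_upto N n x \<in> free_carrier n" "A_tilde_upto N n x \<in> free_carrier n"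
  unfolding C_upto_def A_upto_def A_tilde_upto_def
  by (rule free_carrier_prod_list, force intro: free_carrier_factors)+

lemma nil_class_upto:
  "nil_class (C_upto N n x) = C_prod N n x" "nil_class (A_upto N n y) = (\<Prod>k\<leftarrow>[1..<N + 1]. A_class n 1 (y k))"
  "nil_class (A_tilde_upto N n z) = (\<Prod>k\<leftarrow>[1..<N + 1]. A_tilde_class n 1 (z k))"
  unfolding C_upto_def A_upto_def A_tilde_upto_def C_prod_def nil_class_prod_list
  by (simp_all add: o_def nil_class_A_fac nil_class_A_tilde_fac nil_class_C_fac)

lemma A_class_zero [simp]: "A_class n i 0 = 1" and A_tilde_class_zero [simp]: "A_tilde_class n i 0 = 1"
  by (simp_all add: A_class_def A_tilde_class_def prod_list_trivial)

text \<open>A factor \<open>F\<close> with \<open>F 0 = 1\<close> does not see the zeros that pad a block of variables.\<close>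

lemma prod_var_block:
  assumes "a (i - 1) \<le> a i" "a i \<le> N" and F0: "F 0 = (1 :: 'b::monoid_mult)"
  shows "(\<Prod>k\<leftarrow>[1..<N + 1]. F (var_block a v i k)) = (\<Prod>k\<leftarrow>[a (i - 1) + 1..<a i + 1]. F (v k))"
proof -
  let ?c = "a (i - 1)" and ?s = "a i - a (i - 1)"
  have "(\<Prod>k\<leftarrow>[1..<N + 1]. F (var_block a v i k)) =
    (\<Prod>k\<leftarrow>[1..<?s + 1]. F (var_block a v i k)) * (\<Prod>k\<leftarrow>[?s + 1..<N + 1]. F (var_block a v i k))"
    using assms(2) by (intro prod_list_upt_split) auto
  also have "(\<Prod>k\<leftarrow>[?s + 1..<N + 1]. F (var_block a v i k)) = 1"
    by (rule prod_list_trivial) (auto simp: var_block_def F0)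
  also have "map (\<lambda>k. F (var_block a v i k)) [1..<?s + 1] = map (\<lambda>k. F (v k)) [?c + 1..<a i + 1]"
    using assms(1) by (intro nth_equalityI) (auto simp: var_block_def simp del: upt_Suc)
  finally show ?thesis by simp
qed

lemma agree_upt:
  assumes "\<And>j. j \<in> T \<Longrightarrow> j \<in> {i..<m} \<longleftrightarrow> j \<in> {i'..<m'}"
  shows "agree T (\<Prod>j\<leftarrow>[i..<m]. hfac j t) (\<Prod>j\<leftarrow>[i'..<m']. hfac j t)"
    and "agree T (\<Prod>j\<leftarrow>rev [i..<m]. hfac j t) (\<Prod>j\<leftarrow>rev [i'..<m']. hfac j t)"
proof -
  let ?f = "\<lambda>js. filter (\<lambda>j. j \<in> T) js"
  have "?f [i..<m] = ?f [i'..<m']"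
    using assms by (intro sorted_distinct_set_unique) (auto simp: sorted_wrt_filter)
  moreover from this have "?f (rev [i..<m]) = ?f (rev [i'..<m'])" by (simp flip: rev_filter)
  moreover note agree_prod_filter[of T t "[i..<m]"] agree_prod_filter[of T t "[i'..<m']"]
    agree_prod_filter[of T t "rev [i..<m]"] agree_prod_filter[of T t "rev [i'..<m']"]
  ultimately show "agree T (\<Prod>j\<leftarrow>[i..<m]. hfac j t) (\<Prod>j\<leftarrow>[i'..<m']. hfac j t)"
    "agree T (\<Prod>j\<leftarrow>rev [i..<m]. hfac j t) (\<Prod>j\<leftarrow>rev [i'..<m']. hfac j t)"
    by (simp_all add: agree_def)
qed

lemma agree_map_prod:
  "(\<And>x. x \<in> set xs \<Longrightarrow> agree T (f x) (g x)) \<Longrightarrow> agree T (\<Prod>x\<leftarrow>xs. f x) (\<Prod>x\<leftarrow>xs. g x)"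
  by (rule agree_prod_list) (simp add: list_all2_conv_all_nth)

text \<open>The common ground of the two sides is the set of letters between \<open>c\<close> and \<open>m\<close>. This is what makes a
  Stanley function, computed in the least rank and with all letters from 1 on, a coefficient of a
  block in rank \<open>n\<close>.\<close>

lemma agree_blocks:
  assumes "T \<subseteq> {c<..<m}" "m \<le> n"
  shows "agree T (\<Prod>k\<leftarrow>[c + 1..<d + 1]. A_class m 1 (v k)) (A_block n c d v)"
    and "agree T (\<Prod>k\<leftarrow>[c + 1..<d + 1]. A_tilde_class m 1 (v k)) (A_tilde_block n c d v)"
  unfolding A_block_def A_tilde_block_def A_class_def A_tilde_class_def
  using assms by (intro agree_map_prod agree_upt; force)+

lemma agree_C_prod:
  assumes "T \<subseteq> {..<m}" "m \<le> n"
  shows "agree T (C_prod N m x) (C_prod N n x)"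
proof -
  have "agree T (C_class m t) (C_class n t)" for t
    unfolding C_class_def map_append prod_list.append
    using assms by (intro agree_mult agree_upt) auto
  then show ?thesis unfolding C_prod_def by (rule agree_map_prod)
qed

lemma min_n:
  assumes "u \<in> W n" shows "u \<in> W (min_n u)" "min_n u \<le> n"
  unfolding min_n_def using assms by (auto intro: LeastI Least_le)

lemma parabolic_letters:
  assumes "u \<in> W n" shows "u \<in> parabolic {..<min_n u}"
  using red_words_letters[OF min_n(1)[OF assms]] W_subset_W_inf[OF assms] by (simp add: parabolic_def)

lemma parabolic_fixes_below:
  assumes "u \<in> W n" "fixes_below c u" shows "u \<in> parabolic {c<..<min_n u}"
  using parabolic_letters[OF assms(1)] fixes_below_letters[OF assms(2)] by (fastforce simp: parabolic_def)

lemma bracket_eq_ncoef: "\<xi> \<in> free_carrier n \<Longrightarrow> w \<in> W n \<Longrightarrow> bracket n \<xi> w = ncoef w (nil_class \<xi>)"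
  by (simp add: bracket_eq_coef coef_eq_ncoef)

lemma stanley_var_block:
  assumes u: "u \<in> W n" "fixes_below (a (i - 1)) u" and a: "a (i - 1) \<le> a i"
  shows "stanley u (var_block a v i) = ncoef u (A_block n (a (i - 1)) (a i) v)"
proof -
  let ?m = "min_n u"
  have "bracket ?m (A_upto N ?m (var_block a v i)) u = ncoef u (A_block n (a (i - 1)) (a i) v)" if "N \<ge> a i" for N
  proof -
    have "bracket ?m (A_upto N ?m (var_block a v i)) u = ncoef u (\<Prod>k\<leftarrow>[a (i - 1) + 1..<a i + 1]. A_class ?m 1 (v k))"
      unfolding bracket_eq_ncoef[OF free_carrier_upto(2) min_n(1)[OF u(1)]] nil_class_upto
      by (subst prod_var_block[OF a that]) simp_all
    then show ?thesis
      using agree_blocks(1)[OF subset_refl min_n(2)[OF u(1)], where c = "a (i - 1)" and d = "a i" and v = v] parabolic_fixes_below[OF u]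
      by (simp add: agree_def)
  qed
  then show ?thesis
    unfolding stanley_def Let_def by (intro stable_limitI converges_to_eventually[OF converges_to_const])
qed

lemma double_stanley_var_block:
  assumes u: "u \<in> W n" "fixes_below (b (i - 1)) u" and b: "b (i - 1) \<le> b i"
  shows "double_stanley u (\<lambda>_. 0) (var_block b v i) = ncoef u (A_tilde_block n (b (i - 1)) (b i) v)"
proof -
  let ?m = "min_n u"
  have "bracket ?m (A_tilde_upto N ?m (var_block b v i) * A_upto N ?m (\<lambda>_. 0)) u = ncoef u (A_tilde_block n (b (i - 1)) (b i) v)" if "N \<ge> b i" for N
  proof -
    have "bracket ?m (A_tilde_upto N ?m (var_block b v i) * A_upto N ?m (\<lambda>_. 0)) u =
      ncoef u (\<Prod>k\<leftarrow>[b (i - 1) + 1..<b i + 1]. A_tilde_class ?m 1 (v k))"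
      unfolding bracket_eq_ncoef[OF free_carrier_mult[OF free_carrier_upto(3,2)] min_n(1)[OF u(1)]] nil_class_mult nil_class_upto
      by (subst prod_var_block[OF b that]) (simp_all add: prod_list_trivial)
    then show ?thesis
      using agree_blocks(2)[OF subset_refl min_n(2)[OF u(1)], where c = "b (i - 1)" and d = "b i" and v = v] parabolic_fixes_below[OF u]
      by (simp add: agree_def)
  qed
  then show ?thesis
    unfolding double_stanley_def Let_def by (intro stable_limitI converges_to_eventually[OF converges_to_const])
qed

text \<open>The mixed function keeps the infinite alphabet \<open>X\<close>; it is the only factor of the formula that
  is a proper limit.\<close>

lemma mixed_stanley_var_block:
  assumes u: "u \<in> W n" and ab: "a 0 = 0" "b 0 = 0"
  shows "converges_to (\<lambda>N. ncoef u (A_tilde_block n 0 (b 1) z * C_prod N n X * A_block n 0 (a 1) y))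
    (mixed_stanley u X (var_block a y 1) (var_block b z 1))"
proof -
  let ?m = "min_n u"
  let ?g = "\<lambda>N. ncoef u (A_tilde_block n 0 (b 1) z * C_prod N n X * A_block n 0 (a 1) y)"
  let ?f = "\<lambda>N. bracket ?m (A_tilde_upto N ?m (var_block b z 1) * C_upto N ?m X * A_upto N ?m (var_block a y 1)) u"
  obtain F where F: "converges_to ?g F" using ncoef_C_prod_converges by blast
  have "?f N = ?g N" if N: "N \<ge> max (a 1) (b 1)" for N
  proof -
    let ?T = "{..<?m}"
    have "?f N = ncoef u ((\<Prod>k\<leftarrow>[b 0 + 1..<b 1 + 1]. A_tilde_class ?m 1 (z k)) * C_prod N ?m X * (\<Prod>k\<leftarrow>[a 0 + 1..<a 1 + 1]. A_class ?m 1 (y k)))"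
      using N ab prod_var_block[of b 1 N "A_tilde_class ?m 1" z] prod_var_block[of a 1 N "A_class ?m 1" y]
      by (simp add: bracket_eq_ncoef[OF free_carrier_mult[OF free_carrier_mult[OF free_carrier_upto(3,1)] free_carrier_upto(2)] min_n(1)[OF u]] nil_class_mult nil_class_upto)
    also have "\<dots> = ?g N"
    proof -
      have "agree ?T (\<Prod>k\<leftarrow>[b 0 + 1..<b 1 + 1]. A_tilde_class ?m 1 (z k)) (A_tilde_block n 0 (b 1) z)"
        "agree ?T (\<Prod>k\<leftarrow>[a 0 + 1..<a 1 + 1]. A_class ?m 1 (y k)) (A_block n 0 (a 1) y)"
        unfolding A_block_def A_tilde_block_def A_class_def A_tilde_class_def ab using min_n(2)[OF u]
        by (intro agree_map_prod agree_upt; force)+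
      then have "agree ?T ((\<Prod>k\<leftarrow>[b 0 + 1..<b 1 + 1]. A_tilde_class ?m 1 (z k)) * C_prod N ?m X * (\<Prod>k\<leftarrow>[a 0 + 1..<a 1 + 1]. A_class ?m 1 (y k)))
        (A_tilde_block n 0 (b 1) z * C_prod N n X * A_block n 0 (a 1) y)"
        by (intro agree_mult agree_C_prod[OF subset_refl min_n(2)[OF u]])
      then show ?thesis using parabolic_letters[OF u] unfolding agree_def by blast
    qed
    finally show ?thesis .
  qed
  then have "converges_to ?f F" by (rule converges_to_eventually[OF F])
  then have "mixed_stanley u X (var_block a y 1) (var_block b z 1) = F"
    unfolding mixed_stanley_def Let_def by (rule stable_limitI)
  with F show ?thesis by simp
qed

section \<open>The splitting formula\<close>

lemma prod_split_at:
  fixes g :: "nat \<Rightarrow> 'a::comm_monoid_mult"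
  assumes "1 \<le> p" "1 \<le> q"
  shows "(\<Prod>k<p + q - 1. g k) = (\<Prod>j=1..<q. g (j - 1)) * g (q - 1) * (\<Prod>i=2..p. g (q + i - 2))"
proof -
  have "(\<Prod>k<p + q - 1. g k) = (\<Prod>k<q - 1. g k) * (\<Prod>k=q - 1..<p + q - 1. g k)"
    by (subst prod.union_disjoint[symmetric]) (auto intro: prod.cong)
  also have "(\<Prod>k=q - 1..<p + q - 1. g k) = g (q - 1) * (\<Prod>k=q..<p + q - 1. g k)"
    using assms by (subst prod.atLeast_Suc_lessThan) auto
  also have "(\<Prod>k<q - 1. g k) = (\<Prod>j=1..<q. g (j - 1))"
    by (rule prod.reindex_bij_witness[where i = "\<lambda>j. j - 1" and j = Suc]) auto
  also have "(\<Prod>k=q..<p + q - 1. g k) = (\<Prod>i=2..p. g (q + i - 2))"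
    by (rule prod.reindex_bij_witness[where i = "\<lambda>i. q + i - 2" and j = "\<lambda>k. k + 2 - q"]) (use assms in auto)
  finally show ?thesis by (simp add: mult.assoc)
qed

theorem proposition3p9:
  fixes p q :: nat and a b :: "nat \<Rightarrow> nat" and w :: "int \<Rightarrow> int"
  assumes "p \<ge> 1" and "q \<ge> 1"
    and "strict_mono_on {1..p} a" and "strict_mono_on {1..q} b"
    and "a 0 = 0" and "b 0 = 0"
    and "w \<in> W_inf"
    and "compatible w p a" and "compatible (inv w) q b"
  shows "double_schubert w X Y Z =
    (\<Sum>us\<in>compatible_factorizations p a q b w.
      (\<Prod>j=1..<q. double_stanley (entry us j) (\<lambda>_. 0) (var_block b Z (q + 1 - j))) *
      mixed_stanley (entry us q) X (var_block a Y 1) (var_block b Z 1) *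
      (\<Prod>i=2..p. stanley (entry us (q + i - 1)) (var_block a Y i)))"
proof -
  note p = assms(1) and q = assms(2) and w = assms(7)
  define n where "n = min_n w"
  have wn: "w \<in> W n" using w min_n(1) unfolding n_def W_inf_def by blast
  have has_descent: "\<And>r. has_descent w r \<Longrightarrow> r \<in> a ` {1..p}" "\<And>r. has_descent (inv w) r \<Longrightarrow> r \<in> b ` {1..q}"
    using assms(8,9) descents_iff[OF w] descents_iff[OF inv_in_W_inf[OF w]] by (auto simp: compatible_def)
  have le: "c (i - 1) \<le> c i" if "strict_mono_on {1..m} c" "c 0 = 0" "i \<in> {1..m}" for c :: "nat \<Rightarrow> nat" and m i
  proof (cases "i = 1")
    case False
    then have "i - 1 \<in> {1..m}" "i - 1 < i" using that(3) by auto
    with strict_mono_onD[OF that(1)] that(3) show ?thesis by (simp add: less_imp_le)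
  qed (simp add: that(2))
  note a_le = le[OF assms(3,5)] and b_le = le[OF assms(4,6)]
  let ?E = "\<lambda>i. A_block n (a (i - 1)) (a i) Y"
  let ?Et = "\<lambda>i. A_tilde_block n (b (i - 1)) (b i) Z"
  let ?mid = "\<lambda>N. A_tilde_block n 0 (b 1) Z * C_prod N n X * A_block n 0 (a 1) Y"
  let ?\<xi>s = "\<lambda>N. map ?Et (rev [2..<q + 1]) @ [?mid N] @ map ?E [2..<p + 1]"
  let ?term = "\<lambda>us N. (\<Prod>j=1..<q. ncoef (entry us j) (?Et (q + 1 - j))) * ncoef (entry us q) (?mid N) *
      (\<Prod>i=2..p. ncoef (entry us (q + i - 1)) (?E i))"
  have C_prod_unipotent: "C_prod N n X \<in> unipotent {..<n}" for N
  proof -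
    have "C_class n (X k) \<in> unipotent {..<n}" for k
      unfolding C_class_def by (rule unipotent_prod_list) (auto intro: unipotent_hfac)
    then show ?thesis unfolding C_prod_def by (intro unipotent_prod_list) auto
  qed
  \<comment> \<open>For a fixed number \<open>N\<close> of \<open>X\<close> variables, both staircases are merged into blocks. The first
    blocks on either side are kept together with the \<open>X\<close> part.\<close>
  have "bracket n ((\<Prod>i\<leftarrow>rev [1..<n]. A_tilde_fac n i (Z i)) * C_upto N n X * (\<Prod>i\<leftarrow>[1..<n]. A_fac n i (Y i))) w =
    ncoef w (prod_list (?\<xi>s N))" for N
  proof -
    let ?Zs = "\<Prod>i\<leftarrow>rev [1..<n]. A_tilde_class n i (Z i)"
    let ?Ys = "\<Prod>i\<leftarrow>[1..<n]. A_class n i (Y i)"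
    let ?Es = "\<Prod>k\<leftarrow>[1..<p + 1]. ?E k"
    have "bracket n ((\<Prod>i\<leftarrow>rev [1..<n]. A_tilde_fac n i (Z i)) * C_upto N n X * (\<Prod>i\<leftarrow>[1..<n]. A_fac n i (Y i))) w =
      ncoef w (?Zs * C_prod N n X * ?Ys)"
    proof (subst bracket_eq_ncoef[OF _ wn])
      show "(\<Prod>i\<leftarrow>rev [1..<n]. A_tilde_fac n i (Z i)) * C_upto N n X * (\<Prod>i\<leftarrow>[1..<n]. A_fac n i (Y i)) \<in> free_carrier n"
        by (intro free_carrier_mult free_carrier_upto free_carrier_prod_list) (force intro: free_carrier_factors)+
    qed (simp add: nil_class_mult nil_class_prod_list nil_class_upto o_def nil_class_A_fac nil_class_A_tilde_fac)
    also have "\<dots> = ncoef w (?Zs * C_prod N n X * ?Es)"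
      by (rule right_block_reduction[OF w p assms(3,5) has_descent(1)])
    also have "\<dots> = ncoef w (?Zs * (C_prod N n X * ?Es))" by (simp only: mult.assoc)
    also have "\<dots> = ncoef w ((\<Prod>k\<leftarrow>rev [1..<q + 1]. ?Et k) * (C_prod N n X * ?Es))"
    proof (rule left_block_reduction[OF w q assms(4,6) has_descent(2)])
      have "?E k \<in> unipotent {..<n}" for k
        using A_block_unipotent by (rule subsetD[OF unipotent_subset, rotated]) auto
      then have "?Es \<in> unipotent {..<n}" by (intro unipotent_prod_list) auto
      with C_prod_unipotent show "C_prod N n X * ?Es \<in> unipotent {..<n}" by (rule unipotent_mult)
    qed
    also have "(\<Prod>k\<leftarrow>rev [1..<q + 1]. ?Et k) * (C_prod N n X * ?Es) = prod_list (?\<xi>s N)"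
    proof -
      have "[1..<m + 1] = 1 # [2..<m + 1]" if "1 \<le> m" for m :: nat
        using that upt_conv_Cons[of 1 "m + 1"] by (simp add: numeral_2_eq_2 del: upt_Suc)
      note this[OF p] this[OF q]
      then show ?thesis by (simp only:) (simp add: assms(5,6) mult.assoc del: upt_Suc)
    qed
    finally show ?thesis .
  qed
  \<comment> \<open>The product is expanded over all reduced factorizations.\<close>
  also have "ncoef w (prod_list (?\<xi>s N)) = (\<Sum>us\<in>compatible_factorizations p a q b w. ?term us N)" for N
  proof -
    have len: "length (?\<xi>s N) = p + q - 1" using p q by (simp del: upt_Suc)
    have nth_left: "?\<xi>s N ! (j - 1) = ?Et (q + 1 - j)" if "j \<in> {1..<q}" for j
    proof -
      have "j - 1 < length (rev [2..<q + 1])" using that by auto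
      moreover from this have "rev [2..<q + 1] ! (j - 1) = q + 1 - j"
        using that by (subst rev_nth) (auto simp del: upt_Suc)
      ultimately show ?thesis by (simp only: nth_append length_map nth_map if_True)
    qed
    have nth_mid: "?\<xi>s N ! (q - 1) = ?mid N" using q by (simp add: nth_append del: upt_Suc)
    have nth_right: "?\<xi>s N ! (q + i - 2) = ?E i" if "i \<in> {2..p}" for i
    proof -
      have "q + i - 2 = length (map ?Et (rev [2..<q + 1]) @ [?mid N]) + (i - 2)" using that q by (simp del: upt_Suc)
      then have "?\<xi>s N ! (q + i - 2) = map ?E [2..<p + 1] ! (i - 2)"
        by (simp only: nth_append_length_plus append_assoc[symmetric])
      moreover have "i - 2 < length [2..<p + 1]" "[2..<p + 1] ! (i - 2) = i"
        using that by (auto simp del: upt_Suc)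
      ultimately show ?thesis by (simp only: nth_map)
    qed
    have term_eq: "(\<Prod>k<p + q - 1. ncoef (us ! k) (?\<xi>s N ! k)) = ?term us N" for us
      unfolding prod_split_at[OF p q]
      by (intro arg_cong2[where f = "(*)"] prod.cong refl)
        (simp_all only: nth_left nth_mid nth_right entry_def, simp_all add: numeral_2_eq_2)
    have sub: "compatible_factorizations p a q b w \<subseteq> factorizations (p + q - 1) w"
      by (auto simp: compatible_factorizations_def factorizations_def)
    have "ncoef w (prod_list (?\<xi>s N)) = (\<Sum>us\<in>factorizations (p + q - 1) w. ?term us N)"
      unfolding ncoef_prod_list[OF w] len term_eq ..
    also have "\<dots> = (\<Sum>us\<in>compatible_factorizations p a q b w. ?term us N)"
    proof (rule sum.mono_neutral_right[OF finite_factorizations[OF w] sub], rule ballI, rule ccontr)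
      \<comment> \<open>A nonvanishing term is compatible, since a block only involves letters beyond its first
        position.\<close>
      fix us assume us: "us \<in> factorizations (p + q - 1) w - compatible_factorizations p a q b w"
        and nz: "?term us N \<noteq> 0"
      have inf: "entry us j \<in> W_inf" if "j \<in> {1..p + q - 1}" for j
      proof -
        have "entry us j \<in> set us" using us that by (auto simp: factorizations_def entry_def)
        moreover have "set us \<subseteq> W_inf" using us by (simp add: factorizations_def reduced_factorization_def)
        ultimately show ?thesis by blast
      qed
      have left: "fixes_below (b (q - j)) (entry us j)" if "j \<in> {1..<q}" for j
      proof -
        have j: "j \<in> {1..p + q - 1}" using that p unfolding atLeastAtMost_iff atLeastLessThan_iff by linarith
        have "ncoef (entry us j) (?Et (q + 1 - j)) \<noteq> 0"
          using nz that by (metis (no_types, lifting) finite_atLeastLessThan mult_zero_left prod_zero)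
        from unipotent_ncoef_fixes_below[OF A_tilde_block_unipotent inf[OF j] this] show ?thesis using that p q by simp
      qed
      have right: "fixes_below (a (i - 1)) (entry us (q + i - 1))" if "i \<in> {2..p}" for i
      proof -
        have i: "q + i - 1 \<in> {1..p + q - 1}" using that q unfolding atLeastAtMost_iff by linarith
        have "ncoef (entry us (q + i - 1)) (?E i) \<noteq> 0"
          using nz that by (metis (no_types, lifting) finite_atLeastAtMost mult_zero_right prod_zero)
        from unipotent_ncoef_fixes_below[OF A_block_unipotent inf[OF i] this] show ?thesis using that p q by simp
      qed
      have "us \<in> compatible_factorizations p a q b w"
        unfolding compatible_factorizations_def mem_Collect_eq
      proof (intro conjI ballI)
        show "length us = p + q - 1" "reduced_factorization us w"
          using us by (auto simp: factorizations_def)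
        fix j assume j: "j \<in> {1..p + q - 1}"
        have L: "fixes_below (b (q - j)) (entry us j)" if "j < q" using left[of j] that j by simp
        have R: "fixes_below (a (j - q)) (entry us j)" if "j > q"
        proof -
          have "j - q + 1 \<in> {2..p}" "q + (j - q + 1) - 1 = j" using that j by auto
          with right[of "j - q + 1"] show ?thesis by simp
        qed
        show "j \<noteq> q \<longrightarrow> entry us j \<in> S_inf"
          using L R by (cases "j < q") (auto simp: fixes_below_def)
        show "j < q \<longrightarrow> (\<forall>i\<in>{1..b (q - j)}. entry us j (int i) = int i)"
          using L by (auto simp: fixes_below_def)
        show "q < j \<longrightarrow> (\<forall>i\<in>{1..a (j - q)}. entry us j (int i) = int i)"
          using R by (auto simp: fixes_below_def)
      qed
      with us show False by blast
    qed
    finally show ?thesis .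
  qed
  finally have "double_schubert w X Y Z = stable_limit (\<lambda>N. \<Sum>us\<in>compatible_factorizations p a q b w. ?term us N)"
    unfolding double_schubert_def Let_def n_def[symmetric] by simp
  also have "\<dots> = (\<Sum>us\<in>compatible_factorizations p a q b w.
      (\<Prod>j=1..<q. double_stanley (entry us j) (\<lambda>_. 0) (var_block b Z (q + 1 - j))) *
      mixed_stanley (entry us q) X (var_block a Y 1) (var_block b Z 1) *
      (\<Prod>i=2..p. stanley (entry us (q + i - 1)) (var_block a Y i)))"
  proof (intro stable_limitI converges_to_sum)
    fix us assume us: "us \<in> compatible_factorizations p a q b w"
    have fac: "us \<in> factorizations (p + q - 1) w"
      and comp: "\<And>j. j \<in> {1..p + q - 1} \<Longrightarrow> j \<noteq> q \<Longrightarrow> fixes_below (if j < q then b (q - j) else a (j - q)) (entry us j)"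
      using us by (auto simp: compatible_factorizations_def factorizations_def fixes_below_def)
    have inW: "entry us j \<in> W n" if "j \<in> {1..p + q - 1}" for j
    proof -
      have "entry us j \<in> set us" using fac that by (auto simp: factorizations_def entry_def)
      with factorizations_W[OF wn fac] show ?thesis by blast
    qed
    have left_eq: "(\<Prod>j=1..<q. ncoef (entry us j) (?Et (q + 1 - j))) =
      (\<Prod>j=1..<q. double_stanley (entry us j) (\<lambda>_. 0) (var_block b Z (q + 1 - j)))"
    proof (intro prod.cong refl)
      fix j assume j: "j \<in> {1..<q}"
      then have j': "j \<in> {1..p + q - 1}" using p j unfolding atLeastAtMost_iff atLeastLessThan_iff by linarith
      then have "fixes_below (b (q + 1 - j - 1)) (entry us j)" using comp[of j] j by simp
      then show "ncoef (entry us j) (?Et (q + 1 - j)) = double_stanley (entry us j) (\<lambda>_. 0) (var_block b Z (q + 1 - j))"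
        using j by (intro double_stanley_var_block[symmetric] inW[OF j'] b_le) auto
    qed
    have right_eq: "(\<Prod>i=2..p. ncoef (entry us (q + i - 1)) (?E i)) =
      (\<Prod>i=2..p. stanley (entry us (q + i - 1)) (var_block a Y i))"
    proof (intro prod.cong refl)
      fix i assume i: "i \<in> {2..p}"
      have i': "q + i - 1 \<in> {1..p + q - 1}" using i q unfolding atLeastAtMost_iff by linarith
      have "q + i - 1 \<noteq> q" "\<not> q + i - 1 < q" "q + i - 1 - q = i - 1" using i by auto
      with comp[OF i'] have "fixes_below (a (i - 1)) (entry us (q + i - 1))" by simp
      then show "ncoef (entry us (q + i - 1)) (?E i) = stanley (entry us (q + i - 1)) (var_block a Y i)"
        using i by (intro stanley_var_block[symmetric] inW[OF i'] a_le) auto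
    qed
    let ?D = "\<Prod>j=1..<q. double_stanley (entry us j) (\<lambda>_. 0) (var_block b Z (q + 1 - j))"
      and ?M = "mixed_stanley (entry us q) X (var_block a Y 1) (var_block b Z 1)"
      and ?S = "\<Prod>i=2..p. stanley (entry us (q + i - 1)) (var_block a Y i)"
    have swap: "x * y * z = x * z * y" for x y z :: "(var, int) mseries"
      by (simp add: ac_simps)
    have "q \<in> {1..p + q - 1}" using p q by simp
    from converges_to_mult_left[OF mixed_stanley_var_block[of _ n a b Z Y, OF inW[OF this] assms(5,6)]]
    have "converges_to (\<lambda>N. ?D * ?S * ncoef (entry us q) (?mid N)) (?D * ?S * ?M)" .
    then show "converges_to (?term us) (?D * ?M * ?S)"
      unfolding left_eq right_eq swap[of ?D _ ?S] .
  qed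
  finally show ?thesis .
qed

end
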